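(* Let $G$ be a connected complex Lie group and $\vec A$ an automorphic system in $G$, complex analytic over $S^\times$. Let $\mathcal O_{S^\times\times G}^{\vec A}$ be the sheaf of first integrals of $\vec A$. Then the transversal symmetries of $\vec A$ are the left invariant vector fields with coefficients in $\mathcal O^{\vec A}_{S^\times\times G}$: $$\mathrm{Trans}(\vec A)=\mathcal L(G)\otimes_{\mathbb C}\mathcal O^{\vec A}_{S^\times\times G}.$$
   Context: $S^\times$ is a connected Riemann surface with a derivation $\partial$ given by a nowhere vanishing holomorphic vector field. $\vec A=\partial+\sum_{i=1}^s f_i(t)\vec A_i$ is a vector field on $S^\times\times G$ with $f_i\in\mathcal O(S^\times)$ and $\vec A_i$ right-invariant vector fields on $G$. $\mathcal L(G)$ is the Lie algebra of left-invariant holomorphic vector fields on $G$, regarded as vector fields on $S^\times\times G$. A holomorphic vector field on an open subset of $S^\times\times G$ is transversal if it is tangent to the fibers of the projection onto $S^\times$. $\mathrm{Trans}(\vec A)$ is the sheaf on $S^\times\times G$ of transversal vector fields $\vec L$ that are symmetries of $\vec A$, i.e. with $[\vec L,\vec A]=\lambda\vec A$ for some function $\lambda$ (equivalently, for transversal $\vec L$, $[\vec L,\vec A]=0$). $\mathcal O^{\vec A}_{S^\times\times G}$ is the sheaf of holomorphic functions $F$ on open subsets of $S^\times\times G$ with $\vec A F=0$. *)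

theory Defs
  imports
    "HOL-Analysis.Analysis"
    "HOL-Algebra.Group"
    "HOL-Library.Function_Algebras"
    "HOL-Library.Poly_Mapping"
begin

section \<open>Holomorphic functions of several variables\<close>

text \<open>
  As in \<^const>\<open>Euclidean_space\<close>, the space of dimension \<open>n\<close> consists of the sequences
  that vanish from index \<open>n\<close> on; this admits \<open>n = 0\<close> and lets dimensions be added. Its topology
  is the subspace topology of the product topology on \<^typ>\<open>nat \<Rightarrow> complex\<close>.
\<close>

definition Cspace :: "nat \<Rightarrow> (nat \<Rightarrow> complex) set" where
  "Cspace n = {x. \<forall>i\<ge>n. x i = 0}"

text \<open>
  Holomorphic: continuous, and holomorphic in each variable separately. \<open>D\<close> is meant to be an
  open subset of \<^term>\<open>Cspace n\<close>.
\<close>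

definition holomorphic_Cspace :: "nat \<Rightarrow> ((nat \<Rightarrow> complex) \<Rightarrow> complex) \<Rightarrow> (nat \<Rightarrow> complex) set \<Rightarrow> bool" where
  "holomorphic_Cspace n f D \<longleftrightarrow>
     continuous_on D f \<and>
     (\<forall>x\<in>D. \<forall>i<n. (\<lambda>z. f (x(i := z))) field_differentiable (at (x i)))"


section \<open>Complex manifolds\<close>

text \<open>
  The underlying space of a manifold is a Hausdorff topological type. An atlas is a set of pairs of
  a chart domain and a chart; the values of a chart outside its domain are irrelevant.
\<close>

record 'a cmanifold =
  cdim :: nat
  atlas :: "('a set \<times> ('a \<Rightarrow> nat \<Rightarrow> complex)) set"

definition hol_on :: "('a::topological_space) cmanifold \<Rightarrow> ('a \<Rightarrow> complex) \<Rightarrow> 'a set \<Rightarrow> bool" where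
  "hol_on M f W \<longleftrightarrow>
     (\<forall>(U, \<phi>)\<in>atlas M. holomorphic_Cspace (cdim M) (f \<circ> inv_into U \<phi>) (\<phi> ` (U \<inter> W)))"

definition complex_manifold :: "('a::t2_space) cmanifold \<Rightarrow> bool" where
  "complex_manifold M \<longleftrightarrow>
     (\<Union>(U, \<phi>)\<in>atlas M. U) = UNIV \<and>
     (\<forall>(U, \<phi>)\<in>atlas M.
        open U \<and> openin (top_of_set (Cspace (cdim M))) (\<phi> ` U) \<and>
        (\<exists>\<psi>. homeomorphism U (\<phi> ` U) \<phi> \<psi>)) \<and>
     (\<forall>(U, \<phi>)\<in>atlas M. \<forall>(V, \<psi>)\<in>atlas M. \<forall>i<cdim M.
        holomorphic_Cspace (cdim M) (\<lambda>x. \<psi> (inv_into U \<phi> x) i) (\<phi> ` (U \<inter> V)))"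

definition hol_near :: "('a::topological_space) cmanifold \<Rightarrow> 'a \<Rightarrow> ('a \<Rightarrow> complex) \<Rightarrow> bool" where
  "hol_near M p f \<longleftrightarrow> (\<exists>U. open U \<and> p \<in> U \<and> hol_on M f U)"

definition hol_map ::
  "('a::topological_space) cmanifold \<Rightarrow> ('b::topological_space) cmanifold \<Rightarrow> ('a \<Rightarrow> 'b) \<Rightarrow> bool" where
  "hol_map M N \<Phi> \<longleftrightarrow>
     continuous_on UNIV \<Phi> \<and>
     (\<forall>V h. open V \<longrightarrow> hol_on N h V \<longrightarrow> hol_on M (h \<circ> \<Phi>) (\<Phi> -` V))"

definition prod_manifold ::
  "'a cmanifold \<Rightarrow> 'b cmanifold \<Rightarrow> ('a \<times> 'b) cmanifold" where
  "prod_manifold M N =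
     \<lparr> cdim = cdim M + cdim N,
       atlas = {(U \<times> V, \<lambda>(x, y) i. if i < cdim M then \<phi> x i else \<psi> y (i - cdim M)) | U \<phi> V \<psi>.
                  (U, \<phi>) \<in> atlas M \<and> (V, \<psi>) \<in> atlas N} \<rparr>"

definition riemann_surface :: "('a::t2_space) cmanifold \<Rightarrow> bool" where
  "riemann_surface M \<longleftrightarrow> complex_manifold M \<and> cdim M = 1"

definition complex_lie_group :: "('g::t2_space) cmanifold \<Rightarrow> 'g monoid \<Rightarrow> bool" where
  "complex_lie_group M G \<longleftrightarrow>
     complex_manifold M \<and> group G \<and> carrier G = UNIV \<and>
     hol_map (prod_manifold M M) M (\<lambda>(x, y). x \<otimes>\<^bsub>G\<^esub> y) \<and>
     hol_map M M (\<lambda>x. inv\<^bsub>G\<^esub> x)"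


section \<open>Holomorphic vector fields\<close>

text \<open>
  A tangent vector at \<open>p\<close> is a derivation of the algebra of germs at \<open>p\<close> of holomorphic functions.
  It is represented by a functional on all functions that is \<open>0\<close> on the functions not holomorphic
  near \<open>p\<close>, so that equality of functionals is equality of derivations.
\<close>

definition tangent_vector ::
  "('a::topological_space) cmanifold \<Rightarrow> 'a \<Rightarrow> (('a \<Rightarrow> complex) \<Rightarrow> complex) \<Rightarrow> bool" where
  "tangent_vector M p v \<longleftrightarrow>
     (\<forall>f g. hol_near M p f \<longrightarrow> hol_near M p g \<longrightarrow>
        v (\<lambda>x. f x + g x) = v f + v g \<and>
        v (\<lambda>x. f x * g x) = f p * v g + g p * v f) \<and>
     (\<forall>c f. hol_near M p f \<longrightarrow> v (\<lambda>x. c * f x) = c * v f) \<and>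
     (\<forall>f g. hol_near M p f \<longrightarrow> hol_near M p g \<longrightarrow> (\<forall>\<^sub>F x in nhds p. f x = g x) \<longrightarrow> v f = v g) \<and>
     (\<forall>f. \<not> hol_near M p f \<longrightarrow> v f = 0)"

type_synonym 'a vfield = "'a \<Rightarrow> ('a \<Rightarrow> complex) \<Rightarrow> complex"

text \<open>
  Sections over an open set \<open>W\<close>, of functions as well as of vector fields, are represented by
  functions that are \<open>0\<close> outside \<open>W\<close>.
\<close>

definition vector_fields :: "('a::topological_space) cmanifold \<Rightarrow> 'a set \<Rightarrow> 'a vfield set" where
  "vector_fields M W =
     {X. (\<forall>p\<in>W. tangent_vector M p (X p)) \<and> (\<forall>p. p \<notin> W \<longrightarrow> X p = 0) \<and>
         (\<forall>V f. open V \<longrightarrow> V \<subseteq> W \<longrightarrow> hol_on M f V \<longrightarrow> hol_on M (\<lambda>p. X p f) V)}"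

definition restr :: "'a set \<Rightarrow> ('a \<Rightarrow> 'b::zero) \<Rightarrow> 'a \<Rightarrow> 'b" where
  "restr V X = (\<lambda>p. if p \<in> V then X p else 0)"

definition bracket :: "('a::topological_space) cmanifold \<Rightarrow> 'a vfield \<Rightarrow> 'a vfield \<Rightarrow> 'a vfield" where
  "bracket M X Y =
     (\<lambda>p f. if hol_near M p f then X p (\<lambda>q. Y q f) - Y p (\<lambda>q. X q f) else 0)"

text \<open>
  A vector field on a factor, regarded as a vector field on the product, differentiates in
  the direction of that factor with the other variable frozen.
\<close>

definition lift_fst :: "('s::topological_space) cmanifold \<Rightarrow> ('g::topological_space) cmanifold \<Rightarrow>
    's vfield \<Rightarrow> ('s \<times> 'g) vfield" where
  "lift_fst M N X =
     (\<lambda>(t, g) F. if hol_near (prod_manifold M N) (t, g) F then X t (\<lambda>t'. F (t', g)) else 0)"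

definition lift_snd :: "('s::topological_space) cmanifold \<Rightarrow> ('g::topological_space) cmanifold \<Rightarrow>
    'g vfield \<Rightarrow> ('s \<times> 'g) vfield" where
  "lift_snd M N X =
     (\<lambda>(t, g) F. if hol_near (prod_manifold M N) (t, g) F then X g (\<lambda>g'. F (t, g')) else 0)"

text \<open>Tangent to the fibres of the first projection: annihilated by its differential.\<close>

definition transversal_on :: "('s::topological_space) cmanifold \<Rightarrow> ('s \<times> 'g) set \<Rightarrow> ('s \<times> 'g) vfield \<Rightarrow> bool" where
  "transversal_on M W X \<longleftrightarrow> (\<forall>p\<in>W. \<forall>h. hol_near M (fst p) h \<longrightarrow> X p (\<lambda>q. h (fst q)) = 0)"


section \<open>Invariant vector fields and automorphic systems\<close>

text \<open>Both invariance conditions say that the differential of every translation preserves \<open>X\<close>.\<close>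

definition left_invariant_fields :: "('g::topological_space) cmanifold \<Rightarrow> 'g monoid \<Rightarrow> 'g vfield set" where
  "left_invariant_fields M G =
     {X \<in> vector_fields M UNIV.
        \<forall>h g f. hol_near M (h \<otimes>\<^bsub>G\<^esub> g) f \<longrightarrow> X g (\<lambda>x. f (h \<otimes>\<^bsub>G\<^esub> x)) = X (h \<otimes>\<^bsub>G\<^esub> g) f}"

definition right_invariant_fields :: "('g::topological_space) cmanifold \<Rightarrow> 'g monoid \<Rightarrow> 'g vfield set" where
  "right_invariant_fields M G =
     {X \<in> vector_fields M UNIV.
        \<forall>h g f. hol_near M (g \<otimes>\<^bsub>G\<^esub> h) f \<longrightarrow> X g (\<lambda>x. f (x \<otimes>\<^bsub>G\<^esub> h)) = X (g \<otimes>\<^bsub>G\<^esub> h) f}"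

definition automorphic_system :: "('s::topological_space) cmanifold \<Rightarrow> 's vfield \<Rightarrow>
    ('g::topological_space) cmanifold \<Rightarrow> 'g monoid \<Rightarrow> ('s \<times> 'g) vfield \<Rightarrow> bool" where
  "automorphic_system M D N G A \<longleftrightarrow>
     (\<exists>(s::nat) f X.
        (\<forall>i\<in>{1..s}. hol_on M (f i) UNIV \<and> X i \<in> right_invariant_fields N G) \<and>
        A = (\<lambda>(t, g) F. lift_fst M N D (t, g) F +
                        (\<Sum>i=1..s. f i t * lift_snd M N (X i) (t, g) F)))"

definition first_integrals :: "('a::topological_space) cmanifold \<Rightarrow> 'a vfield \<Rightarrow> 'a set \<Rightarrow> ('a \<Rightarrow> complex) set" where
  "first_integrals M A W =
     {F. hol_on M F W \<and> (\<forall>p. p \<notin> W \<longrightarrow> F p = 0) \<and> (\<forall>p\<in>W. A p F = 0)}"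

definition Trans :: "('s::topological_space) cmanifold \<Rightarrow> ('g::topological_space) cmanifold \<Rightarrow>
    ('s \<times> 'g) vfield \<Rightarrow> ('s \<times> 'g) set \<Rightarrow> ('s \<times> 'g) vfield set" where
  "Trans M N A W =
     {L \<in> vector_fields (prod_manifold M N) W. transversal_on M W L \<and>
        (\<exists>l. \<forall>p\<in>W. \<forall>f. bracket (prod_manifold M N) L A p f = l p * A p f)}"


section \<open>Tensor products of complex vector spaces\<close>

text \<open>
  \<open>V\<close> and \<open>W\<close> are complex subspaces of additive groups with scalar multiplications \<open>s1\<close> and \<open>s2\<close>.
  Their tensor product is the free complex vector space on \<open>V \<times> W\<close> modulo the span of the
  bilinearity relations; its elements are cosets.
\<close>

definition free_scale :: "complex \<Rightarrow> ('a \<Rightarrow>\<^sub>0 complex) \<Rightarrow> ('a \<Rightarrow>\<^sub>0 complex)" where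
  "free_scale c = Poly_Mapping.map (\<lambda>z. c * z)"

definition formal_sums :: "'a set \<Rightarrow> 'b set \<Rightarrow> (('a \<times> 'b) \<Rightarrow>\<^sub>0 complex) set" where
  "formal_sums V W = {u. Poly_Mapping.keys u \<subseteq> V \<times> W}"

abbreviation free_pair :: "'a \<Rightarrow> 'b \<Rightarrow> ('a \<times> 'b) \<Rightarrow>\<^sub>0 complex" where
  "free_pair v w \<equiv> Poly_Mapping.single (v, w) 1"

definition bilinear_relations :: "(complex \<Rightarrow> 'a \<Rightarrow> 'a) \<Rightarrow> (complex \<Rightarrow> 'b \<Rightarrow> 'b) \<Rightarrow>
    ('a::ab_group_add) set \<Rightarrow> ('b::ab_group_add) set \<Rightarrow> (('a \<times> 'b) \<Rightarrow>\<^sub>0 complex) set" where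
  "bilinear_relations s1 s2 V W =
     module.span free_scale
       ({free_pair (v + v') w - free_pair v w - free_pair v' w | v v' w. v \<in> V \<and> v' \<in> V \<and> w \<in> W} \<union>
        {free_pair v (w + w') - free_pair v w - free_pair v w' | v w w'. v \<in> V \<and> w \<in> W \<and> w' \<in> W} \<union>
        {free_pair (s1 c v) w - free_scale c (free_pair v w) | c v w. v \<in> V \<and> w \<in> W} \<union>
        {free_pair v (s2 c w) - free_scale c (free_pair v w) | c v w. v \<in> V \<and> w \<in> W})"

definition tensor_class :: "(complex \<Rightarrow> 'a \<Rightarrow> 'a) \<Rightarrow> (complex \<Rightarrow> 'b \<Rightarrow> 'b) \<Rightarrow>
    ('a::ab_group_add) set \<Rightarrow> ('b::ab_group_add) set \<Rightarrow> (('a \<times> 'b) \<Rightarrow>\<^sub>0 complex) \<Rightarrow>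
    (('a \<times> 'b) \<Rightarrow>\<^sub>0 complex) set" where
  "tensor_class s1 s2 V W u = {u' \<in> formal_sums V W. u' - u \<in> bilinear_relations s1 s2 V W}"

definition tensor :: "(complex \<Rightarrow> 'a \<Rightarrow> 'a) \<Rightarrow> (complex \<Rightarrow> 'b \<Rightarrow> 'b) \<Rightarrow>
    ('a::ab_group_add) set \<Rightarrow> ('b::ab_group_add) set \<Rightarrow> (('a \<times> 'b) \<Rightarrow>\<^sub>0 complex) set set" where
  "tensor s1 s2 V W = tensor_class s1 s2 V W ` formal_sums V W"

definition formal_eval :: "(complex \<Rightarrow> 'c \<Rightarrow> 'c) \<Rightarrow> ('a \<Rightarrow> 'b \<Rightarrow> 'c) \<Rightarrow>
    (('a \<times> 'b) \<Rightarrow>\<^sub>0 complex) \<Rightarrow> 'c::comm_monoid_add" where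
  "formal_eval s b u = (\<Sum>(v, w)\<in>Poly_Mapping.keys u. s (Poly_Mapping.lookup u (v, w)) (b v w))"

text \<open>
  The linear map on the tensor product induced by a bilinear map \<open>b\<close>; the image in question is
  a singleton exactly when \<open>b\<close> respects the relations.
\<close>

definition tensor_lift :: "(complex \<Rightarrow> 'c \<Rightarrow> 'c) \<Rightarrow> ('a \<Rightarrow> 'b \<Rightarrow> 'c) \<Rightarrow>
    (('a \<times> 'b) \<Rightarrow>\<^sub>0 complex) set \<Rightarrow> 'c::comm_monoid_add" where
  "tensor_lift s b T = the_elem (formal_eval s b ` T)"


section \<open>The sheaf of left invariant fields with first integrals as coefficients\<close>

definition fun_scale :: "complex \<Rightarrow> ('a \<Rightarrow> complex) \<Rightarrow> 'a \<Rightarrow> complex" where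
  "fun_scale c F = (\<lambda>p. c * F p)"

definition vfield_scale :: "complex \<Rightarrow> 'a vfield \<Rightarrow> 'a vfield" where
  "vfield_scale c X = (\<lambda>p f. c * X p f)"

definition LO_class :: "('s::topological_space) cmanifold \<Rightarrow> ('g::topological_space) cmanifold \<Rightarrow>
    'g monoid \<Rightarrow> ('s \<times> 'g) vfield \<Rightarrow> ('s \<times> 'g) set \<Rightarrow>
    (('g vfield \<times> ('s \<times> 'g \<Rightarrow> complex)) \<Rightarrow>\<^sub>0 complex) \<Rightarrow>
    (('g vfield \<times> ('s \<times> 'g \<Rightarrow> complex)) \<Rightarrow>\<^sub>0 complex) set" where
  "LO_class M N G A W =
     tensor_class vfield_scale fun_scale (left_invariant_fields N G)
       (first_integrals (prod_manifold M N) A W)"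

text \<open>
  The sections over \<open>W\<close> of the tensor product sheaf. No sheafification is involved: the space of
  left invariant fields is finite dimensional, so this presheaf is already a sheaf.
\<close>

definition LO :: "('s::topological_space) cmanifold \<Rightarrow> ('g::topological_space) cmanifold \<Rightarrow>
    'g monoid \<Rightarrow> ('s \<times> 'g) vfield \<Rightarrow> ('s \<times> 'g) set \<Rightarrow>
    (('g vfield \<times> ('s \<times> 'g \<Rightarrow> complex)) \<Rightarrow>\<^sub>0 complex) set set" where
  "LO M N G A W =
     tensor vfield_scale fun_scale (left_invariant_fields N G)
       (first_integrals (prod_manifold M N) A W)"

definition LO_restr :: "('s::topological_space) cmanifold \<Rightarrow> ('g::topological_space) cmanifold \<Rightarrow>
    'g monoid \<Rightarrow> ('s \<times> 'g) vfield \<Rightarrow> ('s \<times> 'g) set \<Rightarrow>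
    (('g vfield \<times> ('s \<times> 'g \<Rightarrow> complex)) \<Rightarrow>\<^sub>0 complex) set \<Rightarrow>
    (('g vfield \<times> ('s \<times> 'g \<Rightarrow> complex)) \<Rightarrow>\<^sub>0 complex) set" where
  "LO_restr M N G A V T =
     the_elem ((\<lambda>u. LO_class M N G A V
                  (formal_eval free_scale (\<lambda>L F. free_pair L (restr V F)) u)) ` T)"

text \<open>\<open>L \<otimes> F\<close> is identified with the vector field \<open>F L\<close>, which is \<open>0\<close> wherever \<open>F\<close> is.\<close>

definition field_times :: "('s::topological_space) cmanifold \<Rightarrow> ('g::topological_space) cmanifold \<Rightarrow>
    'g vfield \<Rightarrow> ('s \<times> 'g \<Rightarrow> complex) \<Rightarrow> ('s \<times> 'g) vfield" where
  "field_times M N L F = (\<lambda>p f. F p * lift_snd M N L p f)"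

definition LO_field :: "('s::topological_space) cmanifold \<Rightarrow> ('g::topological_space) cmanifold \<Rightarrow>
    (('g vfield \<times> ('s \<times> 'g \<Rightarrow> complex)) \<Rightarrow>\<^sub>0 complex) set \<Rightarrow> ('s \<times> 'g) vfield" where
  "LO_field M N = tensor_lift vfield_scale (field_times M N)"

end

theory Submission
  imports Defs "HOL-Complex_Analysis.Complex_Analysis"
begin

text \<open>
  Translating the coordinate vectors at the identity gives a global left invariant frame, so a
  transversal field is \<open>L = (\<Sum>i. F i E i)\<close> with unique holomorphic coefficients. Left
  translations commute with right translations, hence every \<open>E i\<close> commutes with \<open>A\<close>. If
  \<open>[L, A] = \<lambda> A\<close>, both sides applied to functions of \<open>t\<close> alone give
  \<open>\<lambda> = 0\<close> because \<open>\<partial>\<close> has no zeros, and then \<open>[L, A] = - (\<Sum>i. A (F i) E i) = 0\<close>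
  says that all \<open>F i\<close> are first integrals.

  The calculus behind this rests on Hadamard's lemma: it yields the chain rule for continuous,
  separately holomorphic functions, and shows that a tangent vector is determined by its values on
  the coordinates of a chart.
\<close>

section \<open>Calculus of holomorphic functions of several variables\<close>

text \<open>Two obstacles shape the proof. \<open>holomorphic_Cspace\<close> asks for continuity and
  holomorphy in each variable only, so even the continuity of a partial derivative has to be
  extracted from Cauchy's formula before Hadamard's coefficients can be shown holomorphic. And a
  vector field is given by its action on fixed functions, whereas the frame coefficients of
  \<open>L\<close> at p = (t, g) are the values of \<open>L p\<close> on the coordinates of
  \<open>inv g \<otimes> k\<close>, test functions that vary with p;
  \<open>hol_on_fibre_derivative\<close> shows that such values still depend holomorphically on p.

  Left and right invariant fields commute because both orders of differentiation are mixed partial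
  derivatives of (k, h) -> f (k g h) at the identity. A field acts on germs, so rewriting under it
  always means proving equality on a neighbourhood.

  The tensor product is handled by generators: modulo the relations a formal sum reduces to one
  first integral per frame field, and uniqueness of frame coefficients makes this reduction
  faithful.\<close>

definition pdisc :: "nat \<Rightarrow> (nat \<Rightarrow> complex) \<Rightarrow> real \<Rightarrow> (nat \<Rightarrow> complex) set" where
  "pdisc n a r = {x \<in> Cspace n. \<forall>i<n. x i \<in> ball (a i) r}"

definition pd :: "nat \<Rightarrow> ((nat \<Rightarrow> complex) \<Rightarrow> complex) \<Rightarrow> (nat \<Rightarrow> complex) \<Rightarrow> complex" where
  "pd i f x = deriv (\<lambda>z. f (x(i := z))) (x i)"

lemma Cspace_upd: "x \<in> Cspace n \<Longrightarrow> i < n \<Longrightarrow> x(i := z) \<in> Cspace n"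
  by (auto simp: Cspace_def)

lemma pdisc_upd: "x \<in> pdisc n a r \<Longrightarrow> i < n \<Longrightarrow> z \<in> ball (a i) r \<Longrightarrow> x(i := z) \<in> pdisc n a r"
  by (auto simp: pdisc_def Cspace_upd)

lemma pdisc_mono: "r \<le> r' \<Longrightarrow> pdisc n a r \<subseteq> pdisc n a r'"
  by (force simp: pdisc_def)

lemma centre_in_pdisc: "a \<in> Cspace n \<Longrightarrow> r > 0 \<Longrightarrow> a \<in> pdisc n a r"
  by (simp add: pdisc_def)

lemma continuous_on_fun_upd:
  fixes g :: "'a::topological_space \<Rightarrow> nat \<Rightarrow> complex"
  assumes "continuous_on S g" "continuous_on S f"
  shows "continuous_on S (\<lambda>y. (g y)(k := f y))"
proof (rule continuous_on_coordinatewise_then_product)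
  show "continuous_on S (\<lambda>x. ((g x)(k := f x)) i)" for i
    using continuous_on_product_then_coordinatewise[OF assms(1), of i] assms(2) by (cases "i = k") auto
qed

lemma continuous_on_coord: "continuous_on S (\<lambda>x::nat \<Rightarrow> complex. x i)"
  by (rule continuous_on_product_then_coordinatewise[OF continuous_on_id])

text \<open>Only finitely many coordinates are constrained, so this cylinder is open in the whole
  product topology; preimages under charts and limits of curves need it in this form, without
  \<open>Cspace\<close>.\<close>

lemma open_pdisc_basis: "open {x :: nat \<Rightarrow> complex. \<forall>i<n. x i \<in> ball (a i) r}"
proof -
  have "{x :: nat \<Rightarrow> complex. \<forall>i<n. x i \<in> ball (a i) r} = (\<Inter>i\<in>{..<n}. (\<lambda>x. x i) -` ball (a i) r)"
    by auto
  moreover have "open ((\<lambda>x::nat \<Rightarrow> complex. x i) -` ball (a i) r)" for i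
    by (rule open_vimage) (simp_all add: continuous_on_coord)
  ultimately show ?thesis by auto
qed

lemma openin_pdisc: "openin (top_of_set (Cspace n)) (pdisc n a r)"
proof -
  have "pdisc n a r = Cspace n \<inter> {x. \<forall>i<n. x i \<in> ball (a i) r}" by (auto simp: pdisc_def)
  then show ?thesis using open_pdisc_basis[of n a r] by (auto simp: openin_open)
qed

lemma openin_contains_pdisc:
  assumes "openin (top_of_set (Cspace n)) D" "a \<in> D"
  obtains r where "r > 0" "pdisc n a r \<subseteq> D"
proof -
  from assms obtain T where T: "open T" "D = Cspace n \<inter> T" by (auto simp: openin_open)
  have "openin (product_topology (\<lambda>i. euclidean) UNIV) T"
    using T(1) by (simp add: euclidean_product_topology)
  from product_topology_open_contains_basis[OF this, of a] T(2) assms(2)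
  obtain X where X: "a \<in> Pi\<^sub>E UNIV X" "\<And>i. open (X i)" "Pi\<^sub>E UNIV X \<subseteq> T" by auto
  have "\<exists>e>0. ball (a i) e \<subseteq> X i" for i
    using X(1,2) open_contains_ball by (metis PiE_mem UNIV_I)
  then obtain e where e: "\<And>i. e i > 0" "\<And>i. ball (a i) (e i) \<subseteq> X i" by metis
  \<comment> \<open>Inserting 1 keeps the minimum meaningful for \<open>n = 0\<close>.\<close>
  define r where "r = Min (insert 1 (e ` {..<n}))"
  have r: "r > 0" "\<And>i. i < n \<Longrightarrow> r \<le> e i" using e(1) by (auto simp: r_def)
  have "pdisc n a r \<subseteq> D"
  proof
    fix x assume x: "x \<in> pdisc n a r"
    have "x i \<in> X i" for i
    proof (cases "i < n")
      case True
      then have "x i \<in> ball (a i) (e i)" using x r(2)[OF True] by (force simp: pdisc_def)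
      then show ?thesis using e(2) by blast
    next
      case False
      \<comment> \<open>From index \<open>n\<close> on, both points are 0.\<close>
      then have "x i = a i" using x assms(2) T(2) by (simp add: pdisc_def Cspace_def)
      then show ?thesis using X(1) by auto
    qed
    then have "x \<in> T" using X(3) by auto
    then show "x \<in> D" using x T(2) by (simp add: pdisc_def)
  qed
  with r(1) that show thesis by blast
qed

section \<open>Locality of holomorphy in several variables\<close>

lemma holomorphic_Cspace_subset:
  "holomorphic_Cspace n f D \<Longrightarrow> E \<subseteq> D \<Longrightarrow> holomorphic_Cspace n f E"
  unfolding holomorphic_Cspace_def by (meson continuous_on_subset subset_iff)

lemma holomorphic_Cspace_local:
  assumes "D \<subseteq> Cspace n"
    and "\<And>a. a \<in> D \<Longrightarrow> \<exists>E. openin (top_of_set (Cspace n)) E \<and> a \<in> E \<and> holomorphic_Cspace n f E"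
  shows "holomorphic_Cspace n f D"
  unfolding holomorphic_Cspace_def
proof
  show "continuous_on D f"
    unfolding continuous_on_def
  proof
    fix a assume a: "a \<in> D"
    then obtain T where T: "open T" "a \<in> Cspace n \<inter> T" "holomorphic_Cspace n f (Cspace n \<inter> T)"
      using assms(2)[OF a] by (auto simp: openin_open)
    then have "(f \<longlongrightarrow> f a) (at a within Cspace n \<inter> T)"
      by (auto simp: holomorphic_Cspace_def continuous_on_def)
    then have "(f \<longlongrightarrow> f a) (at a within D \<inter> T)"
      by (rule tendsto_within_subset) (use assms(1) in auto)
    moreover have "at a within D \<inter> T = at a within D"
      by (rule at_within_nhd[of _ T]) (use T in auto)
    ultimately show "(f \<longlongrightarrow> f a) (at a within D)" by simp
  qed
  show "\<forall>x\<in>D. \<forall>i<n. (\<lambda>z. f (x(i := z))) field_differentiable at (x i)"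
    using assms(2) unfolding holomorphic_Cspace_def by blast
qed

text \<open>Links the relative topology of \<open>Cspace n\<close> to limits in one variable:
  changing a coordinate below \<open>n\<close> does not leave \<open>Cspace n\<close>. Derivatives
  of slices therefore depend only on values in \<open>D\<close>.\<close>

lemma eventually_fun_upd_mem:
  assumes "openin (top_of_set (Cspace n)) D" "x \<in> D" "i < n"
  shows "\<forall>\<^sub>F z in nhds (x i). x(i := z) \<in> D"
proof -
  obtain r where r: "r > 0" "pdisc n x r \<subseteq> D" using openin_contains_pdisc[OF assms(1,2)] .
  have "\<forall>\<^sub>F z in nhds (x i). z \<in> ball (x i) r" using r(1) by (intro eventually_nhds_in_open) auto
  moreover have "x \<in> pdisc n x r"
    using assms(1,2) r(1) openin_imp_subset by (fastforce intro!: centre_in_pdisc)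
  ultimately show ?thesis
    by (elim eventually_mono) (use r pdisc_upd[of x n x r i] assms(3) in blast)
qed

lemma holomorphic_Cspace_cong:
  assumes "openin (top_of_set (Cspace n)) D" "\<And>x. x \<in> D \<Longrightarrow> f x = g x"
  shows "holomorphic_Cspace n f D \<longleftrightarrow> holomorphic_Cspace n g D"
proof -
  have "holomorphic_Cspace n g D" if "holomorphic_Cspace n f D" "\<And>x. x \<in> D \<Longrightarrow> f x = g x" for f g
    unfolding holomorphic_Cspace_def
  proof (intro conjI ballI allI impI)
    show "continuous_on D g"
      using that continuous_on_cong[of D D f g] by (simp add: holomorphic_Cspace_def)
    fix x i assume x: "x \<in> D" "i < n"
    have "(\<lambda>z. f (x(i := z))) field_differentiable (at (x i))"
      using that x by (simp add: holomorphic_Cspace_def)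
    then obtain d where "((\<lambda>z. f (x(i := z))) has_field_derivative d) (at (x i))"
      by (auto simp: field_differentiable_def)
    then have "((\<lambda>z. g (x(i := z))) has_field_derivative d) (at (x i))"
      by (rule DERIV_cong_ev[THEN iffD1, rotated -1])
         (use eventually_fun_upd_mem[OF assms(1) x] that(2) in \<open>auto elim: eventually_mono\<close>)
    then show "(\<lambda>z. g (x(i := z))) field_differentiable (at (x i))"
      by (auto simp: field_differentiable_def)
  qed
  then show ?thesis using assms(2) by metis
qed

lemma pd_cong:
  assumes "openin (top_of_set (Cspace n)) D" "x \<in> D" "\<And>x. x \<in> D \<Longrightarrow> f x = g x" "i < n"
  shows "pd i f x = pd i g x"
  unfolding pd_def
  by (rule deriv_cong_ev)
     (use eventually_fun_upd_mem[OF assms(1,2,4)] assms(3) in \<open>auto elim: eventually_mono\<close>)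

lemma has_pd:
  assumes "holomorphic_Cspace n f D" "x \<in> D" "i < n"
  shows "((\<lambda>z. f (x(i := z))) has_field_derivative pd i f x) (at (x i))"
  using assms field_differentiable_derivI unfolding holomorphic_Cspace_def pd_def by blast

section \<open>Cauchy's formula: partial derivatives are again holomorphic\<close>

text \<open>Leibniz' rule in one variable at a time, the others being frozen. It is used for Cauchy
  integrals as well as for the coefficients in Hadamard's lemma.\<close>

lemma holomorphic_Cspace_parametric_integral:
  assumes "continuous_on (pdisc n a r \<times> {0..1}) (\<lambda>(x,s). K x s)"
    and d: "\<And>k x s. k < n \<Longrightarrow> x \<in> pdisc n a r \<Longrightarrow> s \<in> {0..1::real} \<Longrightarrow>
          ((\<lambda>z. K (x(k := z)) s) has_field_derivative K' k x s) (at (x k))"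
    and c: "\<And>k. k < n \<Longrightarrow> continuous_on (pdisc n a r \<times> {0..1}) (\<lambda>(x,s). K' k x s)"
  shows "holomorphic_Cspace n (\<lambda>x. integral {0..1} (K x)) (pdisc n a r)"
  unfolding holomorphic_Cspace_def
proof (intro conjI ballI allI impI)
  show "continuous_on (pdisc n a r) (\<lambda>x. integral {0..1} (K x))"
    using integral_continuous_on_param[of "pdisc n a r" 0 1 K] assms(1) by simp
next
  fix x k assume x: "x \<in> pdisc n a r" "k < n"
  have up: "x(k := z) \<in> pdisc n a r" if "z \<in> ball (a k) r" for z using pdisc_upd[OF x that] .
  \<comment> \<open>Joint continuity on the polydisc restricts to the slice in which only coordinate
    \<open>k\<close> moves.\<close>
  have sub: "continuous_on (ball (a k) r \<times> {0..1}) (\<lambda>(z,s). F (x(k := z)) s)"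
    if "continuous_on (pdisc n a r \<times> {0..1}) (\<lambda>(x,s). F x s)" for F :: "_ \<Rightarrow> real \<Rightarrow> complex"
  proof -
    have "continuous_on (ball (a k) r \<times> {0..1::real}) (\<lambda>y. (\<lambda>(x,s). F x s) (x(k := fst y), snd y))"
      by (rule continuous_on_compose2[OF that])
         (auto intro!: continuous_on_Pair continuous_on_fun_upd[OF continuous_on_const]
               continuous_on_fst continuous_on_snd continuous_on_id up)
    then show ?thesis by (simp add: case_prod_unfold)
  qed
  have "((\<lambda>z. integral (cbox 0 1) (K (x(k := z)))) has_field_derivative
          integral (cbox 0 1) (K' k (x(k := x k)))) (at (x k) within ball (a k) r)"
  proof (rule leibniz_rule_field_derivative)
    fix z s assume z: "z \<in> ball (a k) r" and s: "s \<in> cbox 0 (1::real)"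
    have "((\<lambda>w. K ((x(k := z))(k := w)) s) has_field_derivative K' k (x(k := z)) s) (at ((x(k := z)) k))"
      using d[OF x(2) up[OF z]] s by simp
    then show "((\<lambda>z. K (x(k := z)) s) has_field_derivative K' k (x(k := z)) s) (at z within ball (a k) r)"
      by (simp add: has_field_derivative_at_within)
  next
    fix z assume z: "z \<in> ball (a k) r"
    have "continuous_on {0..1} (\<lambda>s. (\<lambda>(z,s). K (x(k := z)) s) (z, s))"
      by (rule continuous_on_compose2[OF sub[OF assms(1)]]) (use z in \<open>auto intro!: continuous_intros\<close>)
    then show "K (x(k := z)) integrable_on cbox 0 1"
      by (simp add: integrable_continuous_real)
  next
    show "continuous_on (ball (a k) r \<times> cbox 0 1) (\<lambda>(z,s). K' k (x(k := z)) s)"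
      using sub[OF c[OF x(2)]] by simp
    show "x k \<in> ball (a k) r" "convex (ball (a k) r)" using x by (auto simp: pdisc_def)
  qed
  then show "(\<lambda>z. integral {0..1} (K (x(k := z)))) field_differentiable (at (x k))"
    using x at_within_open[of "x k" "ball (a k) r"]
    by (auto simp: field_differentiable_def pdisc_def)
qed

text \<open>The circle is centred at \<open>a i\<close> rather than \<open>x i\<close>, so the path
  of integration does not depend on \<open>x\<close> and the right-hand side can be differentiated
  under the integral sign.\<close>

lemma pd_Cauchy:
  assumes f: "holomorphic_Cspace n f (pdisc n a r)" and \<rho>: "0 < \<rho>" "\<rho> < r"
    and x: "x \<in> pdisc n a \<rho>" and i: "i < n"
  shows "pd i f x = integral {0..1} (\<lambda>s. f (x(i := circlepath (a i) \<rho> s)) /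
           (circlepath (a i) \<rho> s - x i)^2 * (\<rho> * exp (2 * of_real pi * \<i> * s)))"
proof -
  have up: "x(i := z) \<in> pdisc n a r" if "z \<in> ball (a i) r" for z
    using pdisc_upd that x i pdisc_mono[of \<rho> r n a] \<rho> by auto
  let ?h = "\<lambda>z. f (x(i := z))"
  have fd: "?h field_differentiable (at z)" if "z \<in> ball (a i) r" for z
    using f[unfolded holomorphic_Cspace_def, THEN conjunct2, rule_format, OF up[OF that] i] by simp
  have "?h holomorphic_on ball (a i) r"
    unfolding holomorphic_on_def using fd field_differentiable_at_within by blast
  then have hol: "?h holomorphic_on ball (a i) \<rho>" and cont: "continuous_on (cball (a i) \<rho>) ?h"
    using \<rho> by (auto elim!: holomorphic_on_subset
               intro!: holomorphic_on_imp_continuous_on[OF holomorphic_on_subset])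
  have xi: "x i \<in> ball (a i) \<rho>" using x i by (simp add: pdisc_def)
  have "pd i f x = 1 / (2 * of_real pi * \<i>) * contour_integral(circlepath (a i) \<rho>) (\<lambda>u. ?h u / (u - x i)^2)"
    unfolding pd_def
    by (rule DERIV_imp_deriv[OF Cauchy_derivative_integral_circlepath(2)[OF cont hol xi]])
  also have "\<dots> = integral {0..1} (\<lambda>s. 1 / (2 * of_real pi * \<i>) * (?h (circlepath (a i) \<rho> s) /
        (circlepath (a i) \<rho> s - x i)^2 * (2 * pi * \<i> * \<rho> * exp (2 * of_real pi * \<i> * s))))"
    unfolding contour_integral_integral integral_mult_right
    by (simp add: vector_derivative_circlepath)
  \<comment> \<open>The factor 2 pi i in the velocity of the circle cancels the constant of Cauchy's
    formula.\<close>
  also have "\<dots> = integral {0..1} (\<lambda>s. ?h (circlepath (a i) \<rho> s) /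
        (circlepath (a i) \<rho> s - x i)^2 * (\<rho> * exp (2 * of_real pi * \<i> * s)))"
    by (intro integral_cong) (simp add: field_simps)
  finally show ?thesis .
qed

lemma circlepath_neq:
  assumes "w \<in> ball c \<rho>" "\<rho> > 0"
  shows "circlepath c \<rho> s \<noteq> w"
proof -
  have "norm (circlepath c \<rho> s - c) = \<rho>"
    using assms(2) by (simp add: circlepath norm_mult)
  then show ?thesis using assms(1) by (auto simp: dist_norm norm_minus_commute)
qed

lemma circlepath_in_ball:
  assumes "\<rho> > 0" "\<rho> < r"
  shows "circlepath c \<rho> s \<in> ball c r"
proof -
  have "norm (circlepath c \<rho> s - c) = \<rho>"
    using assms(1) by (simp add: circlepath norm_mult)
  then show ?thesis using assms by (simp add: dist_norm norm_minus_commute)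
qed

lemma continuous_on_circle_upd:
  assumes g: "continuous_on (pdisc n a r) g" and \<rho>: "0 < \<rho>" "\<rho> < r" and i: "i < n"
  shows "continuous_on (pdisc n a \<rho> \<times> {0..1}) (\<lambda>p. g ((fst p)(i := circlepath (a i) \<rho> (snd p))))"
proof (rule continuous_on_compose2[OF g])
  show "continuous_on (pdisc n a \<rho> \<times> {0..1}) (\<lambda>p. (fst p)(i := circlepath (a i) \<rho> (snd p)))"
    unfolding circlepath by (intro continuous_on_fun_upd continuous_intros)
  show "(\<lambda>p. (fst p)(i := circlepath (a i) \<rho> (snd p))) ` (pdisc n a \<rho> \<times> {0..1}) \<subseteq> pdisc n a r"
    using pdisc_upd[OF _ i circlepath_in_ball[OF \<rho>]] pdisc_mono[of \<rho> r n a] \<rho> by fastforce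
qed

lemma continuous_on_fst_coord: "continuous_on S (\<lambda>p. fst p i)" for S :: "((nat \<Rightarrow> complex) \<times> real) set"
  by (rule continuous_on_product_then_coordinatewise) (intro continuous_intros)

text \<open>Continuity has to come before holomorphy: differentiating the Cauchy integral for
  \<open>pd i f\<close> in another variable \<open>k\<close> puts \<open>pd k f\<close> under the
  integral, and Leibniz' rule wants a continuous integrand.\<close>

lemma continuous_on_pd_pdisc:
  assumes f: "holomorphic_Cspace n f (pdisc n a r)" and \<rho>: "0 < \<rho>" "\<rho> < r" and i: "i < n"
  shows "continuous_on (pdisc n a \<rho>) (pd i f)"
proof -
  have "continuous_on (pdisc n a \<rho>) (\<lambda>x. integral (cbox 0 1) (\<lambda>s. f (x(i := circlepath (a i) \<rho> s)) /
           (circlepath (a i) \<rho> s - x i)^2 * (\<rho> * exp (2 * of_real pi * \<i> * s))))"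
  proof (rule integral_continuous_on_param)
    show "continuous_on (pdisc n a \<rho> \<times> cbox 0 1) (\<lambda>(x,s). f (x(i := circlepath (a i) \<rho> s)) /
           (circlepath (a i) \<rho> s - x i)^2 * (\<rho> * exp (2 * of_real pi * \<i> * s)))"
      unfolding case_prod_unfold cbox_interval
    proof (intro continuous_intros continuous_on_circle_upd[OF _ \<rho> i] continuous_on_fst_coord)
      show "continuous_on (pdisc n a r) f" using f by (simp add: holomorphic_Cspace_def)
      show "continuous_on (pdisc n a \<rho> \<times> {0..1}) (\<lambda>x. circlepath (a i) \<rho> (snd x))"
        unfolding circlepath by (intro continuous_intros)
      show "\<forall>x\<in>pdisc n a \<rho> \<times> {0..1}. (circlepath (a i) \<rho> (snd x) - fst x i)\<^sup>2 \<noteq> 0"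
        using circlepath_neq[OF _ \<rho>(1)] i by (auto simp: pdisc_def)
    qed
  qed
  then show ?thesis
    by (rule continuous_on_cong[THEN iffD1, rotated -1]) (use pd_Cauchy[OF f \<rho> _ i] in auto)
qed

lemma has_field_derivative_Cauchy_kernel:
  fixes w :: complex
  assumes "w - z0 \<noteq> 0"
  shows "((\<lambda>z. C / (w - z)^2 * E) has_field_derivative 2 * C / (w - z0)^3 * E) (at z0)"
proof -
  have *: "- (C * (2 * u * - 1)) / (u^2 * u^2) * E = 2 * C / u^3 * E" if "u \<noteq> 0" for u
    using that by (simp add: field_simps eval_nat_numeral)
  show ?thesis
    unfolding *[OF assms, symmetric]
    using assms by (auto intro!: derivative_eq_intros simp: power2_eq_square)
qed

lemma holomorphic_Cspace_pd_pdisc: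
  assumes f: "holomorphic_Cspace n f (pdisc n a r)" and \<rho>: "0 < \<rho>" "\<rho> < r" and i: "i < n"
  shows "holomorphic_Cspace n (pd i f) (pdisc n a \<rho>)"
proof -
  \<comment> \<open>An intermediate radius: \<open>pd k f\<close> is continuous on the disc of
    radius \<rho>', which contains the circle of radius \<rho>.\<close>
  obtain \<rho>' where \<rho>': "\<rho> < \<rho>'" "\<rho>' < r" "0 < \<rho>'" using dense[OF \<rho>(2)] \<rho>(1) by auto
  let ?c = "circlepath (a i) \<rho>" and ?e = "\<lambda>s. \<rho> * exp (2 * of_real pi * \<i> * of_real s)"
  let ?K = "\<lambda>x s. f (x(i := ?c s)) / (?c s - x i)^2 * ?e s"
  \<comment> \<open>The circle overwrites coordinate \<open>i\<close> in the argument of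
    \<open>f\<close>, so \<open>x i\<close> occurs only in the denominator and the other coordinates
    only in \<open>f\<close>.\<close>
  let ?K' = "\<lambda>k x s. if k = i then 2 * f (x(i := ?c s)) / (?c s - x i)^3 * ?e s
                     else pd k f (x(i := ?c s)) / (?c s - x i)^2 * ?e s"
  have ne: "?c s - x i \<noteq> 0" if "x \<in> pdisc n a \<rho>" for x s
    using circlepath_neq[OF _ \<rho>(1), of "x i" "a i" s] that i by (auto simp: pdisc_def)
  have cc: "continuous_on (pdisc n a \<rho> \<times> {0..1}) (\<lambda>x. ?c (snd x))"
    unfolding circlepath by (intro continuous_intros)
  have cf: "continuous_on (pdisc n a r) f" using f by (simp add: holomorphic_Cspace_def)
  have "holomorphic_Cspace n (\<lambda>x. integral {0..1} (?K x)) (pdisc n a \<rho>)"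
  proof (rule holomorphic_Cspace_parametric_integral[where K' = ?K'])
    show "continuous_on (pdisc n a \<rho> \<times> {0..1}) (\<lambda>(x,s). ?K x s)"
      unfolding case_prod_unfold
      by (intro continuous_intros continuous_on_circle_upd[OF cf \<rho> i] continuous_on_fst_coord cc)
         (use ne in auto)
    show "continuous_on (pdisc n a \<rho> \<times> {0..1}) (\<lambda>(x,s). ?K' k x s)" if k: "k < n" for k
    proof (cases "k = i")
      case True
      have "continuous_on (pdisc n a \<rho> \<times> {0..1})
              (\<lambda>p. 2 * f ((fst p)(i := ?c (snd p))) / (?c (snd p) - fst p i)^3 * ?e (snd p))"
        by (intro continuous_intros continuous_on_circle_upd[OF cf \<rho> i] continuous_on_fst_coord cc)
           (use ne in auto)
      with True show ?thesis by (simp add: case_prod_unfold)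
    next
      case False
      have "continuous_on (pdisc n a \<rho> \<times> {0..1})
              (\<lambda>p. pd k f ((fst p)(i := ?c (snd p))) / (?c (snd p) - fst p i)^2 * ?e (snd p))"
        by (intro continuous_intros continuous_on_circle_upd[OF continuous_on_pd_pdisc[OF f \<rho>'(3,2) k] \<rho>(1) \<rho>'(1) i]
              continuous_on_fst_coord cc)
           (use ne in auto)
      with False show ?thesis by (simp add: case_prod_unfold)
    qed
    fix k x s assume k: "k < n" and x: "x \<in> pdisc n a \<rho>" and "s \<in> {0..1::real}"
    show "((\<lambda>z. ?K (x(k := z)) s) has_field_derivative ?K' k x s) (at (x k))"
    proof (cases "k = i")
      case True
      have "((\<lambda>z. f (x(i := ?c s)) / (?c s - z)^2 * ?e s) has_field_derivative ?K' i x s) (at (x i))"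
        using has_field_derivative_Cauchy_kernel ne[OF x] by simp
      with True show ?thesis by simp
    next
      case False
      have "x(i := ?c s) \<in> pdisc n a r"
        using pdisc_upd[OF _ i circlepath_in_ball[OF \<rho>]] pdisc_mono[of \<rho> r n a] \<rho> x by fastforce
      from has_pd[OF f this k] False
      have "((\<lambda>z. f ((x(i := ?c s))(k := z))) has_field_derivative pd k f (x(i := ?c s))) (at (x k))" by simp
      then have "((\<lambda>z. f (x(k := z, i := ?c s))) has_field_derivative pd k f (x(i := ?c s))) (at (x k))"
        using False by (simp add: fun_upd_twist)
      then show ?thesis
        using False ne[OF x] by (auto intro!: derivative_eq_intros simp: field_simps)
    qed
  qed
  then show ?thesis
    by (rule holomorphic_Cspace_cong[OF openin_pdisc, THEN iffD1, rotated]) (use pd_Cauchy[OF f \<rho> _ i] in simp)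
qed

text \<open>Holomorphy is local, and a polydisc of half the radius around each point leaves the room
  that Cauchy's formula needs.\<close>

lemma holomorphic_Cspace_pd:
  assumes f: "holomorphic_Cspace n f D" and D: "openin (top_of_set (Cspace n)) D" and i: "i < n"
  shows "holomorphic_Cspace n (pd i f) D"
proof (rule holomorphic_Cspace_local)
  show "D \<subseteq> Cspace n" using D openin_imp_subset by blast
  fix a assume a: "a \<in> D"
  obtain r where r: "r > 0" "pdisc n a r \<subseteq> D" using openin_contains_pdisc[OF D a] .
  have "holomorphic_Cspace n (pd i f) (pdisc n a (r/2))"
    by (rule holomorphic_Cspace_pd_pdisc[OF holomorphic_Cspace_subset[OF f r(2)]]) (use r i in auto)
  moreover have "a \<in> pdisc n a (r/2)"
    using D a r(1) openin_imp_subset by (fastforce intro!: centre_in_pdisc)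
  ultimately show "\<exists>E. openin (top_of_set (Cspace n)) E \<and> a \<in> E \<and> holomorphic_Cspace n (pd i f) E"
    using openin_pdisc by blast
qed

text \<open>Telescoping from \<open>a\<close> to \<open>x\<close> along the coordinate axes: \<open>g i\<close> is the mean of the \<open>i\<close>-th
  partial derivative along the \<open>i\<close>-th edge.\<close>

lemma Hadamard:
  assumes f: "holomorphic_Cspace n f (pdisc n a r)" and a: "a \<in> Cspace n" and r: "r > 0"
  obtains g where "\<forall>i<n. holomorphic_Cspace n (g i) (pdisc n a r) \<and> g i a = pd i f a"
    "\<forall>x\<in>pdisc n a r. f x = f a + (\<Sum>i<n. (x i - a i) * g i x)"
proof -
  let ?P = "pdisc n a r"
  \<comment> \<open>The point at time \<open>s\<close> on the \<open>i\<close>-th edge: earlier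
    coordinates have already reached \<open>x\<close>, later ones are still at
    \<open>a\<close>.\<close>
  define h where "h i x s j = (if j < i then x j else if j = i then a i + of_real s * (x i - a i) else a j)"
    for i :: nat and x :: "nat \<Rightarrow> complex" and s :: real and j
  \<comment> \<open>The edges stay inside because a polydisc is a product of convex discs.\<close>
  have hP: "h i x s \<in> ?P" if "x \<in> ?P" "s \<in> {0..1}" "i < n" for i x s
  proof -
    have "norm (of_real s * (x i - a i)) < r"
    proof -
      have "norm (of_real s * (x i - a i)) \<le> 1 * norm (x i - a i)"
        unfolding norm_mult using that by (intro mult_right_mono) auto
      also have "\<dots> < r" using that by (auto simp: pdisc_def dist_norm norm_minus_commute)
      finally show ?thesis .
    qed
    then show ?thesis using that a r by (auto simp: pdisc_def h_def Cspace_def dist_norm norm_minus_commute)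
  qed
  have hcont: "continuous_on S (\<lambda>p. h i (fst p) (snd p))" for i S
  proof (rule continuous_on_coordinatewise_then_product)
    have "continuous_on S (\<lambda>p. a i + of_real (snd p) * (fst p i - a i))"
      by (intro continuous_intros continuous_on_fst_coord)
    then show "continuous_on S (\<lambda>p. h i (fst p) (snd p) j)" for j
      by (cases j i rule: linorder_cases) (simp_all add: h_def continuous_on_fst_coord)
  qed
  have ch: "continuous_on (?P \<times> {0..1}) (\<lambda>p. u (h i (fst p) (snd p)))"
    if "holomorphic_Cspace n u ?P" "i < n" for u i
    by (rule continuous_on_compose2[OF _ hcont, of ?P u]) (use that hP in \<open>auto simp: holomorphic_Cspace_def\<close>)
  note hpd = holomorphic_Cspace_pd[OF _ openin_pdisc]
  define g where "g i x = integral {0..1} (\<lambda>s. pd i f (h i x s))" for i x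
  show thesis
  proof (rule that; intro allI impI ballI conjI)
    fix i assume i: "i < n"
    note f1 = hpd[OF f i]
    \<comment> \<open>On the \<open>i\<close>-th edge a coordinate before \<open>i\<close> enters as
      it is, coordinate \<open>i\<close> is scaled by \<open>s\<close>, and later ones do not
      enter.\<close>
    let ?K' = "\<lambda>k x s. if k < i then pd k (pd i f) (h i x s) else
                       if k = i then of_real s * pd i (pd i f) (h i x s) else 0"
    show "holomorphic_Cspace n (g i) ?P"
      unfolding g_def
    proof (rule holomorphic_Cspace_parametric_integral[where K' = ?K'])
      show "continuous_on (?P \<times> {0..1}) (\<lambda>(x,s). pd i f (h i x s))"
        using ch[OF f1 i] by (simp add: case_prod_unfold)
      show "continuous_on (?P \<times> {0..1}) (\<lambda>(x,s). ?K' k x s)" if "k < n" for k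
      proof -
        have "continuous_on (?P \<times> {0..1}) (\<lambda>p. of_real (snd p) * pd i (pd i f) (h i (fst p) (snd p)))"
          by (intro continuous_intros ch[OF hpd[OF f1 i] i])
        then show ?thesis
          using ch[OF hpd[OF f1 that] i] by (cases k i rule: linorder_cases) (simp_all add: case_prod_unfold)
      qed
      fix k x s assume k: "k < n" and x: "x \<in> ?P" and s: "s \<in> {0..1::real}"
      note d = has_pd[OF f1 hP[OF x s i]]
      consider "k < i" | "k = i" | "k > i" by linarith
      then show "((\<lambda>z. pd i f (h i (x(k := z)) s)) has_field_derivative ?K' k x s) (at (x k))"
      proof cases
        case 1
        then have "h i (x(k := z)) s = (h i x s)(k := z)" for z by (auto simp: h_def)
        with d[OF k] 1 show ?thesis by (simp add: h_def)
      next
        case 2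
        then have "h i (x(k := z)) s = (h i x s)(i := a i + of_real s * (z - a i))" for z by (auto simp: h_def)
        moreover have "((\<lambda>z. pd i f ((h i x s)(i := a i + of_real s * (z - a i)))) has_field_derivative
            pd i (pd i f) (h i x s) * of_real s) (at (x i))"
          by (rule DERIV_chain2[where f = "\<lambda>z. pd i f ((h i x s)(i := z))"])
             (use d[OF i] in \<open>auto simp: h_def intro!: derivative_eq_intros\<close>)
        ultimately show ?thesis using 2 by (simp add: mult.commute)
      next
        case 3
        then have "h i (x(k := z)) s = h i x s" for z by (auto simp: h_def)
        with 3 show ?thesis by simp
      qed
    qed
    \<comment> \<open>For \<open>x = a\<close> the edges shrink to a point, and the mean of a
      constant is that constant.\<close>
    have "h i a s = a" for s by (auto simp: h_def)
    then show "g i a = pd i f a" by (simp add: g_def)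
  next
    fix x assume x: "x \<in> ?P"
    define y where "y i = (\<lambda>j. if j < i then x j else a j)" for i :: nat
    have "f (y (Suc i)) - f (y i) = (x i - a i) * g i x" if i: "i < n" for i
    proof -
      have "((\<lambda>s. (x i - a i) * pd i f (h i x s)) has_integral f (h i x 1) - f (h i x 0)) {0..1}"
      proof (rule fundamental_theorem_of_calculus)
        fix s assume s: "s \<in> {0..1::real}"
        \<comment> \<open>The edge is parametrised by a complex number so that the holomorphic chain
          rule applies; restriction to real parameters then gives the derivative for the fundamental
          theorem of calculus.\<close>
        have eq: "(h i x s)(i := a i + z * (x i - a i)) = h i x t" if "z = of_real t" for z t
          using that by (auto simp: h_def)
        have "((\<lambda>z. f ((h i x s)(i := a i + z * (x i - a i)))) has_field_derivative
            pd i f (h i x s) * (x i - a i)) (at (of_real s))"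
          by (rule DERIV_chain2[where f = "\<lambda>z. f ((h i x s)(i := z))"])
             (use has_pd[OF f hP[OF x s i] i] in \<open>auto simp: h_def intro!: derivative_eq_intros\<close>)
        then have "((\<lambda>t. f (h i x t)) has_vector_derivative pd i f (h i x s) * (x i - a i)) (at s)"
          using has_vector_derivative_real_field eq[OF refl] by fastforce
        then show "((\<lambda>t. f (h i x t)) has_vector_derivative (x i - a i) * pd i f (h i x s)) (at s within {0..1})"
          by (simp add: has_vector_derivative_at_within mult.commute)
      qed simp
      moreover have "h i x 1 = y (Suc i)" "h i x 0 = y i" by (auto simp: h_def y_def fun_eq_iff less_Suc_eq)
      ultimately show ?thesis by (simp add: g_def integral_unique flip: integral_mult_right)
    qed
    then have "(\<Sum>i<n. (x i - a i) * g i x) = (\<Sum>i<n. f (y (Suc i)) - f (y i))" by simp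
    also have "\<dots> = f (y n) - f (y 0)" by (rule sum_lessThan_telescope)
    finally have "f (y n) = f (y 0) + (\<Sum>i<n. (x i - a i) * g i x)" by simp
    \<comment> \<open>The last vertex is \<open>x\<close> because \<open>x\<close> and
      \<open>a\<close> both vanish from index \<open>n\<close> on.\<close>
    moreover have "y n = x" "y 0 = a" using x a by (auto simp: y_def pdisc_def Cspace_def)
    ultimately show "f x = f a + (\<Sum>i<n. (x i - a i) * g i x)" by simp
  qed
qed

section \<open>The chain rule along curves\<close>

lemma tendsto_coordinatewise_imp:
  fixes \<gamma> :: "'a \<Rightarrow> nat \<Rightarrow> complex"
  assumes "\<And>i. ((\<lambda>z. \<gamma> z i) \<longlongrightarrow> l i) F"
  shows "(\<gamma> \<longlongrightarrow> l) F"
  using assms limitin_componentwise[of "\<lambda>i. euclidean" UNIV \<gamma> l F]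
  by (simp add: euclidean_product_topology)

text \<open>Hadamard's lemma turns the difference quotient of \<open>f\<close> along \<gamma> into
  the sum of the difference quotients of the coordinates times \<open>g i (\<gamma> z)\<close>. Each
  factor converges, the second one by mere continuity of \<open>g i\<close>.\<close>

lemma field_differentiable_compose_holomorphic_Cspace:
  assumes f: "holomorphic_Cspace n f E" and E: "openin (top_of_set (Cspace n)) E"
    and \<gamma>0: "\<gamma> z0 \<in> E" and ev: "\<And>i z. i \<ge> n \<Longrightarrow> \<gamma> z i = 0"
    and d: "\<And>i. i < n \<Longrightarrow> (\<lambda>z. \<gamma> z i) field_differentiable at z0"
  shows "(\<lambda>z. f (\<gamma> z)) field_differentiable at z0"
proof -
  define a where "a = \<gamma> z0"
  have aE: "a \<in> Cspace n" using \<gamma>0 E openin_imp_subset by (auto simp: a_def)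
  obtain r where r: "r > 0" "pdisc n a r \<subseteq> E" using openin_contains_pdisc[OF E \<gamma>0] a_def by metis
  let ?P = "pdisc n a r"
  obtain g where g: "\<forall>i<n. holomorphic_Cspace n (g i) ?P \<and> g i a = pd i f a"
    "\<forall>x\<in>?P. f x = f a + (\<Sum>i<n. (x i - a i) * g i x)"
    using Hadamard[OF holomorphic_Cspace_subset[OF f r(2)] aE r(1)] .
  have tc: "(\<lambda>z. \<gamma> z i) \<midarrow>z0\<rightarrow> a i" for i
  proof (cases "i < n")
    case True
    then show ?thesis
      using field_differentiable_imp_continuous_at[OF d[OF True]] by (simp add: isCont_def a_def)
  next
    case False
    then show ?thesis using ev by (simp add: a_def)
  qed
  have t: "\<gamma> \<midarrow>z0\<rightarrow> a" by (rule tendsto_coordinatewise_imp) (rule tc)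
  have inP: "\<forall>\<^sub>F z in at z0. \<gamma> z \<in> ?P"
  proof -
    have "\<forall>\<^sub>F z in at z0. \<gamma> z \<in> {x. \<forall>i<n. x i \<in> ball (a i) r}"
      by (rule topological_tendstoD[OF t open_pdisc_basis]) (use r in auto)
    then show ?thesis by (elim eventually_mono) (use ev in \<open>auto simp: pdisc_def Cspace_def\<close>)
  qed
  have aP: "a \<in> ?P" using centre_in_pdisc aE r by simp
  have gt: "(\<lambda>z. g i (\<gamma> z)) \<midarrow>z0\<rightarrow> g i a" if "i < n" for i
    by (rule continuous_on_tendsto_compose[OF _ t aP inP])
       (use g(1) that in \<open>simp add: holomorphic_Cspace_def\<close>)
  have "((\<lambda>z. (\<gamma> z i - a i) / (z - z0)) \<longlongrightarrow> deriv (\<lambda>z. \<gamma> z i) z0) (at z0)" if "i < n" for i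
    using field_differentiable_derivI[OF d[OF that]] by (simp add: has_field_derivative_iff a_def)
  then have "((\<lambda>z. \<Sum>i<n. (\<gamma> z i - a i) / (z - z0) * g i (\<gamma> z)) \<longlongrightarrow>
      (\<Sum>i<n. deriv (\<lambda>z. \<gamma> z i) z0 * g i a)) (at z0)"
    using gt by (intro tendsto_sum tendsto_mult) auto
  then have "((\<lambda>z. (f (\<gamma> z) - f (\<gamma> z0)) / (z - z0)) \<longlongrightarrow>
      (\<Sum>i<n. deriv (\<lambda>z. \<gamma> z i) z0 * g i a)) (at z0)"
    by (rule tendsto_cong[THEN iffD1, rotated])
       (use inP in \<open>elim eventually_mono, simp add: g(2) sum_divide_distrib flip: a_def\<close>)
  then show ?thesis unfolding field_differentiable_def has_field_derivative_iff by blast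
qed

lemma holomorphic_Cspace_const: "holomorphic_Cspace n (\<lambda>x. c) D"
  by (simp add: holomorphic_Cspace_def)

lemma holomorphic_Cspace_add:
  "holomorphic_Cspace n f D \<Longrightarrow> holomorphic_Cspace n g D \<Longrightarrow> holomorphic_Cspace n (\<lambda>x. f x + g x) D"
  by (auto simp: holomorphic_Cspace_def intro!: continuous_intros derivative_intros)

lemma holomorphic_Cspace_mult:
  "holomorphic_Cspace n f D \<Longrightarrow> holomorphic_Cspace n g D \<Longrightarrow> holomorphic_Cspace n (\<lambda>x. f x * g x) D"
  by (auto simp: holomorphic_Cspace_def intro!: continuous_intros derivative_intros)

section \<open>Holomorphic functions and tangent vectors on complex manifolds\<close>

lemma chart_open: "complex_manifold M \<Longrightarrow> (U, \<phi>) \<in> atlas M \<Longrightarrow> open U"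
  by (auto simp: complex_manifold_def)

text \<open>The definition of a manifold grants some continuous inverse; injectivity identifies it
  with \<open>inv_into\<close>, in terms of which \<open>hol_on\<close> is stated.\<close>

lemma chart_homeomorphism:
  assumes "complex_manifold M" "(U, \<phi>) \<in> atlas M"
  shows "homeomorphism U (\<phi> ` U) \<phi> (inv_into U \<phi>)"
proof -
  obtain \<psi> where h: "homeomorphism U (\<phi> ` U) \<phi> \<psi>"
    using assms by (auto simp: complex_manifold_def)
  then have "inj_on \<phi> U" by (auto simp: homeomorphism_def intro: inj_on_inverseI)
  with h show ?thesis by (rule_tac homeomorphism_cong[OF h]) (auto simp: homeomorphism_def)
qed

lemma inv_into_chart [simp]:
  assumes "complex_manifold M" "(U, \<phi>) \<in> atlas M" "x \<in> U"
  shows "inv_into U \<phi> (\<phi> x) = x"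
  using chart_homeomorphism[OF assms(1,2)] assms(3) by (simp add: homeomorphism_def)

lemma openin_chart_image:
  assumes "complex_manifold M" "(U, \<phi>) \<in> atlas M" "open W"
  shows "openin (top_of_set (Cspace (cdim M))) (\<phi> ` (U \<inter> W))"
proof -
  have "openin (top_of_set (\<phi> ` U)) (\<phi> ` (U \<inter> W))"
    by (rule homeomorphism_imp_open_map[OF chart_homeomorphism[OF assms(1,2)]])
       (use assms(3) in \<open>auto simp: openin_open\<close>)
  moreover have "openin (top_of_set (Cspace (cdim M))) (\<phi> ` U)"
    using assms by (auto simp: complex_manifold_def)
  ultimately show ?thesis by (rule openin_trans)
qed

lemma chart_in_Cspace:
  assumes "complex_manifold M" "(U, \<phi>) \<in> atlas M" "x \<in> U"
  shows "\<phi> x \<in> Cspace (cdim M)"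
  using openin_imp_subset[OF openin_chart_image[OF assms(1,2) open_UNIV]] assms(3) by auto

text \<open>Removes the padding by zeros with which \<open>hol_on_compose_Cspace\<close> assembles a
  point from its coordinates.\<close>

lemma chart_vanish:
  assumes "complex_manifold M" "(U, \<phi>) \<in> atlas M" "x \<in> U"
  shows "(\<lambda>i. if i < cdim M then \<phi> x i else 0) = \<phi> x"
  using chart_in_Cspace[OF assms] by (auto simp: Cspace_def)

lemma chart_at:
  assumes "complex_manifold M"
  obtains U \<phi> where "(U, \<phi>) \<in> atlas M" "p \<in> U"
proof -
  have "p \<in> (\<Union>(U, \<phi>)\<in>atlas M. U)" using assms[unfolded complex_manifold_def, THEN conjunct1] by simp
  with that show thesis by blast
qed

section \<open>Holomorphic functions on manifolds\<close>

lemma hol_on_subset: "hol_on M f W \<Longrightarrow> V \<subseteq> W \<Longrightarrow> hol_on M f V"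
  unfolding hol_on_def
  by (fast intro: holomorphic_Cspace_subset image_mono Int_mono)

lemma hol_on_const: "hol_on M (\<lambda>x. c) W"
  by (auto simp: hol_on_def o_def holomorphic_Cspace_const)

lemma hol_on_add: "hol_on M f W \<Longrightarrow> hol_on M g W \<Longrightarrow> hol_on M (\<lambda>x. f x + g x) W"
  by (fastforce simp: hol_on_def o_def intro!: holomorphic_Cspace_add)

lemma hol_on_mult: "hol_on M f W \<Longrightarrow> hol_on M g W \<Longrightarrow> hol_on M (\<lambda>x. f x * g x) W"
  by (fastforce simp: hol_on_def o_def intro!: holomorphic_Cspace_mult)

lemma hol_on_sum: "(\<And>i. i \<in> I \<Longrightarrow> hol_on M (f i) W) \<Longrightarrow> hol_on M (\<lambda>x. \<Sum>i\<in>I. f i x) W"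
  by (induction I rule: infinite_finite_induct) (auto simp: hol_on_const hol_on_add)

lemma hol_on_local:
  assumes M: "complex_manifold M"
    and loc: "\<And>p. p \<in> W \<Longrightarrow> \<exists>V. open V \<and> p \<in> V \<and> hol_on M f V"
  shows "hol_on M f W"
  unfolding hol_on_def
proof clarify
  fix U \<phi> assume c: "(U, \<phi>) \<in> atlas M"
  show "holomorphic_Cspace (cdim M) (f \<circ> inv_into U \<phi>) (\<phi> ` (U \<inter> W))"
  proof (rule holomorphic_Cspace_local)
    show "\<phi> ` (U \<inter> W) \<subseteq> Cspace (cdim M)" using chart_in_Cspace[OF M c] by auto
    fix a assume "a \<in> \<phi> ` (U \<inter> W)"
    then obtain p where p: "p \<in> U" "p \<in> W" "a = \<phi> p" by auto
    then obtain V where V: "open V" "p \<in> V" "hol_on M f V" using loc by blast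
    then have "holomorphic_Cspace (cdim M) (f \<circ> inv_into U \<phi>) (\<phi> ` (U \<inter> V))"
      using c by (auto simp: hol_on_def)
    then show "\<exists>E. openin (top_of_set (Cspace (cdim M))) E \<and> a \<in> E \<and>
                 holomorphic_Cspace (cdim M) (f \<circ> inv_into U \<phi>) E"
      using openin_chart_image[OF M c V(1)] p V(2) by blast
  qed
qed

lemma hol_on_cong:
  assumes M: "complex_manifold M" and W: "open W" and eq: "\<And>x. x \<in> W \<Longrightarrow> f x = g x"
    and f: "hol_on M f W"
  shows "hol_on M g W"
  unfolding hol_on_def
proof clarify
  fix U \<phi> assume c: "(U, \<phi>) \<in> atlas M"
  have "holomorphic_Cspace (cdim M) (f \<circ> inv_into U \<phi>) (\<phi> ` (U \<inter> W))"
    using f c by (auto simp: hol_on_def)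
  then show "holomorphic_Cspace (cdim M) (g \<circ> inv_into U \<phi>) (\<phi> ` (U \<inter> W))"
    by (rule holomorphic_Cspace_cong[OF openin_chart_image[OF M c W], THEN iffD1, rotated])
       (use M c eq in auto)
qed

text \<open>Read in another chart, a coordinate function is a component of a transition map.\<close>

lemma hol_on_coord:
  assumes M: "complex_manifold M" and c: "(U, \<phi>) \<in> atlas M" and i: "i < cdim M"
  shows "hol_on M (\<lambda>q. \<phi> q i) U"
proof -
  note t = M[unfolded complex_manifold_def, THEN conjunct2, THEN conjunct2, THEN bspec]
  have "holomorphic_Cspace (cdim M) (\<lambda>x. \<phi> (inv_into V \<psi> x) i) (\<psi> ` (V \<inter> U))"
    if "(V, \<psi>) \<in> atlas M" for V \<psi>
    using t[OF that] c i by auto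
  then show ?thesis by (auto simp: hol_on_def o_def)
qed

text \<open>In a chart of \<open>M\<close>, moving one variable turns the tuple of the
  \<open>c i\<close> into a curve in \<open>Cspace k\<close>, and the chain rule along curves
  applies. The padding keeps the curve in \<open>Cspace k\<close> even where it leaves the image of
  the chart.\<close>

lemma hol_on_compose_Cspace:
  assumes M: "complex_manifold M" and f: "holomorphic_Cspace k f E"
    and E: "openin (top_of_set (Cspace k)) E" and W: "open W"
    and c: "\<And>i. i < k \<Longrightarrow> hol_on M (c i) W"
    and mem: "\<And>x. x \<in> W \<Longrightarrow> (\<lambda>i. if i < k then c i x else 0) \<in> E"
  shows "hol_on M (\<lambda>x. f (\<lambda>i. if i < k then c i x else 0)) W"
  unfolding hol_on_def
proof clarify
  fix U \<phi> assume ch: "(U, \<phi>) \<in> atlas M"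
  let ?\<gamma> = "\<lambda>y i. if i < k then c i (inv_into U \<phi> y) else 0"
  let ?D = "\<phi> ` (U \<inter> W)"
  have hc: "holomorphic_Cspace (cdim M) (\<lambda>y. c i (inv_into U \<phi> y)) ?D" if "i < k" for i
    using c[OF that] ch by (auto simp: hol_on_def o_def)
  have mem': "?\<gamma> y \<in> E" if "y \<in> ?D" for y
    using that mem ch M by auto
  have "holomorphic_Cspace (cdim M) (\<lambda>y. f (?\<gamma> y)) ?D"
    unfolding holomorphic_Cspace_def
  proof (intro conjI ballI allI impI)
    have "continuous_on ?D ?\<gamma>"
    proof (rule continuous_on_coordinatewise_then_product)
      show "continuous_on ?D (\<lambda>y. if i < k then c i (inv_into U \<phi> y) else 0)" for i
        using hc[of i] by (cases "i < k") (auto simp: holomorphic_Cspace_def)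
    qed
    then show "continuous_on ?D (\<lambda>y. f (?\<gamma> y))"
      by (rule continuous_on_compose2[of E f, rotated]) (use f mem' in \<open>auto simp: holomorphic_Cspace_def\<close>)
    fix y j assume y: "y \<in> ?D" and j: "j < cdim M"
    show "(\<lambda>z. f (?\<gamma> (y(j := z)))) field_differentiable at (y j)"
    proof (rule field_differentiable_compose_holomorphic_Cspace[OF f E])
      show "?\<gamma> (y(j := y j)) \<in> E" using mem'[OF y] unfolding fun_upd_triv .
      fix i assume i: "i < k"
      show "(\<lambda>z. ?\<gamma> (y(j := z)) i) field_differentiable at (y j)"
        using hc[OF i, unfolded holomorphic_Cspace_def, THEN conjunct2, rule_format, OF y j] i by simp
    qed simp
  qed
  then show "holomorphic_Cspace (cdim M) ((\<lambda>x. f (\<lambda>i. if i < k then c i x else 0)) \<circ> inv_into U \<phi>) ?D"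
    by (simp add: o_def)
qed

lemma hol_on_compose_chart:
  assumes M: "complex_manifold M" and ch: "(U, \<phi>) \<in> atlas M" and W: "open W" "W \<subseteq> U"
    and E: "openin (top_of_set (Cspace (cdim M))) E"
    and f: "holomorphic_Cspace (cdim M) f E" and mem: "\<phi> ` W \<subseteq> E"
  shows "hol_on M (\<lambda>q. f (\<phi> q)) W"
proof (rule hol_on_cong[OF M W(1)])
  show "hol_on M (\<lambda>q. f (\<lambda>i. if i < cdim M then \<phi> q i else 0)) W"
    by (rule hol_on_compose_Cspace[OF M f E W(1)])
       (use W mem chart_vanish[OF M ch] in \<open>auto intro: hol_on_subset[OF hol_on_coord[OF M ch]]\<close>)
  show "f (\<lambda>i. if i < cdim M then \<phi> q i else 0) = f (\<phi> q)" if "q \<in> W" for q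
    using chart_vanish[OF M ch] that W by auto
qed

definition cpd :: "'a set \<Rightarrow> ('a \<Rightarrow> nat \<Rightarrow> complex) \<Rightarrow> nat \<Rightarrow> ('a \<Rightarrow> complex) \<Rightarrow> 'a \<Rightarrow> complex" where
  "cpd U \<phi> i f q = pd i (f \<circ> inv_into U \<phi>) (\<phi> q)"

lemma hol_on_cpd:
  assumes M: "complex_manifold M" and ch: "(U, \<phi>) \<in> atlas M" and W: "open W"
    and f: "hol_on M f W" and i: "i < cdim M"
  shows "hol_on M (cpd U \<phi> i f) (U \<inter> W)"
  unfolding cpd_def
proof (rule hol_on_compose_chart[OF M ch])
  have "holomorphic_Cspace (cdim M) (f \<circ> inv_into U \<phi>) (\<phi> ` (U \<inter> W))"
    using f ch by (auto simp: hol_on_def)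
  then show "holomorphic_Cspace (cdim M) (pd i (f \<circ> inv_into U \<phi>)) (\<phi> ` (U \<inter> W))"
    by (rule holomorphic_Cspace_pd[OF _ openin_chart_image[OF M ch W] i])
qed (use openin_chart_image[OF M ch W] chart_open[OF M ch] W in auto)

section \<open>Germs of holomorphic functions\<close>

lemma hol_nearI: "open W \<Longrightarrow> p \<in> W \<Longrightarrow> hol_on M f W \<Longrightarrow> hol_near M p f"
  by (auto simp: hol_near_def)

lemma hol_near2:
  assumes "hol_near M p f" "hol_near M p g"
  obtains W where "open W" "p \<in> W" "hol_on M f W" "hol_on M g W"
proof -
  obtain U V where "open U" "p \<in> U" "hol_on M f U" "open V" "p \<in> V" "hol_on M g V"
    using assms by (auto simp: hol_near_def)
  with that[of "U \<inter> V"] show thesis by (meson hol_on_subset inf_le1 inf_le2 IntI open_Int)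
qed

lemma hol_near_const: "hol_near M p (\<lambda>x. c)"
  by (rule hol_nearI[OF open_UNIV]) (auto simp: hol_on_const)

lemma hol_near_add: "hol_near M p f \<Longrightarrow> hol_near M p g \<Longrightarrow> hol_near M p (\<lambda>x. f x + g x)"
  by (metis hol_near2 hol_nearI hol_on_add)

lemma hol_near_mult: "hol_near M p f \<Longrightarrow> hol_near M p g \<Longrightarrow> hol_near M p (\<lambda>x. f x * g x)"
  by (metis hol_near2 hol_nearI hol_on_mult)

lemma hol_near_sum: "(\<And>i. i \<in> I \<Longrightarrow> hol_near M p (f i)) \<Longrightarrow> hol_near M p (\<lambda>x. \<Sum>i\<in>I. f i x)"
  by (induction I rule: infinite_finite_induct) (auto simp: hol_near_const hol_near_add)

lemma hol_near_coord:
  assumes "complex_manifold M" "(U, \<phi>) \<in> atlas M" "p \<in> U" "i < cdim M"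
  shows "hol_near M p (\<lambda>q. \<phi> q i)"
  by (rule hol_nearI[OF chart_open[OF assms(1,2)] assms(3) hol_on_coord[OF assms(1,2,4)]])

lemma hol_near_cong:
  assumes "complex_manifold M" "\<forall>\<^sub>F x in nhds p. f x = g x" "hol_near M p f"
  shows "hol_near M p g"
proof -
  obtain V where V: "open V" "p \<in> V" "\<And>x. x \<in> V \<Longrightarrow> f x = g x"
    using assms(2) by (auto simp: eventually_nhds)
  obtain W where W: "open W" "p \<in> W" "hol_on M f W" using assms(3) by (auto simp: hol_near_def)
  have "hol_on M g (V \<inter> W)"
    by (rule hol_on_cong[OF assms(1) _ _ hol_on_subset[OF W(3)]]) (use V W in auto)
  then show ?thesis by (rule hol_nearI[rotated -1]) (use V W in auto)
qed

section \<open>Tangent vectors as derivations of germs\<close>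

lemma tv_add: "tangent_vector M p v \<Longrightarrow> hol_near M p f \<Longrightarrow> hol_near M p g \<Longrightarrow> v (\<lambda>x. f x + g x) = v f + v g"
  unfolding tangent_vector_def by blast

lemma tv_mult: "tangent_vector M p v \<Longrightarrow> hol_near M p f \<Longrightarrow> hol_near M p g \<Longrightarrow>
    v (\<lambda>x. f x * g x) = f p * v g + g p * v f"
  unfolding tangent_vector_def by blast

lemma tv_cmult: "tangent_vector M p v \<Longrightarrow> hol_near M p f \<Longrightarrow> v (\<lambda>x. c * f x) = c * v f"
  unfolding tangent_vector_def by blast

lemma tv_not_hol_near: "tangent_vector M p v \<Longrightarrow> \<not> hol_near M p f \<Longrightarrow> v f = 0"
  unfolding tangent_vector_def by blast

lemma tv_cong:
  "tangent_vector M p v \<Longrightarrow> hol_near M p f \<Longrightarrow> hol_near M p g \<Longrightarrow> \<forall>\<^sub>F x in nhds p. f x = g x \<Longrightarrow> v f = v g"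
  unfolding tangent_vector_def by blast

lemma tangent_vectorI:
  assumes "\<And>f g. hol_near M p f \<Longrightarrow> hol_near M p g \<Longrightarrow> v (\<lambda>x. f x + g x) = v f + v g"
    and "\<And>f g. hol_near M p f \<Longrightarrow> hol_near M p g \<Longrightarrow> v (\<lambda>x. f x * g x) = f p * v g + g p * v f"
    and "\<And>c f. hol_near M p f \<Longrightarrow> v (\<lambda>x. c * f x) = c * v f"
    and "\<And>f g. hol_near M p f \<Longrightarrow> hol_near M p g \<Longrightarrow> \<forall>\<^sub>F x in nhds p. f x = g x \<Longrightarrow> v f = v g"
    and "\<And>f. \<not> hol_near M p f \<Longrightarrow> v f = 0"
  shows "tangent_vector M p v"
  unfolding tangent_vector_def using assms by blast

lemma tv_cong_on:
  assumes "complex_manifold M" "tangent_vector M p v" "hol_on M f W" "open W" "p \<in> W"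
    "\<And>x. x \<in> W \<Longrightarrow> f x = g x"
  shows "v f = v g"
proof (rule tv_cong[OF assms(2)])
  show "hol_near M p f" "hol_near M p g"
    using assms hol_on_cong[OF assms(1,4,6,3)] by (auto intro: hol_nearI)
  show "\<forall>\<^sub>F x in nhds p. f x = g x"
    using eventually_nhds_in_open[OF assms(4,5)] by (rule eventually_mono) (rule assms(6))
qed

lemma tv_const:
  assumes "tangent_vector M p v" shows "v (\<lambda>x. c) = 0"
proof -
  \<comment> \<open>Since 1 = 1 * 1, the product rule gives \<open>v 1 = 2 * v 1\<close>.\<close>
  have "v (\<lambda>x. 1) = 0" using tv_mult[OF assms hol_near_const hol_near_const, of 1 1] by simp
  then show ?thesis using tv_cmult[OF assms hol_near_const, of c 1] by simp
qed

lemma tv_sum: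
  assumes "tangent_vector M p v" "\<And>i. i \<in> I \<Longrightarrow> hol_near M p (f i)"
  shows "v (\<lambda>x. \<Sum>i\<in>I. f i x) = (\<Sum>i\<in>I. v (f i))"
  using assms(2)
  by (induction I rule: infinite_finite_induct)
     (auto simp: tv_const[OF assms(1)] tv_add[OF assms(1)] hol_near_sum)

text \<open>In the chart, Hadamard's lemma writes \<open>f\<close> near \<open>p\<close> as
  \<open>f p\<close> plus a sum of products of \<phi> i - a i, which vanishes at \<open>p\<close>,
  with a holomorphic factor. A derivation kills the constant and sees only the value of that factor
  at \<open>p\<close>, a partial derivative of \<open>f\<close>.\<close>

lemma tangent_vector_expansion:
  assumes M: "complex_manifold M" and ch: "(U, \<phi>) \<in> atlas M" and p: "p \<in> U"
    and v: "tangent_vector M p v" and f: "hol_near M p f"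
  shows "v f = (\<Sum>i<cdim M. v (\<lambda>q. \<phi> q i) * cpd U \<phi> i f p)"
proof -
  let ?n = "cdim M"
  obtain W where W: "open W" "p \<in> W" "hol_on M f W" using f by (auto simp: hol_near_def)
  define a where "a = \<phi> p"
  have aC: "a \<in> Cspace ?n" using chart_in_Cspace[OF M ch p] by (simp add: a_def)
  let ?E = "\<phi> ` (U \<inter> W)"
  have E: "openin (top_of_set (Cspace ?n)) ?E" by (rule openin_chart_image[OF M ch W(1)])
  have hf: "holomorphic_Cspace ?n (f \<circ> inv_into U \<phi>) ?E" using W(3) ch by (auto simp: hol_on_def)
  obtain r where r: "r > 0" "pdisc ?n a r \<subseteq> ?E"
    using openin_contains_pdisc[OF E, of a] p W(2) by (auto simp: a_def)
  let ?P = "pdisc ?n a r"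
  obtain g where g': "\<forall>i<?n. holomorphic_Cspace ?n (g i) ?P \<and> g i a = pd i (f \<circ> inv_into U \<phi>) a"
    "\<forall>x\<in>?P. (f \<circ> inv_into U \<phi>) x = (f \<circ> inv_into U \<phi>) a + (\<Sum>i<?n. (x i - a i) * g i x)"
    using Hadamard[OF holomorphic_Cspace_subset[OF hf r(2)] aC r(1)] .
  have g: "\<And>i. i < ?n \<Longrightarrow> holomorphic_Cspace ?n (g i) ?P"
    "\<And>i. i < ?n \<Longrightarrow> g i a = pd i (f \<circ> inv_into U \<phi>) a"
    "\<And>x. x \<in> ?P \<Longrightarrow> (f \<circ> inv_into U \<phi>) x = (f \<circ> inv_into U \<phi>) a + (\<Sum>i<?n. (x i - a i) * g i x)"
    using g' by auto
  \<comment> \<open>The cylinder is open in the whole sequence space, which makes \<open>V\<close>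
    open in the manifold; on \<open>U\<close> its preimage is that of the polydisc.\<close>
  define V where "V = U \<inter> \<phi> -` {x. \<forall>i<?n. x i \<in> ball (a i) r}"
  have V: "open V" "V \<subseteq> U"
    unfolding V_def
    using continuous_open_preimage[OF _ chart_open[OF M ch] open_pdisc_basis]
      chart_homeomorphism[OF M ch] by (auto simp: homeomorphism_def)
  have VP: "\<phi> ` V \<subseteq> ?P" using chart_in_Cspace[OF M ch] by (auto simp: V_def pdisc_def)
  have pV: "p \<in> V" using p r(1) by (auto simp: V_def a_def)
  have G: "hol_near M p (\<lambda>q. g i (\<phi> q))" if "i < ?n" for i
    by (rule hol_nearI[OF V(1) pV hol_on_compose_chart[OF M ch V openin_pdisc g(1)[OF that] VP]])
  have x: "hol_near M p (\<lambda>q. \<phi> q i + - a i)" if "i < ?n" for i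
    by (intro hol_near_add hol_near_const hol_near_coord[OF M ch p that])
  have trm: "hol_near M p (\<lambda>q. (\<phi> q i + - a i) * g i (\<phi> q))" if "i < ?n" for i
    by (rule hol_near_mult[OF x[OF that] G[OF that]])
  have "v f = v (\<lambda>q. f p + (\<Sum>i<?n. (\<phi> q i + - a i) * g i (\<phi> q)))"
  proof (rule tv_cong[OF v f])
    show "hol_near M p (\<lambda>q. f p + (\<Sum>i<?n. (\<phi> q i + - a i) * g i (\<phi> q)))"
      by (intro hol_near_add hol_near_const hol_near_sum) (use trm in auto)
    have "f q = f p + (\<Sum>i<?n. (\<phi> q i + - a i) * g i (\<phi> q))" if "q \<in> V" for q
    proof -
      have "\<phi> q \<in> ?P" "q \<in> U" using VP V(2) that by auto
      then show ?thesis using g(3)[of "\<phi> q"] inv_into_chart[OF M ch] p by (simp add: a_def)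
    qed
    with eventually_nhds_in_open[OF V(1) pV]
    show "\<forall>\<^sub>F q in nhds p. f q = f p + (\<Sum>i<?n. (\<phi> q i + - a i) * g i (\<phi> q))"
      by (rule eventually_mono)
  qed
  also have "\<dots> = (\<Sum>i<?n. v (\<lambda>q. (\<phi> q i + - a i) * g i (\<phi> q)))"
  proof -
    have "v (\<lambda>q. f p + (\<Sum>i<?n. (\<phi> q i + - a i) * g i (\<phi> q))) =
        v (\<lambda>q. f p) + v (\<lambda>q. \<Sum>i<?n. (\<phi> q i + - a i) * g i (\<phi> q))"
      by (rule tv_add[OF v hol_near_const hol_near_sum]) (rule trm, simp)
    also have "v (\<lambda>q. f p) = 0" by (rule tv_const[OF v])
    also have "v (\<lambda>q. \<Sum>i<?n. (\<phi> q i + - a i) * g i (\<phi> q)) =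
        (\<Sum>i<?n. v (\<lambda>q. (\<phi> q i + - a i) * g i (\<phi> q)))"
      by (rule tv_sum[OF v]) (rule trm, simp)
    finally show ?thesis by simp
  qed
  also have "\<dots> = (\<Sum>i<?n. v (\<lambda>q. \<phi> q i) * cpd U \<phi> i f p)"
  proof (rule sum.cong[OF refl])
    fix i assume "i \<in> {..<?n}"
    then have i: "i < ?n" by simp
    have "v (\<lambda>q. \<phi> q i + - a i) = v (\<lambda>q. \<phi> q i)"
      by (subst tv_add[OF v hol_near_coord[OF M ch p i] hol_near_const]) (simp add: tv_const[OF v])
    \<comment> \<open>The other term of the product rule carries the factor
      \<open>\<phi> p i - a i = 0\<close>.\<close>
    then show "v (\<lambda>q. (\<phi> q i + - a i) * g i (\<phi> q)) = v (\<lambda>q. \<phi> q i) * cpd U \<phi> i f p"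
      using tv_mult[OF v x[OF i] G[OF i]] g(2)[OF i] by (simp add: a_def cpd_def)
  qed
  finally show ?thesis .
qed

text \<open>On holomorphic germs both sides have the same expansion, and on all other functions both
  are 0 by convention.\<close>

lemma tangent_vector_eqI:
  assumes M: "complex_manifold M" and ch: "(U, \<phi>) \<in> atlas M" and p: "p \<in> U"
    and v: "tangent_vector M p v" and w: "tangent_vector M p w"
    and eq: "\<And>i. i < cdim M \<Longrightarrow> v (\<lambda>q. \<phi> q i) = w (\<lambda>q. \<phi> q i)"
  shows "v = w"
proof
  fix f show "v f = w f"
    using tangent_vector_expansion[OF M ch p v, of f] tangent_vector_expansion[OF M ch p w, of f] eq
      tv_not_hol_near[OF v, of f] tv_not_hol_near[OF w, of f]
    by (cases "hol_near M p f") auto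
qed

text \<open>The coordinate vector of the chart at \<open>p\<close>; the guard supplies the value 0
  that \<open>tangent_vector\<close> prescribes off the holomorphic germs.\<close>

definition cvec :: "('a::topological_space) cmanifold \<Rightarrow> 'a set \<Rightarrow> ('a \<Rightarrow> nat \<Rightarrow> complex) \<Rightarrow> nat \<Rightarrow>
    'a \<Rightarrow> ('a \<Rightarrow> complex) \<Rightarrow> complex" where
  "cvec M U \<phi> i p f = (if hol_near M p f then cpd U \<phi> i f p else 0)"

lemma tangent_vector_cvec:
  assumes M: "complex_manifold M" and ch: "(U, \<phi>) \<in> atlas M" and p: "p \<in> U" and i: "i < cdim M"
  shows "tangent_vector M p (cvec M U \<phi> i p)"
proof -
  let ?inv = "inv_into U \<phi>"
  have D: "((\<lambda>z. (f \<circ> ?inv) ((\<phi> p)(i := z))) has_field_derivative cpd U \<phi> i f p) (at (\<phi> p i))"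
    if f: "hol_near M p f" for f
  proof -
    obtain W where W: "open W" "p \<in> W" "hol_on M f W" using f by (auto simp: hol_near_def)
    have "holomorphic_Cspace (cdim M) (f \<circ> ?inv) (\<phi> ` (U \<inter> W))" using W(3) ch by (auto simp: hol_on_def)
    from has_pd[OF this _ i] show ?thesis using p W(2) by (simp add: cpd_def)
  qed
  have val: "f (?inv ((\<phi> p)(i := \<phi> p i))) = f p" for f :: "'a \<Rightarrow> complex" using M ch p by simp
  show ?thesis
  proof (rule tangent_vectorI)
    fix f g assume f: "hol_near M p f" and g: "hol_near M p g"
    have "((\<lambda>z. ((\<lambda>x. f x + g x) \<circ> ?inv) ((\<phi> p)(i := z))) has_field_derivative
        cpd U \<phi> i f p + cpd U \<phi> i g p) (at (\<phi> p i))"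
      using DERIV_add[OF D[OF f] D[OF g]] by (simp add: o_def)
    from DERIV_imp_deriv[OF this]
    show "cvec M U \<phi> i p (\<lambda>x. f x + g x) = cvec M U \<phi> i p f + cvec M U \<phi> i p g"
      by (simp add: cvec_def f g hol_near_add cpd_def pd_def)
  next
    fix f g assume f: "hol_near M p f" and g: "hol_near M p g"
    have "((\<lambda>z. ((\<lambda>x. f x * g x) \<circ> ?inv) ((\<phi> p)(i := z))) has_field_derivative
        cpd U \<phi> i f p * g p + cpd U \<phi> i g p * f p) (at (\<phi> p i))"
      using DERIV_mult[OF D[OF f] D[OF g]] unfolding o_def val .
    from DERIV_imp_deriv[OF this]
    show "cvec M U \<phi> i p (\<lambda>x. f x * g x) = f p * cvec M U \<phi> i p g + g p * cvec M U \<phi> i p f"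
      by (simp add: cvec_def f g hol_near_mult cpd_def pd_def mult.commute)
  next
    fix c f assume f: "hol_near M p f"
    have "((\<lambda>z. ((\<lambda>x. c * f x) \<circ> ?inv) ((\<phi> p)(i := z))) has_field_derivative
        c * cpd U \<phi> i f p) (at (\<phi> p i))"
      using DERIV_cmult[OF D[OF f], of c] by (simp add: o_def)
    from DERIV_imp_deriv[OF this] show "cvec M U \<phi> i p (\<lambda>x. c * f x) = c * cvec M U \<phi> i p f"
      by (simp add: cvec_def f hol_near_mult hol_near_const cpd_def pd_def)
  next
    fix f g assume f: "hol_near M p f" and g: "hol_near M p g" and "\<forall>\<^sub>F x in nhds p. f x = g x"
    then obtain W where W: "open W" "p \<in> W" "\<And>x. x \<in> W \<Longrightarrow> f x = g x" by (auto simp: eventually_nhds)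
    have "cpd U \<phi> i f p = cpd U \<phi> i g p"
      unfolding cpd_def
      by (rule pd_cong[OF openin_chart_image[OF M ch W(1)]]) (use W p i M ch in auto)
    then show "cvec M U \<phi> i p f = cvec M U \<phi> i p g" by (simp add: cvec_def f g)
  qed (simp add: cvec_def)
qed

lemma cvec_coord:
  assumes M: "complex_manifold M" and ch: "(U, \<phi>) \<in> atlas M" and p: "p \<in> U"
    and i: "i < cdim M" and j: "j < cdim M"
  shows "cvec M U \<phi> i p (\<lambda>q. \<phi> q j) = (if i = j then 1 else 0)"
proof -
  have "cpd U \<phi> i (\<lambda>q. \<phi> q j) p = pd i (\<lambda>x. x j) (\<phi> p)"
    unfolding cpd_def
    by (rule pd_cong[OF openin_chart_image[OF M ch open_UNIV]]) (use p i M ch in auto)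
  also have "\<dots> = (if i = j then 1 else 0)" by (auto simp: pd_def)
  finally show ?thesis using hol_near_coord[OF M ch p j] by (simp add: cvec_def)
qed

lemma tangent_vector_sum:
  assumes "\<And>i. i \<in> I \<Longrightarrow> tangent_vector M p (v i)"
  shows "tangent_vector M p (\<lambda>f. \<Sum>i\<in>I. c i * v i f)"
proof -
  have "tangent_vector M p (\<lambda>f. 0)" by (rule tangent_vectorI) simp_all
  moreover have "tangent_vector M p (\<lambda>f. c * v f + w f)" if "tangent_vector M p v" "tangent_vector M p w" for c v w
  proof (rule tangent_vectorI)
    fix f g assume "hol_near M p f" "hol_near M p g" "\<forall>\<^sub>F x in nhds p. f x = g x"
    from tv_cong[OF that(1) this] tv_cong[OF that(2) this] show "c * v f + w f = c * v g + w g" by simp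
  qed (simp_all add: tv_add[OF that(1)] tv_add[OF that(2)] tv_mult[OF that(1)] tv_mult[OF that(2)]
         tv_cmult[OF that(1)] tv_cmult[OF that(2)] tv_not_hol_near[OF that(1)] tv_not_hol_near[OF that(2)]
         algebra_simps)
  ultimately show ?thesis using assms
    by (induction I rule: infinite_finite_induct) auto
qed

lemma tangent_vector_basis:
  assumes M: "complex_manifold M" and ch: "(U, \<phi>) \<in> atlas M" and p: "p \<in> U" and v: "tangent_vector M p v"
  shows "v = (\<lambda>f. \<Sum>i<cdim M. v (\<lambda>q. \<phi> q i) * cvec M U \<phi> i p f)"
proof (rule tangent_vector_eqI[OF M ch p v])
  show "tangent_vector M p (\<lambda>f. \<Sum>i<cdim M. v (\<lambda>q. \<phi> q i) * cvec M U \<phi> i p f)"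
    by (rule tangent_vector_sum) (use tangent_vector_cvec[OF M ch p] in auto)
  fix j assume j: "j < cdim M"
  have "(\<Sum>i<cdim M. v (\<lambda>q. \<phi> q i) * cvec M U \<phi> i p (\<lambda>q. \<phi> q j)) =
        (\<Sum>i<cdim M. if i = j then v (\<lambda>q. \<phi> q j) else 0)"
    by (rule sum.cong) (auto simp: cvec_coord[OF M ch p _ j])
  then show "v (\<lambda>q. \<phi> q j) = (\<Sum>i<cdim M. v (\<lambda>q. \<phi> q i) * cvec M U \<phi> i p (\<lambda>q. \<phi> q j))"
    using j by simp
qed

section \<open>Holomorphic maps and their differentials\<close>

lemma hol_map_on: "hol_map M N \<Phi> \<Longrightarrow> open V \<Longrightarrow> hol_on N h V \<Longrightarrow> hol_on M (\<lambda>x. h (\<Phi> x)) (\<Phi> -` V)"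
  by (auto simp: hol_map_def o_def)

lemma hol_map_open: "hol_map M N \<Phi> \<Longrightarrow> open V \<Longrightarrow> open (\<Phi> -` V)"
  by (auto simp: hol_map_def intro: open_vimage)

lemma hol_map_near: "hol_map M N \<Phi> \<Longrightarrow> hol_near N (\<Phi> p) h \<Longrightarrow> hol_near M p (\<lambda>x. h (\<Phi> x))"
  unfolding hol_near_def by (metis hol_map_on hol_map_open vimageI2)

lemma hol_map_id: "hol_map M M (\<lambda>x. x)"
  by (auto simp: hol_map_def o_def)

lemma hol_map_const: "hol_map M N (\<lambda>x. c)"
  by (auto simp: hol_map_def o_def hol_on_const)

lemma hol_map_compose:
  assumes "hol_map M N \<Phi>" "hol_map N K \<Psi>" shows "hol_map M K (\<lambda>x. \<Psi> (\<Phi> x))"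
  unfolding hol_map_def
proof (intro conjI allI impI)
  show "continuous_on UNIV (\<lambda>x. \<Psi> (\<Phi> x))"
    by (rule continuous_on_compose2[where g = \<Psi> and t = UNIV]) (use assms in \<open>auto simp: hol_map_def\<close>)
  fix V h assume V: "open V" "hol_on K h V"
  then show "hol_on M (h \<circ> (\<lambda>x. \<Psi> (\<Phi> x))) ((\<lambda>x. \<Psi> (\<Phi> x)) -` V)"
    using hol_map_on[OF assms(1) hol_map_open[OF assms(2) V(1)] hol_map_on[OF assms(2) V]]
    by (simp add: o_def vimage_def)
qed

text \<open>The differential of \<Phi>, with \<open>q\<close> meant to be the image point. The guard
  matters because \<open>f\<close> composed with \<Phi> may be holomorphic although \<open>f\<close>
  is not, for instance when \<Phi> embeds a slice of a product.\<close>

definition push :: "('b::topological_space) cmanifold \<Rightarrow> 'b \<Rightarrow> ('a \<Rightarrow> 'b) \<Rightarrow>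
    (('a \<Rightarrow> complex) \<Rightarrow> complex) \<Rightarrow> ('b \<Rightarrow> complex) \<Rightarrow> complex" where
  "push N q \<Phi> v f = (if hol_near N q f then v (\<lambda>x. f (\<Phi> x)) else 0)"

lemma tangent_vector_push:
  fixes M :: "('a::t2_space) cmanifold"
  assumes \<Phi>: "hol_map M N \<Phi>" and v: "tangent_vector M p v"
  shows "tangent_vector N (\<Phi> p) (push N (\<Phi> p) \<Phi> v)"
proof -
  note near = hol_map_near[OF \<Phi>]
  have lim: "isCont \<Phi> p"
    using \<Phi> by (simp add: hol_map_def continuous_on_eq_continuous_at)
  show ?thesis
  proof (rule tangent_vectorI)
    fix f g assume f: "hol_near N (\<Phi> p) f" and g: "hol_near N (\<Phi> p) g" and ev: "\<forall>\<^sub>F x in nhds (\<Phi> p). f x = g x"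
    have "\<forall>\<^sub>F x in nhds p. f (\<Phi> x) = g (\<Phi> x)"
      using eventually_compose_filterlim[OF ev lim[unfolded isCont_def tendsto_at_iff_tendsto_nhds]] .
    then show "push N (\<Phi> p) \<Phi> v f = push N (\<Phi> p) \<Phi> v g"
      using tv_cong[OF v near[OF f] near[OF g]] by (simp add: push_def f g)
  qed (simp_all add: push_def hol_near_add hol_near_mult hol_near_const near
         tv_add[OF v] tv_mult[OF v] tv_cmult[OF v] tv_const[OF v])
qed

section \<open>Product manifolds\<close>

definition prod_chart :: "nat \<Rightarrow> ('a \<Rightarrow> nat \<Rightarrow> complex) \<Rightarrow> ('b \<Rightarrow> nat \<Rightarrow> complex) \<Rightarrow> 'a \<times> 'b \<Rightarrow> nat \<Rightarrow> complex" where
  "prod_chart m \<phi> \<psi> = (\<lambda>(x, y) i. if i < m then \<phi> x i else \<psi> y (i - m))"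

lemma prod_chart_apply: "prod_chart m \<phi> \<psi> (x, y) i = (if i < m then \<phi> x i else \<psi> y (i - m))"
  by (simp add: prod_chart_def)

definition fpart :: "nat \<Rightarrow> (nat \<Rightarrow> complex) \<Rightarrow> nat \<Rightarrow> complex" where
  "fpart m z = (\<lambda>i. if i < m then z i else 0)"

definition spart :: "nat \<Rightarrow> (nat \<Rightarrow> complex) \<Rightarrow> nat \<Rightarrow> complex" where
  "spart m z = (\<lambda>i. z (i + m))"

lemma cdim_prod [simp]: "cdim (prod_manifold M N) = cdim M + cdim N"
  by (simp add: prod_manifold_def)

lemma atlas_prod: "atlas (prod_manifold M N) =
    {(U \<times> V, prod_chart (cdim M) \<phi> \<psi>) | U \<phi> V \<psi>. (U, \<phi>) \<in> atlas M \<and> (V, \<psi>) \<in> atlas N}"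
  by (simp add: prod_manifold_def prod_chart_def)

lemma prod_chart_in_atlas:
  "(U, \<phi>) \<in> atlas M \<Longrightarrow> (V, \<psi>) \<in> atlas N \<Longrightarrow> (U \<times> V, prod_chart (cdim M) \<phi> \<psi>) \<in> atlas (prod_manifold M N)"
  by (auto simp: atlas_prod)

lemma continuous_on_fpart: "continuous_on S (fpart m)"
proof (rule continuous_on_coordinatewise_then_product)
  show "continuous_on S (\<lambda>x. fpart m x i)" for i
    by (cases "i < m") (simp_all add: fpart_def continuous_on_coord)
qed

lemma continuous_on_spart: "continuous_on S (spart m)"
  by (rule continuous_on_coordinatewise_then_product) (simp add: spart_def continuous_on_coord)

text \<open>A change of one coordinate either passes through \<open>fpart m\<close> as a change of
  the same coordinate or is cut off; \<open>spart\<close> below behaves alike with a shift of the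
  index.\<close>

lemma holomorphic_Cspace_fpart:
  assumes F: "holomorphic_Cspace m F D" and E: "\<And>z. z \<in> E \<Longrightarrow> fpart m z \<in> D"
  shows "holomorphic_Cspace k (\<lambda>z. F (fpart m z)) E"
  unfolding holomorphic_Cspace_def
proof (intro conjI ballI allI impI)
  show "continuous_on E (\<lambda>z. F (fpart m z))"
    by (rule continuous_on_compose2[OF _ continuous_on_fpart, of D F]) (use F E in \<open>auto simp: holomorphic_Cspace_def\<close>)
  fix z i assume z: "z \<in> E"
  show "(\<lambda>w. F (fpart m (z(i := w)))) field_differentiable at (z i)"
  proof (cases "i < m")
    case True
    then have "fpart m (z(i := w)) = (fpart m z)(i := w)" for w by (auto simp: fpart_def)
    with True show ?thesis
      using F[unfolded holomorphic_Cspace_def, THEN conjunct2, rule_format, OF E[OF z] True]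
      by (simp add: fpart_def)
  next
    case False
    then have "fpart m (z(i := w)) = fpart m z" for w by (auto simp: fpart_def)
    then show ?thesis by simp
  qed
qed

lemma holomorphic_Cspace_spart:
  assumes F: "holomorphic_Cspace n F D" and E: "\<And>z. z \<in> E \<Longrightarrow> spart m z \<in> D"
  shows "holomorphic_Cspace (m + n) (\<lambda>z. F (spart m z)) E"
  unfolding holomorphic_Cspace_def
proof (intro conjI ballI allI impI)
  show "continuous_on E (\<lambda>z. F (spart m z))"
    by (rule continuous_on_compose2[OF _ continuous_on_spart, of D F]) (use F E in \<open>auto simp: holomorphic_Cspace_def\<close>)
  fix z i assume z: "z \<in> E" and i: "i < m + n"
  show "(\<lambda>w. F (spart m (z(i := w)))) field_differentiable at (z i)"
  proof (cases "i < m")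
    case True
    then have "spart m (z(i := w)) = spart m z" for w by (auto simp: spart_def)
    then show ?thesis by simp
  next
    case False
    then have "spart m (z(i := w)) = (spart m z)(i - m := w)" for w by (auto simp: spart_def fun_eq_iff)
    moreover have "spart m z (i - m) = z i" using False by (simp add: spart_def)
    moreover have "i - m < n" using i False by simp
    ultimately show ?thesis
      using F[unfolded holomorphic_Cspace_def, THEN conjunct2, rule_format, OF E[OF z], of "i - m"] by simp
  qed
qed

lemma spart_prod_chart: "spart m (prod_chart m \<phi> \<psi> (x, y)) = \<psi> y"
  by (simp add: spart_def prod_chart_def)

context
  fixes M :: "('a::t2_space) cmanifold" and N :: "('b::t2_space) cmanifold"
  assumes M: "complex_manifold M" and N: "complex_manifold N"
begin

lemma fpart_prod_chart:
  assumes "(U, \<phi>) \<in> atlas M" "x \<in> U"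
  shows "fpart (cdim M) (prod_chart (cdim M) \<phi> \<psi> (x, y :: 'b)) = \<phi> x"
  using chart_vanish[OF M assms] by (simp add: fpart_def prod_chart_def cong: if_cong)

text \<open>Describes the image by conditions on the two halves of the coordinates, so that openness
  and the inverse of a product chart can be read off from the factors.\<close>

lemma prod_chart_image:
  assumes U: "(U, \<phi>) \<in> atlas M" and V: "(V, \<psi>) \<in> atlas N" and "A \<subseteq> U" "B \<subseteq> V"
  shows "prod_chart (cdim M) \<phi> \<psi> ` (A \<times> B) =
    {z \<in> Cspace (cdim M + cdim N). fpart (cdim M) z \<in> \<phi> ` A \<and> spart (cdim M) z \<in> \<psi> ` B}" (is "?P ` _ = ?R")
proof
  show "?P ` (A \<times> B) \<subseteq> ?R"
  proof clarify
    fix x y assume xy: "x \<in> A" "y \<in> B"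
    then have "\<phi> x \<in> Cspace (cdim M)" "\<psi> y \<in> Cspace (cdim N)"
      using chart_in_Cspace[OF M U] chart_in_Cspace[OF N V] assms by auto
    then have "?P (x, y) \<in> Cspace (cdim M + cdim N)" by (auto simp: Cspace_def prod_chart_def)
    then show "?P (x, y) \<in> Cspace (cdim M + cdim N) \<and> fpart (cdim M) (?P (x, y)) \<in> \<phi> ` A \<and>
        spart (cdim M) (?P (x, y)) \<in> \<psi> ` B"
      using xy assms(3) fpart_prod_chart[OF U] by (auto simp: spart_prod_chart)
  qed
  show "?R \<subseteq> ?P ` (A \<times> B)"
  proof clarify
    fix z x y assume z: "z \<in> Cspace (cdim M + cdim N)"
      and x: "fpart (cdim M) z = \<phi> x" "x \<in> A" and y: "spart (cdim M) z = \<psi> y" "y \<in> B"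
    have "z i = ?P (x, y) i" for i
    proof (cases "i < cdim M")
      case True
      then show ?thesis using fun_cong[OF x(1), of i] by (simp add: fpart_def prod_chart_def)
    next
      case False
      then show ?thesis using fun_cong[OF y(1), of "i - cdim M"] by (simp add: spart_def prod_chart_def)
    qed
    then have "z = ?P (x, y)" by blast
    with x y show "z \<in> ?P ` (A \<times> B)" by blast
  qed
qed

lemma openin_prod_chart_image:
  assumes U: "(U, \<phi>) \<in> atlas M" and V: "(V, \<psi>) \<in> atlas N"
  shows "openin (top_of_set (Cspace (cdim M + cdim N))) (prod_chart (cdim M) \<phi> \<psi> ` (U \<times> V))"
proof -
  obtain T1 T2 where T: "open T1" "\<phi> ` U = Cspace (cdim M) \<inter> T1" "open T2" "\<psi> ` V = Cspace (cdim N) \<inter> T2"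
    using openin_chart_image[OF M U open_UNIV] openin_chart_image[OF N V open_UNIV]
    by (auto simp: openin_open)
  have "fpart (cdim M) z \<in> Cspace (cdim M)" "spart (cdim M) z \<in> Cspace (cdim N)"
    if "z \<in> Cspace (cdim M + cdim N)" for z
    using that by (auto simp: Cspace_def fpart_def spart_def)
  then have "prod_chart (cdim M) \<phi> \<psi> ` (U \<times> V) =
      Cspace (cdim M + cdim N) \<inter> (fpart (cdim M) -` T1 \<inter> spart (cdim M) -` T2)"
    unfolding prod_chart_image[OF U V order_refl order_refl] T by auto
  moreover have "open (fpart (cdim M) -` T1 \<inter> spart (cdim M) -` T2)"
    using T by (intro open_Int open_vimage continuous_on_fpart continuous_on_spart)
  ultimately show ?thesis by (auto simp: openin_open)
qed

lemma prod_chart_homeomorphism: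
  assumes U: "(U, \<phi>) \<in> atlas M" and V: "(V, \<psi>) \<in> atlas N"
  shows "homeomorphism (U \<times> V) (prod_chart (cdim M) \<phi> \<psi> ` (U \<times> V)) (prod_chart (cdim M) \<phi> \<psi>)
           (\<lambda>z. (inv_into U \<phi> (fpart (cdim M) z), inv_into V \<psi> (spart (cdim M) z)))"
    (is "homeomorphism _ ?I ?P ?Q")
proof -
  note hU = chart_homeomorphism[OF M U] and hV = chart_homeomorphism[OF N V]
  have im: "fpart (cdim M) z \<in> \<phi> ` U" "spart (cdim M) z \<in> \<psi> ` V" if "z \<in> ?I" for z
    using that unfolding prod_chart_image[OF U V order_refl order_refl] by auto
  show ?thesis
  proof (rule homeomorphismI)
    have cU: "continuous_on U \<phi>" and cV: "continuous_on V \<psi>" using hU hV by (auto simp: homeomorphism_def)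
    show "continuous_on (U \<times> V) ?P"
    proof (rule continuous_on_coordinatewise_then_product)
      fix i
      have "continuous_on (U \<times> V) (\<lambda>p. \<phi> (fst p))"
        by (rule continuous_on_compose2[OF cU continuous_on_fst[OF continuous_on_id]]) auto
      moreover have "continuous_on (U \<times> V) (\<lambda>p. \<psi> (snd p))"
        by (rule continuous_on_compose2[OF cV continuous_on_snd[OF continuous_on_id]]) auto
      ultimately show "continuous_on (U \<times> V) (\<lambda>p. ?P p i)"
        by (cases "i < cdim M")
           (auto simp: prod_chart_def case_prod_unfold intro: continuous_on_product_then_coordinatewise)
    qed
    have "continuous_on (\<phi> ` U) (inv_into U \<phi>)" "continuous_on (\<psi> ` V) (inv_into V \<psi>)"
      using hU hV by (auto simp: homeomorphism_def)
    then show "continuous_on ?I ?Q"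
      by (intro continuous_on_Pair continuous_on_compose2[OF _ continuous_on_fpart]
            continuous_on_compose2[OF _ continuous_on_spart]) (use im in auto)
    have *: "?Q (?P p) = p" if "p \<in> U \<times> V" for p
      using that inv_into_chart[OF M U] inv_into_chart[OF N V] fpart_prod_chart[OF U]
      by (auto simp: spart_prod_chart)
    then show "?Q (?P p) = p" if "p \<in> U \<times> V" for p using that .
    show "?P (?Q z) = z" if "z \<in> ?I" for z using that * by force
    show "?Q ` ?I \<subseteq> U \<times> V" using * by (auto simp: image_iff)
  qed simp
qed

lemma inv_into_prod_chart:
  assumes U: "(U, \<phi>) \<in> atlas M" and V: "(V, \<psi>) \<in> atlas N" and z: "z \<in> prod_chart (cdim M) \<phi> \<psi> ` (U \<times> V)"
  shows "inv_into (U \<times> V) (prod_chart (cdim M) \<phi> \<psi>) z =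
           (inv_into U \<phi> (fpart (cdim M) z), inv_into V \<psi> (spart (cdim M) z))"
proof -
  have h: "\<And>p. p \<in> U \<times> V \<Longrightarrow> (inv_into U \<phi> (fpart (cdim M) (prod_chart (cdim M) \<phi> \<psi> p)),
      inv_into V \<psi> (spart (cdim M) (prod_chart (cdim M) \<phi> \<psi> p))) = p"
    using homeomorphism_apply1[OF prod_chart_homeomorphism[OF U V]] .
  then have inj: "inj_on (prod_chart (cdim M) \<phi> \<psi>) (U \<times> V)" 
    by (rule inj_on_inverseI[where g = "\<lambda>z. (inv_into U \<phi> (fpart (cdim M) z), inv_into V \<psi> (spart (cdim M) z))"])
  from z obtain p where p: "p \<in> U \<times> V" "z = prod_chart (cdim M) \<phi> \<psi> p" by blast
  show ?thesis unfolding p(2) h[OF p(1)] by (rule inv_into_f_f[OF inj p(1)])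
qed

text \<open>Transition maps split: each component depends on one half of the coordinates only and is
  there a component of a transition map of that factor.\<close>

lemma complex_manifold_prod: "complex_manifold (prod_manifold M N)"
  unfolding complex_manifold_def
proof (intro conjI ballI)
  have "p \<in> (\<Union>(U, \<phi>)\<in>atlas (prod_manifold M N). U)" for p
  proof -
    obtain U \<phi> where U: "(U, \<phi>) \<in> atlas M" "fst p \<in> U" using chart_at[OF M] .
    obtain V \<psi> where V: "(V, \<psi>) \<in> atlas N" "snd p \<in> V" using chart_at[OF N] .
    have "p \<in> U \<times> V" using U V by (simp add: mem_Times_iff)
    then show ?thesis by (intro UN_I[OF prod_chart_in_atlas[OF U(1) V(1)]]) simp
  qed
  then show "(\<Union>(U, \<phi>)\<in>atlas (prod_manifold M N). U) = UNIV" by blast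
next
  fix c assume "c \<in> atlas (prod_manifold M N)"
  then obtain U \<phi> V \<psi> where c: "c = (U \<times> V, prod_chart (cdim M) \<phi> \<psi>)" and U: "(U, \<phi>) \<in> atlas M"
    and V: "(V, \<psi>) \<in> atlas N" by (auto simp: atlas_prod)
  show "case c of (U, \<phi>) \<Rightarrow> open U \<and> openin (top_of_set (Cspace (cdim (prod_manifold M N)))) (\<phi> ` U) \<and>
      (\<exists>\<psi>. homeomorphism U (\<phi> ` U) \<phi> \<psi>)"
    using c open_Times[OF chart_open[OF M U] chart_open[OF N V]] openin_prod_chart_image[OF U V]
      prod_chart_homeomorphism[OF U V] by auto
  have "\<forall>i<cdim M + cdim N. holomorphic_Cspace (cdim M + cdim N)
      (\<lambda>z. prod_chart (cdim M) \<phi>' \<psi>' (inv_into (U \<times> V) (prod_chart (cdim M) \<phi> \<psi>) z) i)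
      (prod_chart (cdim M) \<phi> \<psi> ` (U \<times> V \<inter> U' \<times> V'))" (is "\<forall>i<_. holomorphic_Cspace _ (?F i) ?D")
    if U': "(U', \<phi>') \<in> atlas M" and V': "(V', \<psi>') \<in> atlas N" for U' \<phi>' V' \<psi>'
  proof (intro allI impI)
    fix i assume i: "i < cdim M + cdim N"
    have D: "?D = prod_chart (cdim M) \<phi> \<psi> ` ((U \<inter> U') \<times> (V \<inter> V'))" by (simp add: Times_Int_Times)
    have im: "fpart (cdim M) z \<in> \<phi> ` (U \<inter> U')" "spart (cdim M) z \<in> \<psi> ` (V \<inter> V')" if "z \<in> ?D" for z
      using that unfolding D prod_chart_image[OF U V Int_lower1 Int_lower1] by auto
    have inv: "inv_into (U \<times> V) (prod_chart (cdim M) \<phi> \<psi>) z =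
        (inv_into U \<phi> (fpart (cdim M) z), inv_into V \<psi> (spart (cdim M) z))" if "z \<in> ?D" for z
      using inv_into_prod_chart[OF U V] that by blast
    have oD: "openin (top_of_set (Cspace (cdim M + cdim N))) ?D"
    proof (rule openin_trans[OF _ openin_prod_chart_image[OF U V]])
      show "openin (top_of_set (prod_chart (cdim M) \<phi> \<psi> ` (U \<times> V))) ?D"
        by (rule homeomorphism_imp_open_map[OF prod_chart_homeomorphism[OF U V]])
           (use open_Times[OF chart_open[OF M U'] chart_open[OF N V']] in \<open>auto simp: openin_open\<close>)
    qed
    show "holomorphic_Cspace (cdim M + cdim N) (?F i) ?D"
    proof (cases "i < cdim M")
      case True
      have "holomorphic_Cspace (cdim M) (\<lambda>x. \<phi>' (inv_into U \<phi> x) i) (\<phi> ` (U \<inter> U'))"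
        using hol_on_coord[OF M U' True] U by (auto simp: hol_on_def o_def)
      from holomorphic_Cspace_fpart[OF this im(1)]
      have "holomorphic_Cspace (cdim M + cdim N) (\<lambda>z. \<phi>' (inv_into U \<phi> (fpart (cdim M) z)) i) ?D" .
      then show ?thesis
        by (rule holomorphic_Cspace_cong[OF oD, THEN iffD1, rotated]) (simp only: inv prod_chart_apply True if_True)
    next
      case False
      with i have i': "i - cdim M < cdim N" by simp
      have "holomorphic_Cspace (cdim N) (\<lambda>x. \<psi>' (inv_into V \<psi> x) (i - cdim M)) (\<psi> ` (V \<inter> V'))"
        using hol_on_coord[OF N V' i'] V by (auto simp: hol_on_def o_def)
      from holomorphic_Cspace_spart[OF this im(2)]
      have "holomorphic_Cspace (cdim M + cdim N) (\<lambda>z. \<psi>' (inv_into V \<psi> (spart (cdim M) z)) (i - cdim M)) ?D" .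
      then show ?thesis
        by (rule holomorphic_Cspace_cong[OF oD, THEN iffD1, rotated]) (simp only: inv prod_chart_apply False if_False)
    qed
  qed
  then show "case c of (U, \<phi>) \<Rightarrow> \<forall>(V, \<psi>)\<in>atlas (prod_manifold M N). \<forall>i<cdim (prod_manifold M N).
      holomorphic_Cspace (cdim (prod_manifold M N)) (\<lambda>x. \<psi> (inv_into U \<phi> x) i) (\<phi> ` (U \<inter> V))"
    by (auto simp: c atlas_prod)
qed

lemma hol_map_fst: "hol_map (prod_manifold M N) M fst"
  unfolding hol_map_def
proof (intro conjI allI impI)
  fix W h assume W: "open W" and h: "hol_on M h W"
  have oW: "open (fst -` W :: ('a \<times> 'b) set)" using open_vimage_fst[OF W] .
  show "hol_on (prod_manifold M N) (h \<circ> fst) (fst -` W)"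
    unfolding hol_on_def
  proof clarify
    fix C P assume ch: "(C, P) \<in> atlas (prod_manifold M N)"
    then obtain U \<phi> V \<psi> where c: "C = U \<times> V" "P = prod_chart (cdim M) \<phi> \<psi>" and U: "(U, \<phi>) \<in> atlas M"
      and V: "(V, \<psi>) \<in> atlas N" by (auto simp: atlas_prod)
    have hh: "holomorphic_Cspace (cdim M) (h \<circ> inv_into U \<phi>) (\<phi> ` (U \<inter> W))"
      using h U by (auto simp: hol_on_def)
    have "fpart (cdim M) z \<in> \<phi> ` (U \<inter> W)" if "z \<in> P ` (C \<inter> (fst -` W))" for z
      using that fpart_prod_chart[OF U] by (auto simp: c)
    from holomorphic_Cspace_fpart[OF hh this]
    have "holomorphic_Cspace (cdim (prod_manifold M N)) (\<lambda>z. (h \<circ> inv_into U \<phi>) (fpart (cdim M) z))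
        (P ` (C \<inter> (fst -` W)))" by simp
    then show "holomorphic_Cspace (cdim (prod_manifold M N)) (h \<circ> fst \<circ> inv_into C P) (P ` (C \<inter> (fst -` W)))"
    proof (rule holomorphic_Cspace_cong[OF openin_chart_image[OF complex_manifold_prod ch oW], THEN iffD1, rotated])
      fix z assume "z \<in> P ` (C \<inter> (fst -` W))"
      then have "z \<in> prod_chart (cdim M) \<phi> \<psi> ` (U \<times> V)" using c by blast
      from inv_into_prod_chart[OF U V this]
      show "(h \<circ> inv_into U \<phi>) (fpart (cdim M) z) = (h \<circ> fst \<circ> inv_into C P) z" by (simp add: c)
    qed
  qed
qed (intro continuous_intros)

lemma hol_map_snd: "hol_map (prod_manifold M N) N snd"
  unfolding hol_map_def
proof (intro conjI allI impI)
  fix W h assume W: "open W" and h: "hol_on N h W"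
  have oW: "open (snd -` W :: ('a \<times> 'b) set)" using open_vimage_snd[OF W] .
  show "hol_on (prod_manifold M N) (h \<circ> snd) (snd -` W)"
    unfolding hol_on_def
  proof clarify
    fix C P assume ch: "(C, P) \<in> atlas (prod_manifold M N)"
    then obtain U \<phi> V \<psi> where c: "C = U \<times> V" "P = prod_chart (cdim M) \<phi> \<psi>" and U: "(U, \<phi>) \<in> atlas M"
      and V: "(V, \<psi>) \<in> atlas N" by (auto simp: atlas_prod)
    have hh: "holomorphic_Cspace (cdim N) (h \<circ> inv_into V \<psi>) (\<psi> ` (V \<inter> W))"
      using h V by (auto simp: hol_on_def)
    have "spart (cdim M) z \<in> \<psi> ` (V \<inter> W)" if "z \<in> P ` (C \<inter> (snd -` W))" for z
      using that by (auto simp: c spart_prod_chart)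
    from holomorphic_Cspace_spart[OF hh this]
    have "holomorphic_Cspace (cdim (prod_manifold M N)) (\<lambda>z. (h \<circ> inv_into V \<psi>) (spart (cdim M) z))
        (P ` (C \<inter> (snd -` W)))" by simp
    then show "holomorphic_Cspace (cdim (prod_manifold M N)) (h \<circ> snd \<circ> inv_into C P) (P ` (C \<inter> (snd -` W)))"
    proof (rule holomorphic_Cspace_cong[OF openin_chart_image[OF complex_manifold_prod ch oW], THEN iffD1, rotated])
      fix z assume "z \<in> P ` (C \<inter> (snd -` W))"
      then have "z \<in> prod_chart (cdim M) \<phi> \<psi> ` (U \<times> V)" using c by blast
      from inv_into_prod_chart[OF U V this]
      show "(h \<circ> inv_into V \<psi>) (spart (cdim M) z) = (h \<circ> snd \<circ> inv_into C P) z" by (simp add: c)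
    qed
  qed
qed (intro continuous_intros)

text \<open>Locally \<open>h\<close> is a holomorphic function of the product coordinates, which
  along the map are the coordinates of \<Phi> and \<Psi>; the claim is then
  \<open>hol_on_compose_Cspace\<close>. Slices, the swap of factors and products of maps into a
  group are all obtained from it.\<close>

lemma hol_map_Pair:
  fixes K :: "('c::t2_space) cmanifold"
  assumes K: "complex_manifold K" and \<Phi>: "hol_map K M \<Phi>" and \<Psi>: "hol_map K N \<Psi>"
  shows "hol_map K (prod_manifold M N) (\<lambda>x. (\<Phi> x, \<Psi> x))"
  unfolding hol_map_def
proof (intro conjI allI impI)
  show cont: "continuous_on UNIV (\<lambda>x. (\<Phi> x, \<Psi> x))"
    using \<Phi> \<Psi> by (auto simp: hol_map_def intro: continuous_on_Pair)
  fix W h assume W: "open W" and h: "hol_on (prod_manifold M N) h W"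
  show "hol_on K (h \<circ> (\<lambda>x. (\<Phi> x, \<Psi> x))) ((\<lambda>x. (\<Phi> x, \<Psi> x)) -` W)"
  proof (rule hol_on_local[OF K])
    fix p assume p: "p \<in> (\<lambda>x. (\<Phi> x, \<Psi> x)) -` W"
    obtain U \<phi> where U: "(U, \<phi>) \<in> atlas M" "\<Phi> p \<in> U" using chart_at[OF M] .
    obtain V \<psi> where V: "(V, \<psi>) \<in> atlas N" "\<Psi> p \<in> V" using chart_at[OF N] .
    let ?P = "prod_chart (cdim M) \<phi> \<psi>" and ?k = "cdim (prod_manifold M N)"
    note ch = prod_chart_in_atlas[OF U(1) V(1)]
    define O' where "O' = (\<lambda>x. (\<Phi> x, \<Psi> x)) -` W \<inter> (\<Phi> -` U \<inter> \<Psi> -` V)"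
    have O': "open O'" "p \<in> O'"
      unfolding O'_def using p U V open_vimage[OF W cont]
        hol_map_open[OF \<Phi> chart_open[OF M U(1)]] hol_map_open[OF \<Psi> chart_open[OF N V(1)]] by auto
    have "hol_on K (\<lambda>x. (h \<circ> inv_into (U \<times> V) ?P) (\<lambda>i. if i < ?k then ?P (\<Phi> x, \<Psi> x) i else 0)) O'"
    proof (rule hol_on_compose_Cspace[OF K _ openin_chart_image[OF complex_manifold_prod ch W] O'(1)])
      show "holomorphic_Cspace ?k (h \<circ> inv_into (U \<times> V) ?P) (?P ` (U \<times> V \<inter> W))"
        using h ch by (auto simp: hol_on_def)
      show "(\<lambda>i. if i < ?k then ?P (\<Phi> x, \<Psi> x) i else 0) \<in> ?P ` (U \<times> V \<inter> W)" if "x \<in> O'" for x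
      proof -
        have x: "(\<Phi> x, \<Psi> x) \<in> U \<times> V \<inter> W" using that by (auto simp: O'_def)
        then have "(\<lambda>i. if i < ?k then ?P (\<Phi> x, \<Psi> x) i else 0) = ?P (\<Phi> x, \<Psi> x)"
          by (intro chart_vanish[OF complex_manifold_prod ch]) blast
        with x show ?thesis by simp
      qed
      fix i assume i: "i < ?k"
      show "hol_on K (\<lambda>x. ?P (\<Phi> x, \<Psi> x) i) O'"
      proof (cases "i < cdim M")
        case True
        have "hol_on K (\<lambda>x. \<phi> (\<Phi> x) i) O'"
          by (rule hol_on_subset[OF hol_map_on[OF \<Phi> chart_open[OF M U(1)] hol_on_coord[OF M U(1) True]]])
             (auto simp: O'_def)
        with True show ?thesis by (simp add: prod_chart_def)
      next
        case False
        with i have "i - cdim M < cdim N" by simp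
        then have "hol_on K (\<lambda>x. \<psi> (\<Psi> x) (i - cdim M)) O'"
          by (intro hol_on_subset[OF hol_map_on[OF \<Psi> chart_open[OF N V(1)] hol_on_coord[OF N V(1)]]])
             (auto simp: O'_def)
        with False show ?thesis by (simp add: prod_chart_def)
      qed
    qed
    then have "hol_on K (h \<circ> (\<lambda>x. (\<Phi> x, \<Psi> x))) O'"
    proof (rule hol_on_cong[OF K O'(1), rotated])
      fix x assume "x \<in> O'"
      then have x: "(\<Phi> x, \<Psi> x) \<in> U \<times> V" by (auto simp: O'_def)
      show "(h \<circ> inv_into (U \<times> V) ?P) (\<lambda>i. if i < ?k then ?P (\<Phi> x, \<Psi> x) i else 0) = (h \<circ> (\<lambda>x. (\<Phi> x, \<Psi> x))) x"
        unfolding chart_vanish[OF complex_manifold_prod ch x]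
        using inv_into_chart[OF complex_manifold_prod ch x] by simp
    qed
    with O' show "\<exists>V. open V \<and> p \<in> V \<and> hol_on K (h \<circ> (\<lambda>x. (\<Phi> x, \<Psi> x))) V" by blast
  qed
qed

lemma hol_map_slice1: "hol_map M (prod_manifold M N) (\<lambda>x. (x, y))"
  by (rule hol_map_Pair[OF M hol_map_id hol_map_const])

lemma hol_map_slice2: "hol_map N (prod_manifold M N) (\<lambda>y. (x, y))"
  by (rule hol_map_Pair[OF N hol_map_const hol_map_id])

end

section \<open>Differentiation along one factor, with holomorphic dependence on parameters\<close>

context
  fixes M :: "('a::t2_space) cmanifold" and N :: "('b::t2_space) cmanifold"
  assumes M: "complex_manifold M" and N: "complex_manifold N"
begin

lemma lift_fst_eq_push: "lift_fst M N X (t, g) = push (prod_manifold M N) (t, g) (\<lambda>t'. (t', g)) (X t)"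
  by (rule ext) (simp add: lift_fst_def push_def)

lemma lift_snd_eq_push: "lift_snd M N X (t, g) = push (prod_manifold M N) (t, g) (\<lambda>g'. (t, g')) (X g)"
  by (rule ext) (simp add: lift_snd_def push_def)

lemma tangent_vector_lift_fst:
  "tangent_vector M t (X t) \<Longrightarrow> tangent_vector (prod_manifold M N) (t, g) (lift_fst M N X (t, g))"
  unfolding lift_fst_eq_push by (rule tangent_vector_push[OF hol_map_slice1[OF M N]])

lemma tangent_vector_lift_snd:
  "tangent_vector N g (X g) \<Longrightarrow> tangent_vector (prod_manifold M N) (t, g) (lift_snd M N X (t, g))"
  unfolding lift_snd_eq_push by (rule tangent_vector_push[OF hol_map_slice2[OF M N]])

lemma hol_near_slice1: "hol_near (prod_manifold M N) (x, y) F \<Longrightarrow> hol_near M x (\<lambda>x'. F (x', y))"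
  by (rule hol_map_near[OF hol_map_slice1[OF M N]])

lemma hol_near_slice2: "hol_near (prod_manifold M N) (x, y) F \<Longrightarrow> hol_near N y (\<lambda>y'. F (x, y'))"
  by (rule hol_map_near[OF hol_map_slice2[OF M N]])

lemma hol_near_comp_fst: "hol_near M (fst p) h \<Longrightarrow> hol_near (prod_manifold M N) p (\<lambda>q. h (fst q))"
  by (rule hol_map_near[OF hol_map_fst[OF M N]])

lemma hol_near_comp_snd: "hol_near N (snd p) h \<Longrightarrow> hol_near (prod_manifold M N) p (\<lambda>q. h (snd q))"
  by (rule hol_map_near[OF hol_map_snd[OF M N]])

text \<open>Push \<open>Y\<close> into the product along the slice through \<open>x\<close> and
  expand there: the coordinates of the first factor are constant on the slice and contribute
  nothing.\<close>

lemma fibre_expansion: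
  assumes U: "(U, \<phi>) \<in> atlas M" "x \<in> U" and V: "(V, \<psi>) \<in> atlas N" "y \<in> V"
    and F: "hol_near (prod_manifold M N) (x, y) F" and Y: "tangent_vector N y Y"
  shows "Y (\<lambda>y'. F (x, y')) =
    (\<Sum>j<cdim N. Y (\<lambda>q. \<psi> q j) * cpd (U \<times> V) (prod_chart (cdim M) \<phi> \<psi>) (cdim M + j) F (x, y))"
proof -
  let ?P = "prod_chart (cdim M) \<phi> \<psi>" and ?m = "cdim M" and ?n = "cdim N"
  define v where "v = push (prod_manifold M N) (x, y) (\<lambda>y'. (x, y')) Y"
  note ch = prod_chart_in_atlas[OF U(1) V(1)]
  have xy: "(x, y) \<in> U \<times> V" using U V by simp
  have v: "tangent_vector (prod_manifold M N) (x, y) v"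
    unfolding v_def by (rule tangent_vector_push[OF hol_map_slice2[OF M N] Y])
  have near: "hol_near (prod_manifold M N) (x, y) (\<lambda>q. ?P q i)" if "i < ?m + ?n" for i
    by (rule hol_near_coord[OF complex_manifold_prod[OF M N] ch xy]) (use that in simp)
  have c1: "v (\<lambda>q. ?P q i) = 0" if "i < ?m" for i
    using near[of i] that by (simp add: v_def push_def prod_chart_apply tv_const[OF Y])
  have c2: "v (\<lambda>q. ?P q (?m + j)) = Y (\<lambda>q. \<psi> q j)" if "j < ?n" for j
    using near[of "?m + j"] that by (simp add: v_def push_def prod_chart_apply)
  have split: "(\<Sum>i<?m + k. f i) = (\<Sum>i<?m. f i) + (\<Sum>j<k. f (?m + j))" for f :: "nat \<Rightarrow> complex" and k
    by (induction k) (auto simp: add.assoc)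
  have "Y (\<lambda>y'. F (x, y')) = v F" using F by (simp add: v_def push_def)
  also have "\<dots> = (\<Sum>i<?m + ?n. v (\<lambda>q. ?P q i) * cpd (U \<times> V) ?P i F (x, y))"
    using tangent_vector_expansion[OF complex_manifold_prod[OF M N] ch xy v F] by simp
  finally show ?thesis by (simp add: split c1 c2)
qed

text \<open>Here the vector \<open>Y k\<close>, its base point and the function it differentiates
  all vary with the parameter \<open>k\<close>. By \<open>fibre_expansion\<close> the value is
  locally a finite sum of products of values of \<open>Y k\<close> on fixed coordinates with partial
  derivatives of \<open>F\<close>, each holomorphic in \<open>k\<close>.\<close>

lemma hol_on_fibre_derivative:
  fixes K :: "('c::t2_space) cmanifold"
  assumes K: "complex_manifold K" and a: "hol_map K M a" and b: "hol_map K N b" and Q: "open Q"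
    and Y: "\<And>k. k \<in> Q \<Longrightarrow> tangent_vector N (b k) (Y k)"
    and holY: "\<And>V h. open V \<Longrightarrow> hol_on N h V \<Longrightarrow> hol_on K (\<lambda>k. Y k h) (Q \<inter> b -` V)"
    and W: "open W" and F: "hol_on (prod_manifold M N) F W"
  shows "hol_on K (\<lambda>k. Y k (\<lambda>y. F (a k, y))) {k \<in> Q. (a k, b k) \<in> W}"
proof (rule hol_on_local[OF K])
  fix k assume k: "k \<in> {k \<in> Q. (a k, b k) \<in> W}"
  obtain U \<phi> where U: "(U, \<phi>) \<in> atlas M" "a k \<in> U" using chart_at[OF M] .
  obtain V \<psi> where V: "(V, \<psi>) \<in> atlas N" "b k \<in> V" using chart_at[OF N] .
  let ?P = "prod_chart (cdim M) \<phi> \<psi>"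
  let ?d = "\<lambda>j. cpd (U \<times> V) ?P (cdim M + j) F"
  note ab = hol_map_Pair[OF M N K a b]
  have oUVW: "open (U \<times> V \<inter> W)"
    using chart_open[OF M U(1)] chart_open[OF N V(1)] W by (intro open_Int open_Times)
  define R where "R = Q \<inter> (\<lambda>k. (a k, b k)) -` (U \<times> V \<inter> W)"
  have R: "open R" "k \<in> R"
    unfolding R_def using open_Int[OF Q hol_map_open[OF ab oUVW]] k U V by auto
  have "hol_on K (\<lambda>k. \<Sum>j<cdim N. Y k (\<lambda>q. \<psi> q j) * ?d j (a k, b k)) R"
  proof (intro hol_on_sum hol_on_mult)
    fix j assume "j \<in> {..<cdim N}"
    then have j: "j < cdim N" "cdim M + j < cdim (prod_manifold M N)" by auto
    show "hol_on K (\<lambda>k. Y k (\<lambda>q. \<psi> q j)) R"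
      by (rule hol_on_subset[OF holY[OF chart_open[OF N V(1)] hol_on_coord[OF N V(1) j(1)]]])
         (auto simp: R_def)
    show "hol_on K (\<lambda>k. ?d j (a k, b k)) R"
      by (rule hol_on_subset[OF hol_map_on[OF ab oUVW
            hol_on_cpd[OF complex_manifold_prod[OF M N] prod_chart_in_atlas[OF U(1) V(1)] W F j(2)]]])
         (auto simp: R_def)
  qed
  then have "hol_on K (\<lambda>k. Y k (\<lambda>y. F (a k, y))) R"
  proof (rule hol_on_cong[OF K R(1), rotated])
    fix k assume k: "k \<in> R"
    then have k': "k \<in> Q" "a k \<in> U" "b k \<in> V" "(a k, b k) \<in> W" by (auto simp: R_def)
    show "(\<Sum>j<cdim N. Y k (\<lambda>q. \<psi> q j) * ?d j (a k, b k)) = Y k (\<lambda>y. F (a k, y))"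
      by (rule fibre_expansion[OF U(1) k'(2) V(1) k'(3) hol_nearI[OF W k'(4) F] Y[OF k'(1)], symmetric])
  qed
  with R show "\<exists>V. open V \<and> k \<in> V \<and> hol_on K (\<lambda>k. Y k (\<lambda>y. F (a k, y))) V" by blast
qed

text \<open>The case where the product itself is the parameter space and the vector at the parameter
  p is \<open>X (snd p)\<close>.\<close>

lemma vector_fields_lift_snd:
  assumes X: "X \<in> vector_fields N UNIV"
  shows "lift_snd M N X \<in> vector_fields (prod_manifold M N) UNIV"
proof -
  have tv: "tangent_vector N g (X g)" for g using X by (simp add: vector_fields_def)
  have "hol_on (prod_manifold M N) (\<lambda>p. lift_snd M N X p F) W"
    if W: "open W" and F: "hol_on (prod_manifold M N) F W" for W F
  proof (rule hol_on_cong[OF complex_manifold_prod[OF M N] W])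
    have "hol_on (prod_manifold M N) (\<lambda>p. X (snd p) (\<lambda>y. F (fst p, y))) {p \<in> UNIV. (fst p, snd p) \<in> W}"
    proof (rule hol_on_fibre_derivative[OF complex_manifold_prod[OF M N] hol_map_fst[OF M N] hol_map_snd[OF M N] open_UNIV tv _ W F])
      fix V h assume V: "open V" and h: "hol_on N h V"
      then have "hol_on N (\<lambda>g. X g h) V" using X by (simp add: vector_fields_def)
      from hol_map_on[OF hol_map_snd[OF M N] V this]
      show "hol_on (prod_manifold M N) (\<lambda>p. X (snd p) h) (UNIV \<inter> snd -` V)" by simp
    qed
    then show "hol_on (prod_manifold M N) (\<lambda>p. X (snd p) (\<lambda>y. F (fst p, y))) W" by simp
    show "X (snd p) (\<lambda>y. F (fst p, y)) = lift_snd M N X p F" if "p \<in> W" for p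
      using hol_nearI[OF W that F] by (cases p) (simp add: lift_snd_def)
  qed
  then show ?thesis
    unfolding vector_fields_def using tangent_vector_lift_snd tv by auto
qed

lemma hol_on_partial_snd:
  assumes Y: "tangent_vector N q Y" and W: "open W" and F: "hol_on (prod_manifold M N) F W"
  shows "hol_on M (\<lambda>x. Y (\<lambda>y. F (x, y))) {x. (x, q) \<in> W}"
proof -
  have "hol_on M (\<lambda>x. Y (\<lambda>y. F (x, y))) {x \<in> UNIV. (x, q) \<in> W}"
    by (rule hol_on_fibre_derivative[OF M hol_map_id hol_map_const open_UNIV Y _ W F]) (rule hol_on_const)
  then show ?thesis by simp
qed

end

lemma hol_map_swap:
  fixes M :: "('a::t2_space) cmanifold" and N :: "('b::t2_space) cmanifold"
  assumes M: "complex_manifold M" and N: "complex_manifold N"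
  shows "hol_map (prod_manifold N M) (prod_manifold M N) (\<lambda>p. (snd p, fst p))"
  by (rule hol_map_Pair[OF M N complex_manifold_prod[OF N M] hol_map_snd[OF N M] hol_map_fst[OF N M]])

context
  fixes M :: "('a::t2_space) cmanifold" and N :: "('b::t2_space) cmanifold"
  assumes M: "complex_manifold M" and N: "complex_manifold N"
begin

text \<open>Carries the results about the second factor over to the first.\<close>

lemma hol_on_swap:
  assumes "open W" "hol_on (prod_manifold M N) F W"
  shows "hol_on (prod_manifold N M) (\<lambda>p. F (snd p, fst p)) {p. (snd p, fst p) \<in> W}"
    "open {p :: 'b \<times> 'a. (snd p, fst p) \<in> W}"
  using hol_map_on[OF hol_map_swap[OF M N] assms] hol_map_open[OF hol_map_swap[OF M N] assms(1)]
  by (simp_all add: vimage_def)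

lemma hol_on_partial_fst:
  assumes X: "tangent_vector M p X" and W: "open W" and F: "hol_on (prod_manifold M N) F W"
  shows "hol_on N (\<lambda>y. X (\<lambda>x. F (x, y))) {y. (p, y) \<in> W}"
  using hol_on_partial_snd[OF N M X hol_on_swap(2,1)[OF W F]] by simp

lemma vector_fields_lift_fst:
  assumes X: "X \<in> vector_fields M UNIV"
  shows "lift_fst M N X \<in> vector_fields (prod_manifold M N) UNIV"
proof -
  have tv: "tangent_vector M g (X g)" for g using X by (simp add: vector_fields_def)
  have "hol_on (prod_manifold M N) (\<lambda>p. lift_fst M N X p F) W"
    if W: "open W" and F: "hol_on (prod_manifold M N) F W" for W F
  proof (rule hol_on_cong[OF complex_manifold_prod[OF M N] W])
    let ?F = "\<lambda>p. F (snd p, fst p)" and ?W = "{p. (snd p, fst p) \<in> W}"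
    note sw = hol_on_swap[OF W F]
    have "hol_on (prod_manifold N M) (\<lambda>p. lift_snd N M X p ?F) ?W"
      using vector_fields_lift_snd[OF N M X] sw by (simp add: vector_fields_def)
    from hol_map_on[OF hol_map_swap[OF N M] sw(2) this]
    show "hol_on (prod_manifold M N) (\<lambda>p. lift_snd N M X (snd p, fst p) ?F) W" by (simp add: vimage_def)
    show "lift_snd N M X (snd p, fst p) ?F = lift_fst M N X p F" if "p \<in> W" for p
    proof -
      have "hol_near (prod_manifold N M) (snd p, fst p) ?F"
        by (rule hol_nearI[OF sw(2) _ sw(1)]) (use that in simp)
      then show ?thesis
        using hol_nearI[OF W that F] by (cases p) (simp add: lift_snd_def lift_fst_def)
    qed
  qed
  then show ?thesis
    unfolding vector_fields_def using tangent_vector_lift_fst[OF M N] tv by auto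
qed

text \<open>The commutator of the two partial differentiations is a derivation that kills all
  coordinates.\<close>

lemma partial_derivatives_commute:
  assumes X: "tangent_vector M p X" and Y: "tangent_vector N q Y"
    and F: "hol_near (prod_manifold M N) (p, q) F"
  shows "X (\<lambda>x. Y (\<lambda>y. F (x, y))) = Y (\<lambda>y. X (\<lambda>x. F (x, y)))"
proof -
  define C where "C F = (if hol_near (prod_manifold M N) (p, q) F
      then X (\<lambda>x. Y (\<lambda>y. F (x, y))) - Y (\<lambda>y. X (\<lambda>x. F (x, y))) else 0)" for F
  let ?near = "hol_near (prod_manifold M N) (p, q)"
  note MN = complex_manifold_prod[OF M N]
  note s1 = hol_near_slice1[OF M N] and s2 = hol_near_slice2[OF M N]
  have op: "open {x. (x, q) \<in> W}" "open {y. (p, y) \<in> W}" if "open W" for W :: "('a \<times> 'b) set"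
    using hol_map_open[OF hol_map_slice1[OF M N] that, of q] hol_map_open[OF hol_map_slice2[OF M N] that, of p]
    by (simp_all add: vimage_def)
  have dx: "hol_near M p (\<lambda>x. Y (\<lambda>y. F (x, y)))" and dy: "hol_near N q (\<lambda>y. X (\<lambda>x. F (x, y)))"
    if F: "?near F" for F
  proof -
    obtain W where W: "open W" "(p, q) \<in> W" "hol_on (prod_manifold M N) F W"
      using F by (auto simp: hol_near_def)
    show "hol_near M p (\<lambda>x. Y (\<lambda>y. F (x, y)))"
      by (rule hol_nearI[OF op(1)[OF W(1)] _ hol_on_partial_snd[OF M N Y W(1,3)]]) (use W in simp)
    show "hol_near N q (\<lambda>y. X (\<lambda>x. F (x, y)))"
      by (rule hol_nearI[OF op(2)[OF W(1)] _ hol_on_partial_fst[OF X W(1,3)]]) (use W in simp)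
  qed
  have evx: "\<forall>\<^sub>F x in nhds p. Q (x, q)" and evy: "\<forall>\<^sub>F y in nhds q. Q (p, y)"
    if "open W" "(p, q) \<in> W" "\<And>z. z \<in> W \<Longrightarrow> Q z" for W Q
  proof -
    show "\<forall>\<^sub>F x in nhds p. Q (x, q)"
      using eventually_nhds_in_open[OF op(1)[OF that(1)], of p] that by (auto elim!: eventually_mono)
    show "\<forall>\<^sub>F y in nhds q. Q (p, y)"
      using eventually_nhds_in_open[OF op(2)[OF that(1)], of q] that by (auto elim!: eventually_mono)
  qed
  have nx: "\<forall>\<^sub>F x in nhds p. hol_near (prod_manifold M N) (x, q) F"
    and ny: "\<forall>\<^sub>F y in nhds q. hol_near (prod_manifold M N) (p, y) F" if F: "?near F" for F
  proof -
    obtain W where W: "open W" "(p, q) \<in> W" "hol_on (prod_manifold M N) F W"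
      using F by (auto simp: hol_near_def)
    have "hol_near (prod_manifold M N) z F" if "z \<in> W" for z using W that by (auto intro: hol_nearI)
    from evx[OF W(1,2) this] evy[OF W(1,2) this]
    show "\<forall>\<^sub>F x in nhds p. hol_near (prod_manifold M N) (x, q) F"
      "\<forall>\<^sub>F y in nhds q. hol_near (prod_manifold M N) (p, y) F" by auto
  qed
  have tvC: "tangent_vector (prod_manifold M N) (p, q) C"
  proof (rule tangent_vectorI)
    fix F G assume F: "?near F" and G: "?near G"
    have "X (\<lambda>x. Y (\<lambda>y. F (x, y) + G (x, y))) = X (\<lambda>x. Y (\<lambda>y. F (x, y)) + Y (\<lambda>y. G (x, y)))"
      by (rule tv_cong[OF X dx[OF hol_near_add[OF F G]] hol_near_add[OF dx[OF F] dx[OF G]]])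
         (rule eventually_mono[OF eventually_conj[OF nx[OF F] nx[OF G]]], rule tv_add[OF Y s2 s2], auto)
    moreover have "Y (\<lambda>y. X (\<lambda>x. F (x, y) + G (x, y))) = Y (\<lambda>y. X (\<lambda>x. F (x, y)) + X (\<lambda>x. G (x, y)))"
      by (rule tv_cong[OF Y dy[OF hol_near_add[OF F G]] hol_near_add[OF dy[OF F] dy[OF G]]])
         (rule eventually_mono[OF eventually_conj[OF ny[OF F] ny[OF G]]], rule tv_add[OF X s1 s1], auto)
    ultimately show "C (\<lambda>z. F z + G z) = C F + C G"
      by (simp add: C_def F G hol_near_add tv_add[OF X dx[OF F] dx[OF G]] tv_add[OF Y dy[OF F] dy[OF G]])
  next
    fix F G assume F: "?near F" and G: "?near G"
    have "X (\<lambda>x. Y (\<lambda>y. F (x, y) * G (x, y))) = X (\<lambda>x. F (x, q) * Y (\<lambda>y. G (x, y)) + G (x, q) * Y (\<lambda>y. F (x, y)))"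
      by (rule tv_cong[OF X dx[OF hol_near_mult[OF F G]] hol_near_add[OF hol_near_mult[OF s1[OF F] dx[OF G]]
              hol_near_mult[OF s1[OF G] dx[OF F]]]])
         (rule eventually_mono[OF eventually_conj[OF nx[OF F] nx[OF G]]], rule tv_mult[OF Y s2 s2], auto)
    also have "\<dots> = X (\<lambda>x. F (x, q) * Y (\<lambda>y. G (x, y))) + X (\<lambda>x. G (x, q) * Y (\<lambda>y. F (x, y)))"
      by (rule tv_add[OF X hol_near_mult[OF s1[OF F] dx[OF G]] hol_near_mult[OF s1[OF G] dx[OF F]]])
    finally have 1: "X (\<lambda>x. Y (\<lambda>y. F (x, y) * G (x, y))) =
        F (p, q) * X (\<lambda>x. Y (\<lambda>y. G (x, y))) + Y (\<lambda>y. G (p, y)) * X (\<lambda>x. F (x, q)) +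
        (G (p, q) * X (\<lambda>x. Y (\<lambda>y. F (x, y))) + Y (\<lambda>y. F (p, y)) * X (\<lambda>x. G (x, q)))"
      unfolding tv_mult[OF X s1[OF F] dx[OF G]] tv_mult[OF X s1[OF G] dx[OF F]] .
    have "Y (\<lambda>y. X (\<lambda>x. F (x, y) * G (x, y))) = Y (\<lambda>y. F (p, y) * X (\<lambda>x. G (x, y)) + G (p, y) * X (\<lambda>x. F (x, y)))"
      by (rule tv_cong[OF Y dy[OF hol_near_mult[OF F G]] hol_near_add[OF hol_near_mult[OF s2[OF F] dy[OF G]]
              hol_near_mult[OF s2[OF G] dy[OF F]]]])
         (rule eventually_mono[OF eventually_conj[OF ny[OF F] ny[OF G]]], rule tv_mult[OF X s1 s1], auto)
    also have "\<dots> = Y (\<lambda>y. F (p, y) * X (\<lambda>x. G (x, y))) + Y (\<lambda>y. G (p, y) * X (\<lambda>x. F (x, y)))"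
      by (rule tv_add[OF Y hol_near_mult[OF s2[OF F] dy[OF G]] hol_near_mult[OF s2[OF G] dy[OF F]]])
    finally have 2: "Y (\<lambda>y. X (\<lambda>x. F (x, y) * G (x, y))) =
        F (p, q) * Y (\<lambda>y. X (\<lambda>x. G (x, y))) + X (\<lambda>x. G (x, q)) * Y (\<lambda>y. F (p, y)) +
        (G (p, q) * Y (\<lambda>y. X (\<lambda>x. F (x, y))) + X (\<lambda>x. F (x, q)) * Y (\<lambda>y. G (p, y)))"
      unfolding tv_mult[OF Y s2[OF F] dy[OF G]] tv_mult[OF Y s2[OF G] dy[OF F]] .
    \<comment> \<open>The mixed products of first derivatives of \<open>F\<close> and
      \<open>G\<close> are the same in both orders and cancel in the difference.\<close>
    show "C (\<lambda>z. F z * G z) = F (p, q) * C G + G (p, q) * C F"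
      by (simp add: C_def F G hol_near_mult 1 2 algebra_simps)
  next
    fix c F assume F: "?near F"
    have "X (\<lambda>x. Y (\<lambda>y. c * F (x, y))) = X (\<lambda>x. c * Y (\<lambda>y. F (x, y)))"
      by (rule tv_cong[OF X dx[OF hol_near_mult[OF hol_near_const F]] hol_near_mult[OF hol_near_const dx[OF F]]])
         (rule eventually_mono[OF nx[OF F]], rule tv_cmult[OF Y s2])
    moreover have "Y (\<lambda>y. X (\<lambda>x. c * F (x, y))) = Y (\<lambda>y. c * X (\<lambda>x. F (x, y)))"
      by (rule tv_cong[OF Y dy[OF hol_near_mult[OF hol_near_const F]] hol_near_mult[OF hol_near_const dy[OF F]]])
         (rule eventually_mono[OF ny[OF F]], rule tv_cmult[OF X s1])
    ultimately show "C (\<lambda>z. c * F z) = c * C F"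
      by (simp add: C_def F hol_near_mult hol_near_const tv_cmult[OF X dx[OF F]] tv_cmult[OF Y dy[OF F]]
            right_diff_distrib)
  next
    fix F G assume F: "?near F" and G: "?near G" and "\<forall>\<^sub>F z in nhds (p, q). F z = G z"
    then obtain W where W: "open W" "(p, q) \<in> W" "\<And>z. z \<in> W \<Longrightarrow> F z = G z" by (auto simp: eventually_nhds)
    \<comment> \<open>Equality of germs at (p, q) has to be passed to the slices through all nearby
      points, since the inner derivative is taken there before the outer one acts.\<close>
    have 1: "\<forall>\<^sub>F y in nhds (snd z). F (fst z, y) = G (fst z, y)" "\<forall>\<^sub>F x in nhds (fst z). F (x, snd z) = G (x, snd z)"
      if "z \<in> W" for z
      using eventually_nhds_in_open[OF hol_map_open[OF hol_map_slice2[OF M N] W(1)], of "snd z" "fst z"]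
        eventually_nhds_in_open[OF hol_map_open[OF hol_map_slice1[OF M N] W(1)], of "fst z" "snd z"] that W(3)
      by (auto elim!: eventually_mono)
    have 2: "\<forall>\<^sub>F x in nhds p. \<forall>\<^sub>F y in nhds q. F (x, y) = G (x, y)"
      using evx[OF W(1,2), of "\<lambda>z. \<forall>\<^sub>F y in nhds (snd z). F (fst z, y) = G (fst z, y)"] 1(1) by simp
    have 3: "\<forall>\<^sub>F y in nhds q. \<forall>\<^sub>F x in nhds p. F (x, y) = G (x, y)"
      using evy[OF W(1,2), of "\<lambda>z. \<forall>\<^sub>F x in nhds (fst z). F (x, snd z) = G (x, snd z)"] 1(2) by simp
    have "X (\<lambda>x. Y (\<lambda>y. F (x, y))) = X (\<lambda>x. Y (\<lambda>y. G (x, y)))"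
    proof (rule tv_cong[OF X dx[OF F] dx[OF G]])
      show "\<forall>\<^sub>F x in nhds p. Y (\<lambda>y. F (x, y)) = Y (\<lambda>y. G (x, y))"
        using nx[OF F] nx[OF G] 2
        by eventually_elim (rule tv_cong[OF Y s2 s2], simp_all)
    qed
    moreover have "Y (\<lambda>y. X (\<lambda>x. F (x, y))) = Y (\<lambda>y. X (\<lambda>x. G (x, y)))"
    proof (rule tv_cong[OF Y dy[OF F] dy[OF G]])
      show "\<forall>\<^sub>F y in nhds q. X (\<lambda>x. F (x, y)) = X (\<lambda>x. G (x, y))"
        using ny[OF F] ny[OF G] 3
        by eventually_elim (rule tv_cong[OF X s1 s1], simp_all)
    qed
    ultimately show "C F = C G" by (simp add: C_def F G)
  qed (simp add: C_def)
  obtain U \<phi> where U: "(U, \<phi>) \<in> atlas M" "p \<in> U" using chart_at[OF M] .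
  obtain V \<psi> where V: "(V, \<psi>) \<in> atlas N" "q \<in> V" using chart_at[OF N] .
  \<comment> \<open>A coordinate depends on one variable only, so in either order some
    differentiation meets a constant.\<close>
  have "C (\<lambda>z. prod_chart (cdim M) \<phi> \<psi> z i) = 0" for i
    by (cases "i < cdim M") (simp_all add: C_def prod_chart_apply tv_const[OF X] tv_const[OF Y])
  then have "C F = 0"
    using tangent_vector_expansion[OF MN prod_chart_in_atlas[OF U(1) V(1)] _ tvC F] U V by simp
  then show ?thesis using F by (simp add: C_def)
qed

end

lemma vector_fields_tangent: "X \<in> vector_fields M W \<Longrightarrow> p \<in> W \<Longrightarrow> tangent_vector M p (X p)"
  by (simp add: vector_fields_def)

lemma vector_fields_hol_near:
  assumes X: "X \<in> vector_fields M W" and W: "open W" "p \<in> W" and f: "hol_near M p f"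
  shows "hol_near M p (\<lambda>q. X q f)"
proof -
  obtain V where V: "open V" "p \<in> V" "hol_on M f V" using f by (auto simp: hol_near_def)
  have "hol_on M (\<lambda>q. X q f) (V \<inter> W)"
    using X hol_on_subset[OF V(3) Int_lower1] V(1) W(1) unfolding vector_fields_def by blast
  then show ?thesis by (rule hol_nearI[rotated -1]) (use V W in auto)
qed

lemma vector_fields_sum:
  assumes X: "\<And>i. i \<in> I \<Longrightarrow> X i \<in> vector_fields M UNIV" and c: "\<And>i. i \<in> I \<Longrightarrow> hol_on M (c i) W"
    and 0: "\<And>i p. i \<in> I \<Longrightarrow> p \<notin> W \<Longrightarrow> c i p = 0"
  shows "(\<lambda>p f. \<Sum>i\<in>I. c i p * X i p f) \<in> vector_fields M W"
  unfolding vector_fields_def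
proof (intro CollectI conjI ballI allI impI)
  fix p assume "p \<in> W"
  show "tangent_vector M p (\<lambda>f. \<Sum>i\<in>I. c i p * X i p f)"
    by (rule tangent_vector_sum) (rule vector_fields_tangent[OF X], auto)
next
  fix p assume "p \<notin> W"
  then show "(\<lambda>f. \<Sum>i\<in>I. c i p * X i p f) = 0" using 0 by (auto simp: fun_eq_iff)
next
  fix V f assume V: "open V" "V \<subseteq> W" "hol_on M f V"
  then show "hol_on M (\<lambda>p. \<Sum>i\<in>I. c i p * X i p f) V"
    using X by (intro hol_on_sum hol_on_mult hol_on_subset[OF c V(2)]) (auto simp: vector_fields_def)
qed

lemma eventually_hol_near:
  assumes "hol_near M p f" shows "\<forall>\<^sub>F q in nhds p. hol_near M q f"
  using assms unfolding hol_near_def eventually_nhds by blast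

section \<open>Invariant vector fields on complex Lie groups\<close>

text \<open>The differential of left translation by \<open>g\<close> applied to \<open>v\<close>. It
  does without the guard of \<open>push\<close> because left translation is biholomorphic: for
  \<open>v\<close> tangent at the identity, the function under \<open>v\<close> has a holomorphic
  germ exactly when \<open>f\<close> has one at \<open>g\<close>.\<close>

definition translate_vector :: "'g monoid \<Rightarrow> (('g \<Rightarrow> complex) \<Rightarrow> complex) \<Rightarrow> 'g vfield" where
  "translate_vector G v = (\<lambda>g f. v (\<lambda>h. f (g \<otimes>\<^bsub>G\<^esub> h)))"

context
  fixes N :: "('g::t2_space) cmanifold" and G :: "'g monoid" (structure)
  assumes LG: "complex_lie_group N G"
begin

lemma Lie_manifold: "complex_manifold N"
  using LG by (simp add: complex_lie_group_def)

lemma Lie_mult [simp]: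
  "x \<otimes> y \<otimes> z = x \<otimes> (y \<otimes> z)" "\<one> \<otimes> x = x" "x \<otimes> \<one> = x" "inv x \<otimes> x = \<one>" "x \<otimes> inv x = \<one>"
  "inv x \<otimes> (x \<otimes> y) = y" "x \<otimes> (inv x \<otimes> y) = y"
proof -
  interpret group G using LG by (simp add: complex_lie_group_def)
  have c: "x \<in> carrier G" for x using LG by (simp add: complex_lie_group_def)
  show "x \<otimes> y \<otimes> z = x \<otimes> (y \<otimes> z)" "\<one> \<otimes> x = x" "x \<otimes> \<one> = x" "inv x \<otimes> x = \<one>" "x \<otimes> inv x = \<one>"
    using c by (simp_all add: m_assoc)
  show "inv x \<otimes> (x \<otimes> y) = y" "x \<otimes> (inv x \<otimes> y) = y"
    using c by (simp_all flip: m_assoc)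
qed

lemma hol_map_mult:
  fixes K :: "('k::t2_space) cmanifold"
  assumes K: "complex_manifold K" and a: "hol_map K N a" and b: "hol_map K N b"
  shows "hol_map K N (\<lambda>x. a x \<otimes> b x)"
proof -
  have "hol_map (prod_manifold N N) N (\<lambda>(x, y). x \<otimes> y)" using LG by (simp add: complex_lie_group_def)
  from hol_map_compose[OF hol_map_Pair[OF Lie_manifold Lie_manifold K a b] this] show ?thesis by simp
qed

lemma hol_map_inv: "hol_map N N (\<lambda>x. inv x)"
  using LG by (simp add: complex_lie_group_def)

lemma hol_map_left_translation: "hol_map N N (\<lambda>x. g \<otimes> x)"
  by (rule hol_map_mult[OF Lie_manifold hol_map_const hol_map_id])

lemma hol_map_right_translation: "hol_map N N (\<lambda>x. x \<otimes> g)"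
  by (rule hol_map_mult[OF Lie_manifold hol_map_id hol_map_const])

lemma hol_map_prod_mult:
  "hol_map (prod_manifold N N) N (\<lambda>p. fst p \<otimes> snd p)"
  by (rule hol_map_mult[OF complex_manifold_prod hol_map_fst hol_map_snd]) (rule Lie_manifold)+

lemma hol_near_left_translation: "hol_near N \<one> (\<lambda>h. f (g \<otimes> h)) \<longleftrightarrow> hol_near N g f"
proof
  assume "hol_near N \<one> (\<lambda>h. f (g \<otimes> h))"
  then have "hol_near N (inv g \<otimes> g) (\<lambda>h. f (g \<otimes> h))" by simp
  from hol_map_near[OF hol_map_left_translation this] show "hol_near N g f" by simp
next
  assume "hol_near N g f"
  then have "hol_near N (g \<otimes> \<one>) f" by simp
  from hol_map_near[OF hol_map_left_translation this] show "hol_near N \<one> (\<lambda>h. f (g \<otimes> h))" .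
qed

lemma translate_vector_eq_push:
  assumes "tangent_vector N \<one> v"
  shows "translate_vector G v g = push N g (\<lambda>h. g \<otimes> h) v"
  using tv_not_hol_near[OF assms] by (auto simp: translate_vector_def push_def hol_near_left_translation)

lemma tangent_vector_translate:
  assumes "tangent_vector N \<one> v" shows "tangent_vector N g (translate_vector G v g)"
  using tangent_vector_push[OF hol_map_left_translation[of g] assms]
  by (simp add: translate_vector_eq_push[OF assms])

text \<open>Invariance is associativity. For holomorphy, g -> v (f (g h)) is a partial derivative,
  in the second variable at the identity, of \<open>f\<close> composed with multiplication on
  \<open>N\<close> times \<open>N\<close>.\<close>

lemma translate_vector_left_invariant:
  assumes v: "tangent_vector N \<one> v"
  shows "translate_vector G v \<in> left_invariant_fields N G"
proof -
  have "hol_on N (\<lambda>g. v (\<lambda>h. f (g \<otimes> h))) V" if V: "open V" and f: "hol_on N f V" for V f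
  proof -
    have "open ((\<lambda>p. fst p \<otimes> snd p) -` V)" "hol_on (prod_manifold N N) (\<lambda>p. f (fst p \<otimes> snd p)) ((\<lambda>p. fst p \<otimes> snd p) -` V)"
      using hol_map_open[OF hol_map_prod_mult V] hol_map_on[OF hol_map_prod_mult V f] .
    from hol_on_partial_snd[OF Lie_manifold Lie_manifold v this] show ?thesis by simp
  qed
  then show ?thesis
    using tangent_vector_translate[OF v]
    by (auto simp: left_invariant_fields_def vector_fields_def translate_vector_def)
qed

lemma left_invariant_field_eq_translate:
  assumes X: "X \<in> left_invariant_fields N G"
  shows "X = translate_vector G (X \<one>)"
proof (intro ext)
  fix g f
  have tv: "tangent_vector N g (X g)" for g using X by (auto simp: left_invariant_fields_def vector_fields_def)
  have inv: "hol_near N (h \<otimes> g) f \<Longrightarrow> X g (\<lambda>x. f (h \<otimes> x)) = X (h \<otimes> g) f" for h g f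
    using X by (simp add: left_invariant_fields_def)
  show "X g f = translate_vector G (X \<one>) g f"
  proof (cases "hol_near N g f")
    case True
    with inv[of g \<one> f] show ?thesis by (simp add: translate_vector_def)
  next
    case False
    then show ?thesis
      using tv_not_hol_near[OF tv] by (simp add: translate_vector_def hol_near_left_translation)
  qed
qed

text \<open>By invariance both sides become derivatives at the identity of f (k g h):
  \<open>X\<close> differentiates in h and \<open>Y\<close> in k, and
  \<open>partial_derivatives_commute\<close> exchanges them.\<close>

lemma left_right_invariant_commute:
  assumes X: "X \<in> left_invariant_fields N G" and Y: "Y \<in> right_invariant_fields N G" and f: "hol_near N g f"
  shows "X g (\<lambda>x. Y x f) = Y g (\<lambda>x. X x f)"
proof -
  have vX: "X \<in> vector_fields N UNIV" and vY: "Y \<in> vector_fields N UNIV"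
    using X Y by (auto simp: left_invariant_fields_def right_invariant_fields_def)
  note tX = vector_fields_tangent[OF vX UNIV_I] and tY = vector_fields_tangent[OF vY UNIV_I]
  have hX: "hol_near N g (\<lambda>x. X x f)" and hY: "hol_near N g (\<lambda>x. Y x f)"
    using vector_fields_hol_near[OF vX _ _ f] vector_fields_hol_near[OF vY _ _ f] by auto
  have lX: "X h (\<lambda>x. u (k \<otimes> x)) = X (k \<otimes> h) u" if "hol_near N (k \<otimes> h) u" for u k h
    using X that by (simp add: left_invariant_fields_def)
  have rY: "Y h (\<lambda>x. u (x \<otimes> k)) = Y (h \<otimes> k) u" if "hol_near N (h \<otimes> k) u" for u k h
    using Y that by (simp add: right_invariant_fields_def)
  note LT = hol_map_left_translation[of g] and RT = hol_map_right_translation[of g]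
  have "X g (\<lambda>x. Y x f) = X \<one> (\<lambda>h. Y (g \<otimes> h) f)"
    using lX[of g \<one> "\<lambda>x. Y x f"] hY by simp
  also have "\<dots> = X \<one> (\<lambda>h. Y \<one> (\<lambda>k. f (k \<otimes> (g \<otimes> h))))"
  proof (rule tv_cong[OF tX, symmetric])
    show h: "hol_near N \<one> (\<lambda>h. Y (g \<otimes> h) f)"
      using hol_map_near[OF LT, of \<one> "\<lambda>x. Y x f"] hY by simp
    \<comment> \<open>Right invariance can be used at \<open>g \<otimes> h\<close> only where
      \<open>f\<close> is holomorphic, that is for h near the identity; translating back by
      \<open>inv g\<close> provides this.\<close>
    have ev: "\<forall>\<^sub>F h in nhds \<one>. hol_near N (g \<otimes> h) f"
      using eventually_hol_near[OF hol_near_left_translation[THEN iffD2, OF f]]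
    proof (rule eventually_mono)
      fix h assume "hol_near N h (\<lambda>h. f (g \<otimes> h))"
      then have "hol_near N (inv g \<otimes> (g \<otimes> h)) (\<lambda>h. f (g \<otimes> h))" by simp
      from hol_map_near[OF hol_map_left_translation this] show "hol_near N (g \<otimes> h) f" by simp
    qed
    then show ev': "\<forall>\<^sub>F h in nhds \<one>. Y \<one> (\<lambda>k. f (k \<otimes> (g \<otimes> h))) = Y (g \<otimes> h) f"
      by (rule eventually_mono) (use rY[of \<one>] in simp)
    show "hol_near N \<one> (\<lambda>h. Y \<one> (\<lambda>k. f (k \<otimes> (g \<otimes> h))))"
      by (rule hol_near_cong[OF Lie_manifold _ h]) (use ev' in \<open>simp add: eq_commute\<close>)
  qed
  also have "\<dots> = Y \<one> (\<lambda>k. X \<one> (\<lambda>h. f (k \<otimes> (g \<otimes> h))))"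
  proof -
    \<comment> \<open>The first variable is h, on which \<open>X\<close> acts; the second is k, on
      which \<open>Y\<close> acts.\<close>
    have "hol_near (prod_manifold N N) (\<one>, \<one>) (\<lambda>p. f (snd p \<otimes> (g \<otimes> fst p)))"
      by (rule hol_map_near[where \<Phi> = "\<lambda>p. snd p \<otimes> (g \<otimes> fst p)" and h = f])
         (use f Lie_manifold in \<open>auto intro!: hol_map_mult complex_manifold_prod hol_map_fst hol_map_snd hol_map_const\<close>)
    from partial_derivatives_commute[OF Lie_manifold Lie_manifold tX tY this] show ?thesis by simp
  qed
  also have "\<dots> = Y \<one> (\<lambda>k. X (k \<otimes> g) f)"
  proof (rule tv_cong[OF tY])
    show h: "hol_near N \<one> (\<lambda>k. X (k \<otimes> g) f)"
      using hol_map_near[OF RT, of \<one> "\<lambda>x. X x f"] hX by simp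
    have "hol_near N \<one> (\<lambda>k. f (k \<otimes> g))" using hol_map_near[OF RT, of \<one> f] f by simp
    from eventually_hol_near[OF this] have ev: "\<forall>\<^sub>F k in nhds \<one>. hol_near N (k \<otimes> g) f"
    proof (rule eventually_mono)
      fix h assume "hol_near N h (\<lambda>h. f (h \<otimes> g))"
      then have "hol_near N (h \<otimes> g \<otimes> inv g) (\<lambda>h. f (h \<otimes> g))" by simp
      from hol_map_near[OF hol_map_right_translation this[folded Lie_mult(1)]] show "hol_near N (h \<otimes> g) f" by simp
    qed
    then show ev': "\<forall>\<^sub>F k in nhds \<one>. X \<one> (\<lambda>h. f (k \<otimes> (g \<otimes> h))) = X (k \<otimes> g) f"
    proof (rule eventually_mono)
      fix k assume "hol_near N (k \<otimes> g) f"
      then show "X \<one> (\<lambda>h. f (k \<otimes> (g \<otimes> h))) = X (k \<otimes> g) f"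
        using lX[where h = \<one> and k = "k \<otimes> g" and u = f] by simp
    qed
    show "hol_near N \<one> (\<lambda>k. X \<one> (\<lambda>h. f (k \<otimes> (g \<otimes> h))))"
      by (rule hol_near_cong[OF Lie_manifold _ h]) (use ev' in \<open>simp add: eq_commute\<close>)
  qed
  also have "\<dots> = Y g (\<lambda>x. X x f)" using rY[of \<one> g "\<lambda>x. X x f"] hX by simp
  finally show ?thesis .
qed

section \<open>The left invariant frame and its dual coordinates\<close>

context
  fixes U :: "'g set" and \<phi> :: "'g \<Rightarrow> nat \<Rightarrow> complex"
  assumes ch: "(U, \<phi>) \<in> atlas N" and oneU: "\<one> \<in> U"
begin

definition left_frame :: "nat \<Rightarrow> 'g vfield" where
  "left_frame i = translate_vector G (cvec N U \<phi> i \<one>)"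

lemma left_frame_invariant: "i < cdim N \<Longrightarrow> left_frame i \<in> left_invariant_fields N G"
  unfolding left_frame_def
  by (intro translate_vector_left_invariant tangent_vector_cvec[OF Lie_manifold ch oneU])

text \<open>These translates of the coordinates at the identity are coordinates near
  \<open>g\<close>, dual there to the frame; evaluating a vector on them gives its frame
  coefficients.\<close>

lemma hol_near_translated_coord:
  "i < cdim N \<Longrightarrow> hol_near N g (\<lambda>k. \<phi> (inv g \<otimes> k) i)"
  using hol_map_near[OF hol_map_left_translation, of "inv g" g "\<lambda>k. \<phi> k i"]
    hol_near_coord[OF Lie_manifold ch oneU] by simp

lemma left_frame_coord:
  "i < cdim N \<Longrightarrow> j < cdim N \<Longrightarrow> left_frame i g (\<lambda>k. \<phi> (inv g \<otimes> k) j) = (if i = j then 1 else 0)"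
  by (simp add: left_frame_def translate_vector_def cvec_coord[OF Lie_manifold ch oneU])

text \<open>A left invariant field is the translate of its value at the identity, so the
  coefficients found there are valid everywhere. This is the finite dimensionality of the Lie
  algebra.\<close>

lemma left_invariant_expansion:
  assumes "X \<in> left_invariant_fields N G"
  shows "X = (\<lambda>g f. \<Sum>i<cdim N. X \<one> (\<lambda>q. \<phi> q i) * left_frame i g f)"
proof -
  have "tangent_vector N \<one> (X \<one>)" using assms by (auto simp: left_invariant_fields_def vector_fields_def)
  note b = tangent_vector_basis[OF Lie_manifold ch oneU this]
  show ?thesis
    by (subst left_invariant_field_eq_translate[OF assms], subst (1) b)
       (simp add: left_frame_def translate_vector_def)
qed

text \<open>Transport \<open>w\<close> to the identity by \<open>inv g\<close>, expand it in
  coordinate vectors, and transport back.\<close>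

lemma tangent_vector_left_frame:
  assumes w: "tangent_vector N g w"
  shows "w f = (\<Sum>i<cdim N. w (\<lambda>k. \<phi> (inv g \<otimes> k) i) * left_frame i g f)"
proof (cases "hol_near N g f")
  case True
  define w' where "w' = push N \<one> (\<lambda>k. inv g \<otimes> k) w"
  have "tangent_vector N (inv g \<otimes> g) (push N (inv g \<otimes> g) (\<lambda>k. inv g \<otimes> k) w)"
    by (rule tangent_vector_push[OF hol_map_left_translation w])
  then have w': "tangent_vector N \<one> w'" by (simp add: w'_def)
  have "w f = w' (\<lambda>h. f (g \<otimes> h))"
    using True by (simp add: w'_def push_def hol_near_left_translation)
  also have "\<dots> = (\<Sum>i<cdim N. w' (\<lambda>q. \<phi> q i) * cvec N U \<phi> i \<one> (\<lambda>h. f (g \<otimes> h)))"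
    by (rule fun_cong[OF tangent_vector_basis[OF Lie_manifold ch oneU w']])
  also have "\<dots> = (\<Sum>i<cdim N. w (\<lambda>k. \<phi> (inv g \<otimes> k) i) * left_frame i g f)"
    by (rule sum.cong[OF refl])
       (simp add: w'_def push_def hol_near_coord[OF Lie_manifold ch oneU] left_frame_def translate_vector_def)
  finally show ?thesis .
next
  case False
  have "left_frame i g f = 0" if "i < cdim N" for i
    using tv_not_hol_near[OF vector_fields_tangent[of "left_frame i" N UNIV g] False]
      left_frame_invariant[OF that]
    by (simp add: left_invariant_fields_def)
  then show ?thesis using tv_not_hol_near[OF w False] by simp
qed

end

end

section \<open>Transversal symmetries of an automorphic system\<close>

context
  fixes S :: "('s::t2_space) cmanifold" and D :: "'s vfield"
    and N :: "('g::t2_space) cmanifold" and G :: "'g monoid" (structure)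
    and A :: "('s \<times> 'g) vfield"
  assumes S: "complex_manifold S" and D: "D \<in> vector_fields S UNIV" and LG: "complex_lie_group N G"
    and A: "automorphic_system S D N G A"
begin

abbreviation (input) "SN \<equiv> prod_manifold S N"

lemma N_manifold: "complex_manifold N"
  by (rule Lie_manifold[OF LG])

lemma SN_manifold: "complex_manifold SN"
  by (rule complex_manifold_prod[OF S N_manifold])

lemma automorphic_systemE:
  obtains s :: nat and f X where
    "\<forall>i\<in>{1..s}. hol_on S (f i) UNIV" "\<forall>i\<in>{1..s}. X i \<in> right_invariant_fields N G"
    "A = (\<lambda>p F. lift_fst S N D p F + (\<Sum>i=1..s. f i (fst p) * lift_snd S N (X i) p F))"
proof -
  obtain s :: nat and f X where *:
    "\<forall>i\<in>{1..s}. hol_on S (f i) UNIV \<and> X i \<in> right_invariant_fields N G"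
    "A = (\<lambda>(t, g) F. lift_fst S N D (t, g) F + (\<Sum>i=1..s. f i t * lift_snd S N (X i) (t, g) F))"
    using A unfolding automorphic_system_def by blast
  show thesis
  proof (rule that)
    show "A = (\<lambda>p F. lift_fst S N D p F + (\<Sum>i=1..s. f i (fst p) * lift_snd S N (X i) p F))"
      unfolding *(2) by (rule ext) (simp add: case_prod_unfold)
  qed (use *(1) in auto)
qed

lemma right_invariant_vector_field: "X \<in> right_invariant_fields N G \<Longrightarrow> X \<in> vector_fields N UNIV"
  by (simp add: right_invariant_fields_def)

lemma left_invariant_vector_field: "X \<in> left_invariant_fields N G \<Longrightarrow> X \<in> vector_fields N UNIV"
  by (simp add: left_invariant_fields_def)

lemma automorphic_vector_field: "A \<in> vector_fields SN UNIV"
proof -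
  obtain s :: nat and f X where fX0:
    "\<forall>i\<in>{1..s}. hol_on S (f i) UNIV" "\<forall>i\<in>{1..s}. X i \<in> right_invariant_fields N G"
    and A': "A = (\<lambda>p F. lift_fst S N D p F + (\<Sum>i=1..s. f i (fst p) * lift_snd S N (X i) p F))"
    using automorphic_systemE .
  note fX = fX0[rule_format]
  \<comment> \<open>The coefficient fields are numbered from 1, so index 0 is free for the lift of
    \<open>D\<close> with coefficient 1, and \<open>A\<close> becomes a single sum.\<close>
  let ?Z = "\<lambda>i. if i = 0 then lift_fst S N D else lift_snd S N (X i)"
  let ?c = "\<lambda>i p. if i = 0 then 1 else f i (fst p)"
  have "(\<lambda>p F. \<Sum>i\<in>{0..s}. ?c i p * ?Z i p F) \<in> vector_fields SN UNIV"
  proof (rule vector_fields_sum)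
    fix i assume i: "i \<in> {0..s}"
    show "?Z i \<in> vector_fields SN UNIV"
      using vector_fields_lift_fst[OF S N_manifold D] vector_fields_lift_snd[OF S N_manifold right_invariant_vector_field[OF fX(2)]] i
      by auto
    show "hol_on SN (?c i) UNIV"
      using hol_on_const[where c = 1 and W = UNIV] hol_map_on[OF hol_map_fst[OF S N_manifold] open_UNIV fX(1)] i
      by (cases "i = 0") auto
  qed simp
  moreover have "(\<Sum>i\<in>{0..s}. ?c i p * ?Z i p F) = A p F" for p F
    by (simp add: A' sum.atLeast_Suc_atMost)
  ultimately show ?thesis by simp
qed

lemma lift_snd_comp_fst:
  assumes X: "X \<in> vector_fields N UNIV"
  shows "lift_snd S N X p (\<lambda>q. h (fst q)) = 0"
  using tv_const[OF vector_fields_tangent[OF X UNIV_I]] by (cases p) (simp add: lift_snd_def)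

text \<open>The fields along the group kill functions of t. This is how the multiplier of a symmetry
  is isolated.\<close>

lemma automorphic_comp_fst:
  assumes h: "hol_near S (fst p) h"
  shows "A p (\<lambda>q. h (fst q)) = D (fst p) h"
proof -
  obtain s :: nat and f X where fX0:
    "\<forall>i\<in>{1..s}. hol_on S (f i) UNIV" "\<forall>i\<in>{1..s}. X i \<in> right_invariant_fields N G"
    and A': "A = (\<lambda>p F. lift_fst S N D p F + (\<Sum>i=1..s. f i (fst p) * lift_snd S N (X i) p F))"
    using automorphic_systemE .
  note fX = fX0[rule_format]
  have "lift_fst S N D p (\<lambda>q. h (fst q)) = D (fst p) h"
    using hol_near_comp_fst[OF S N_manifold h] by (cases p) (simp add: lift_fst_def)
  then show ?thesis
    using lift_snd_comp_fst[OF right_invariant_vector_field[OF fX(2)]] by (simp add: A')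
qed

text \<open>\<open>X\<close> commutes with \<open>D\<close> because they act on different factors,
  and with the right invariant fields by \<open>left_right_invariant_commute\<close>; moreover it
  kills the coefficients \<open>f i\<close>, which depend on t alone.\<close>

lemma left_invariant_commutes_automorphic:
  assumes X: "X \<in> left_invariant_fields N G" and F: "hol_near SN p F"
  shows "lift_snd S N X p (\<lambda>q. A q F) = A p (\<lambda>q. lift_snd S N X q F)"
proof -
  obtain s :: nat and f Y where fY0:
    "\<forall>i\<in>{1..s}. hol_on S (f i) UNIV" "\<forall>i\<in>{1..s}. Y i \<in> right_invariant_fields N G"
    and A': "A = (\<lambda>p F. lift_fst S N D p F + (\<Sum>i=1..s. f i (fst p) * lift_snd S N (Y i) p F))"
    using automorphic_systemE .
  note fY = fY0[rule_format]
  obtain t g where p: "p = (t, g)" by fastforce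
  note vX = left_invariant_vector_field[OF X] and vY = right_invariant_vector_field[OF fY(2)]
  note lX = vector_fields_lift_snd[OF S N_manifold vX]
  let ?X = "lift_snd S N X" and ?D = "lift_fst S N D" and ?Y = "\<lambda>i. lift_snd S N (Y i)"
  note tX = vector_fields_tangent[OF lX UNIV_I]
  have hX: "hol_near SN p (\<lambda>q. ?X q F)"
    by (rule vector_fields_hol_near[OF lX open_UNIV UNIV_I F])
  have hD: "hol_near SN p (\<lambda>q. ?D q F)"
    by (rule vector_fields_hol_near[OF vector_fields_lift_fst[OF S N_manifold D] open_UNIV UNIV_I F])
  have hY: "hol_near SN p (\<lambda>q. ?Y i q F)" if "i \<in> {1..s}" for i
    by (rule vector_fields_hol_near[OF vector_fields_lift_snd[OF S N_manifold vY[OF that]] open_UNIV UNIV_I F])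
  have hf: "hol_near SN p (\<lambda>q. f i (fst q))" if "i \<in> {1..s}" for i
    by (rule hol_near_comp_fst[OF S N_manifold hol_nearI[OF open_UNIV UNIV_I fY(1)[OF that]]])
  have hF: "hol_near N g (\<lambda>g'. F (t, g'))" using hol_near_slice2[OF S N_manifold] F p by blast
  \<comment> \<open>The lifts carry a guard for holomorphy of \<open>F\<close>. To unfold it under
    an outer derivation, it must hold at all nearby points of each slice.\<close>
  have ev1: "\<forall>\<^sub>F g' in nhds g. hol_near SN (t, g') F" and ev2: "\<forall>\<^sub>F t' in nhds t. hol_near SN (t', g) F"
  proof -
    obtain W where W: "open W" "p \<in> W" "hol_on SN F W" using F by (auto simp: hol_near_def)
    have n: "hol_near SN z F" if "z \<in> W" for z using W(1) that W(3) by (rule hol_nearI)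
    show "\<forall>\<^sub>F g' in nhds g. hol_near SN (t, g') F"
      using eventually_nhds_in_open[OF hol_map_open[OF hol_map_slice2[OF S N_manifold] W(1)], of g t] W(2) p n
      by (auto elim!: eventually_mono)
    show "\<forall>\<^sub>F t' in nhds t. hol_near SN (t', g) F"
      using eventually_nhds_in_open[OF hol_map_open[OF hol_map_slice1[OF S N_manifold] W(1)], of t g] W(2) p n
      by (auto elim!: eventually_mono)
  qed
  have gX: "X g u = X g u'" if "hol_near N g u" "\<forall>\<^sub>F x in nhds g. u x = u' x" for u u'
    by (rule tv_cong[OF vector_fields_tangent[OF vX UNIV_I] that(1) hol_near_cong[OF N_manifold that(2,1)] that(2)])
  have D: "?X p (\<lambda>q. ?D q F) = ?D p (\<lambda>q. ?X q F)"
  proof -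
    have "?X p (\<lambda>q. ?D q F) = X g (\<lambda>g'. ?D (t, g') F)"
      using hD by (simp add: p lift_snd_def)
    also have "\<dots> = X g (\<lambda>g'. D t (\<lambda>t'. F (t', g')))"
      by (rule gX[OF hol_near_slice2[OF S N_manifold hD[unfolded p]] eventually_mono[OF ev1]]) (simp add: lift_fst_def)
    also have "\<dots> = D t (\<lambda>t'. X g (\<lambda>g'. F (t', g')))"
      by (rule partial_derivatives_commute[OF S N_manifold vector_fields_tangent[OF D UNIV_I]
            vector_fields_tangent[OF vX UNIV_I] F[unfolded p], symmetric])
    also have "\<dots> = D t (\<lambda>t'. ?X (t', g) F)"
    proof -
      have ev: "\<forall>\<^sub>F t' in nhds t. ?X (t', g) F = X g (\<lambda>g'. F (t', g'))"
        by (rule eventually_mono[OF ev2]) (simp add: lift_snd_def)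
      have h: "hol_near S t (\<lambda>t'. ?X (t', g) F)" by (rule hol_near_slice1[OF S N_manifold hX[unfolded p]])
      show ?thesis
        by (rule tv_cong[OF vector_fields_tangent[OF D UNIV_I] h hol_near_cong[OF S ev h] ev, symmetric])
    qed
    also have "\<dots> = ?D p (\<lambda>q. ?X q F)"
      using hX by (simp add: p lift_fst_def)
    finally show ?thesis .
  qed
  have Y: "?X p (\<lambda>q. ?Y i q F) = ?Y i p (\<lambda>q. ?X q F)" if i: "i \<in> {1..s}" for i
  proof -
    have "?X p (\<lambda>q. ?Y i q F) = X g (\<lambda>g'. ?Y i (t, g') F)"
      using hY[OF i] by (simp add: p lift_snd_def)
    also have "\<dots> = X g (\<lambda>g'. Y i g' (\<lambda>g'. F (t, g')))"
      by (rule gX[OF hol_near_slice2[OF S N_manifold hY[OF i, unfolded p]] eventually_mono[OF ev1]]) (simp add: lift_snd_def)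
    also have "\<dots> = Y i g (\<lambda>g'. X g' (\<lambda>g'. F (t, g')))"
      by (rule left_right_invariant_commute[OF LG X fY(2)[OF i] hF])
    also have "\<dots> = Y i g (\<lambda>g'. ?X (t, g') F)"
    proof -
      have ev: "\<forall>\<^sub>F g' in nhds g. ?X (t, g') F = X g' (\<lambda>g'. F (t, g'))"
        by (rule eventually_mono[OF ev1]) (simp add: lift_snd_def)
      have h: "hol_near N g (\<lambda>g'. ?X (t, g') F)" by (rule hol_near_slice2[OF S N_manifold hX[unfolded p]])
      show ?thesis
        by (rule tv_cong[OF vector_fields_tangent[OF vY[OF i] UNIV_I] h hol_near_cong[OF N_manifold ev h] ev, symmetric])
    qed
    also have "\<dots> = ?Y i p (\<lambda>q. ?X q F)"
      using hX by (simp add: p lift_snd_def)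
    finally show ?thesis .
  qed
  have "?X p (\<lambda>q. A q F) = ?X p (\<lambda>q. ?D q F) + (\<Sum>i=1..s. ?X p (\<lambda>q. f i (fst q) * ?Y i q F))"
  proof -
    have m: "hol_near SN p (\<lambda>q. f i (fst q) * ?Y i q F)" if "i \<in> {1..s}" for i
      by (rule hol_near_mult[OF hf[OF that] hY[OF that]])
    have "?X p (\<lambda>q. A q F) = ?X p (\<lambda>q. ?D q F) + ?X p (\<lambda>q. \<Sum>i=1..s. f i (fst q) * ?Y i q F)"
      unfolding A' by (rule tv_add[OF tX hD hol_near_sum]) (rule m)
    also have "?X p (\<lambda>q. \<Sum>i=1..s. f i (fst q) * ?Y i q F) = (\<Sum>i=1..s. ?X p (\<lambda>q. f i (fst q) * ?Y i q F))"
      by (rule tv_sum[OF tX]) (rule m)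
    finally show ?thesis .
  qed
  \<comment> \<open>The product rule leaves no derivative of \<open>f i\<close>, by
    \<open>lift_snd_comp_fst\<close>.\<close>
  also have "\<dots> = ?D p (\<lambda>q. ?X q F) + (\<Sum>i=1..s. f i (fst p) * ?Y i p (\<lambda>q. ?X q F))"
    by (simp add: D tv_mult[OF tX hf hY] Y lift_snd_comp_fst[OF vX])
  finally show ?thesis by (simp add: A')
qed

section \<open>Coefficients with respect to the lifted frame\<close>

context
  fixes U :: "'g set" and \<phi> :: "'g \<Rightarrow> nat \<Rightarrow> complex"
  assumes ch: "(U, \<phi>) \<in> atlas N" and oneU: "\<one> \<in> U"
begin

abbreviation (input) "frame i \<equiv> left_frame N G U \<phi> i"

lemma frame_left_invariant: "i < cdim N \<Longrightarrow> frame i \<in> left_invariant_fields N G"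
  by (rule left_frame_invariant[OF LG ch oneU])

lemma lift_frame: "i < cdim N \<Longrightarrow> lift_snd S N (frame i) \<in> vector_fields SN UNIV"
  by (rule vector_fields_lift_snd[OF S N_manifold left_invariant_vector_field[OF frame_left_invariant]])

lemma hol_near_lifted_coord:
  "i < cdim N \<Longrightarrow> hol_near SN p (\<lambda>q. \<phi> (inv (snd p) \<otimes> snd q) i)"
  by (rule hol_near_comp_snd[OF S N_manifold hol_near_translated_coord[OF LG ch oneU]])

lemma lift_frame_coord:
  assumes "i < cdim N" "j < cdim N"
  shows "lift_snd S N (frame i) p (\<lambda>q. \<phi> (inv (snd p) \<otimes> snd q) j) = (if i = j then 1 else 0)"
  using hol_near_lifted_coord[OF assms(2), of p] left_frame_coord[OF LG ch oneU assms]
  by (cases p) (simp add: lift_snd_def)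

text \<open>Testing on the dual coordinate \<open>j\<close> centred at \<open>p\<close> singles out
  \<open>c j\<close>; injectivity on the tensor product rests on this.\<close>

lemma frame_combination_unique:
  assumes "\<And>F. (\<Sum>i<cdim N. c i * lift_snd S N (frame i) p F) = 0" and j: "j < cdim N"
  shows "c j = 0"
proof -
  have "(\<Sum>i<cdim N. c i * lift_snd S N (frame i) p (\<lambda>q. \<phi> (inv (snd p) \<otimes> snd q) j)) =
      (\<Sum>i<cdim N. if i = j then c j else 0)"
    by (rule sum.cong) (auto simp: lift_frame_coord j)
  then show ?thesis using assms by simp
qed

text \<open>The product rule splits \<open>A (c i * E i F)\<close>. The part that keeps
  \<open>c i\<close> undifferentiated cancels against \<open>L (A F)\<close> because the frame
  commutes with \<open>A\<close>.\<close>

lemma bracket_frame_combination: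
  assumes c: "\<And>i. i < cdim N \<Longrightarrow> hol_near SN p (c i)" and F: "hol_near SN p F"
    and L: "\<forall>\<^sub>F q in nhds p. L q = (\<lambda>F. \<Sum>i<cdim N. c i q * lift_snd S N (frame i) q F)"
  shows "L p (\<lambda>q. A q F) - A p (\<lambda>q. L q F) = - (\<Sum>i<cdim N. lift_snd S N (frame i) p F * A p (c i))"
proof -
  let ?E = "\<lambda>i. lift_snd S N (frame i)" and ?n = "cdim N"
  note tA = vector_fields_tangent[OF automorphic_vector_field UNIV_I]
  have hE: "hol_near SN p (\<lambda>q. ?E i q F)" if "i < ?n" for i
    by (rule vector_fields_hol_near[OF lift_frame[OF that] open_UNIV UNIV_I F])
  have m: "hol_near SN p (\<lambda>q. c i q * ?E i q F)" if "i < ?n" for i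
    by (rule hol_near_mult[OF c[OF that] hE[OF that]])
  have h: "hol_near SN p (\<lambda>q. \<Sum>i<?n. c i q * ?E i q F)"
    by (rule hol_near_sum) (use m in simp)
  have ev: "\<forall>\<^sub>F q in nhds p. (\<Sum>i<?n. c i q * ?E i q F) = L q F"
    using L by (rule eventually_mono) simp
  have "A p (\<lambda>q. L q F) = A p (\<lambda>q. \<Sum>i<?n. c i q * ?E i q F)"
    by (rule tv_cong[OF tA h hol_near_cong[OF SN_manifold ev h] ev, symmetric])
  also have "\<dots> = (\<Sum>i<?n. A p (\<lambda>q. c i q * ?E i q F))"
    by (rule tv_sum[OF tA]) (use m in simp)
  also have "\<dots> = (\<Sum>i<?n. c i p * A p (\<lambda>q. ?E i q F) + ?E i p F * A p (c i))"
    by (rule sum.cong[OF refl], rule tv_mult[OF tA]) (use c hE in auto)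
  finally have 1: "A p (\<lambda>q. L q F) = (\<Sum>i<?n. c i p * A p (\<lambda>q. ?E i q F)) + (\<Sum>i<?n. ?E i p F * A p (c i))"
    by (simp add: sum.distrib)
  have "L p = (\<lambda>F. \<Sum>i<?n. c i p * ?E i p F)" using eventually_nhds_x_imp_x[OF L] .
  then have "L p (\<lambda>q. A q F) = (\<Sum>i<?n. c i p * ?E i p (\<lambda>q. A q F))" by simp
  also have "\<dots> = (\<Sum>i<?n. c i p * A p (\<lambda>q. ?E i q F))"
    by (rule sum.cong[OF refl]) (simp add: left_invariant_commutes_automorphic[OF frame_left_invariant F])
  finally show ?thesis using 1 by simp
qed

text \<open>With first integrals as coefficients the bracket formula gives 0, so the zero multiplier
  witnesses the symmetry.\<close>

lemma frame_combination_in_Trans: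
  assumes W: "open W" and c: "\<And>i. i < cdim N \<Longrightarrow> c i \<in> first_integrals SN A W"
  shows "(\<lambda>p F. \<Sum>i<cdim N. c i p * lift_snd S N (frame i) p F) \<in> Trans S N A W" (is "?L \<in> _")
proof -
  have hc: "hol_on SN (c i) W" "p \<notin> W \<Longrightarrow> c i p = 0" "p \<in> W \<Longrightarrow> A p (c i) = 0" if "i < cdim N" for i p
    using c[OF that] unfolding first_integrals_def by blast+
  have 1: "?L \<in> vector_fields SN W"
    by (rule vector_fields_sum) (use lift_frame hc in auto)
  have 2: "transversal_on S W ?L"
    unfolding transversal_on_def
    using lift_snd_comp_fst[OF left_invariant_vector_field[OF frame_left_invariant]] by simp
  have 3: "bracket SN ?L A p F = 0 * A p F" if p: "p \<in> W" for p F
  proof (cases "hol_near SN p F")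
    case True
    have "?L p (\<lambda>q. A q F) - A p (\<lambda>q. ?L q F) = - (\<Sum>i<cdim N. lift_snd S N (frame i) p F * A p (c i))"
      by (rule bracket_frame_combination[OF hol_nearI[OF W p hc(1)] True]) simp_all
    then show ?thesis using True hc(3)[OF _ p] by (simp add: bracket_def)
  qed (simp add: bracket_def)
  show ?thesis unfolding Trans_def using 3 by (intro CollectI conjI 1 2 exI[of _ "\<lambda>p. 0"]) blast
qed

text \<open>A vector killed by the differential of the projection to \<open>S\<close> comes from its
  projection to the group, whose expansion in the left frame is known.\<close>

lemma transversal_expansion:
  assumes v: "tangent_vector SN p v" and tr: "\<And>h. hol_near S (fst p) h \<Longrightarrow> v (\<lambda>q. h (fst q)) = 0"
  shows "v = (\<lambda>F. \<Sum>i<cdim N. v (\<lambda>q. \<phi> (inv (snd p) \<otimes> snd q) i) * lift_snd S N (frame i) p F)"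
proof -
  obtain t g where p: "p = (t, g)" by fastforce
  define w where "w = push N g snd v"
  have w: "tangent_vector N g w"
    using tangent_vector_push[OF hol_map_snd[OF S N_manifold] v] by (simp add: w_def p)
  \<comment> \<open>Compared on a product chart: coordinates of \<open>S\<close> are killed on both
    sides, on the left by transversality and on the right because they are constant on the
    slice.\<close>
  have vw: "v = push SN p (\<lambda>g'. (t, g')) w"
  proof -
    obtain C \<chi>' where C: "(C, \<chi>') \<in> atlas S" "t \<in> C" using chart_at[OF S] .
    obtain V \<psi> where V: "(V, \<psi>) \<in> atlas N" "g \<in> V" using chart_at[OF N_manifold] .
    show ?thesis
    proof (rule tangent_vector_eqI[OF SN_manifold prod_chart_in_atlas[OF C(1) V(1)] _ v])
      show "p \<in> C \<times> V" using C V p by simp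
      show "tangent_vector SN p (push SN p (\<lambda>g'. (t, g')) w)"
        unfolding p by (rule tangent_vector_push[OF hol_map_slice2[OF S N_manifold] w])
      fix i assume i: "i < cdim SN"
      let ?P = "prod_chart (cdim S) \<chi>' \<psi>"
      have h: "hol_near SN p (\<lambda>q. ?P q i)"
        by (rule hol_near_coord[OF SN_manifold prod_chart_in_atlas[OF C(1) V(1)] _ i]) (use C V p in simp)
      show "v (\<lambda>q. ?P q i) = push SN p (\<lambda>g'. (t, g')) w (\<lambda>q. ?P q i)"
      proof (cases "i < cdim S")
        case True
        then have "v (\<lambda>q. ?P q i) = v (\<lambda>q. \<chi>' (fst q) i)"
          by (simp add: prod_chart_def case_prod_unfold)
        also have "\<dots> = 0" using tr[of "\<lambda>x. \<chi>' x i"] hol_near_coord[OF S C True] by (simp add: p)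
        finally show ?thesis using True h by (simp add: push_def prod_chart_apply tv_const[OF w])
      next
        case False
        have "hol_near N g (\<lambda>x. \<psi> x (i - cdim S))"
          by (rule hol_near_coord[OF N_manifold V]) (use i False in simp)
        with False h show ?thesis
          by (simp add: push_def prod_chart_apply w_def) (simp add: prod_chart_def case_prod_unfold)
      qed
    qed
  qed
  have wv: "w (\<lambda>k. \<phi> (inv g \<otimes> k) i) = v (\<lambda>q. \<phi> (inv g \<otimes> snd q) i)" if "i < cdim N" for i
    using hol_near_translated_coord[OF LG ch oneU that] by (simp add: w_def push_def)
  show ?thesis
  proof
    fix F
    show "v F = (\<Sum>i<cdim N. v (\<lambda>q. \<phi> (inv (snd p) \<otimes> snd q) i) * lift_snd S N (frame i) p F)"
    proof (cases "hol_near SN p F")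
      case True
      have "v F = w (\<lambda>g'. F (t, g'))" using True by (subst vw) (simp add: push_def)
      also have "\<dots> = (\<Sum>i<cdim N. w (\<lambda>k. \<phi> (inv g \<otimes> k) i) * frame i g (\<lambda>g'. F (t, g')))"
        by (rule tangent_vector_left_frame[OF LG ch oneU w])
      finally show ?thesis using True by (simp add: wv p lift_snd_def)
    next
      case False
      then show ?thesis using tv_not_hol_near[OF v False] by (simp add: p lift_snd_def)
    qed
  qed
qed

lemma Trans_frame_expansion:
  assumes W: "open W" and Dnz: "\<And>t. D t \<noteq> 0" and L: "L \<in> Trans S N A W"
  obtains c where "\<forall>i<cdim N. c i \<in> first_integrals SN A W"
    "L = (\<lambda>p F. \<Sum>i<cdim N. c i p * lift_snd S N (frame i) p F)"
proof -
  let ?n = "cdim N"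
  from L obtain l where vL: "L \<in> vector_fields SN W" and tr: "transversal_on S W L"
    and l: "\<And>p F. p \<in> W \<Longrightarrow> bracket SN L A p F = l p * A p F"
    unfolding Trans_def by blast
  have L0: "L p = 0" if "p \<notin> W" for p using vL that unfolding vector_fields_def by blast
  have tL: "tangent_vector SN p (L p)" if "p \<in> W" for p using vector_fields_tangent[OF vL that] .
  have trL: "L p (\<lambda>q. h (fst q)) = 0" if "p \<in> W" "hol_near S (fst p) h" for p h
    using tr that by (simp add: transversal_on_def)
  note tA = vector_fields_tangent[OF automorphic_vector_field UNIV_I]
  \<comment> \<open>The dual coordinates are centred at \<open>p\<close> itself, so the function
    being differentiated changes with \<open>p\<close>.\<close>
  define c where "c i p = L p (\<lambda>q. \<phi> (inv (snd p) \<otimes> snd q) i)" for i p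
  have exp: "L p = (\<lambda>F. \<Sum>i<?n. c i p * lift_snd S N (frame i) p F)" for p
  proof (cases "p \<in> W")
    case True
    from transversal_expansion[OF tL[OF True] trL[OF True]] show ?thesis by (simp add: c_def)
  qed (simp add: L0 c_def fun_eq_iff)
  have hc: "hol_on SN (c i) W" if i: "i < ?n" for i
  proof -
    have m: "hol_map (prod_manifold N N) N (\<lambda>z. inv (fst z) \<otimes> snd z)"
      by (rule hol_map_mult[OF LG complex_manifold_prod[OF N_manifold N_manifold]
            hol_map_compose[OF hol_map_fst[OF N_manifold N_manifold] hol_map_inv[OF LG]] hol_map_snd[OF N_manifold N_manifold]])
    let ?O = "(\<lambda>z. inv (fst z) \<otimes> snd z) -` U"
    \<comment> \<open>The moving test function is the slice at \<open>snd p\<close> of one fixed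
      function on \<open>N\<close> times \<open>N\<close>, namely coordinate \<open>i\<close> of
      x^-1 y. The parameter is p in \<open>W\<close>, and the vector is the projection of
      \<open>L p\<close> to the group.\<close>
    have "hol_on SN (\<lambda>p. L p (\<lambda>q. (\<lambda>z. \<phi> (inv (fst z) \<otimes> snd z) i) (snd p, snd q))) {p \<in> W. (snd p, snd p) \<in> ?O}"
    proof (rule hol_on_fibre_derivative[OF N_manifold N_manifold SN_manifold hol_map_snd[OF S N_manifold] hol_map_snd[OF S N_manifold] W,
            where Y = "\<lambda>p h. L p (\<lambda>q. h (snd q))"])
      fix p assume p: "p \<in> W"
      have "(\<lambda>h. L p (\<lambda>q. h (snd q))) = push N (snd p) snd (L p)"
      proof
        fix h
        have "hol_near N (snd p) h" if "hol_near SN p (\<lambda>q. h (snd q))"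
          using hol_near_slice2[OF S N_manifold, of "fst p" "snd p" "\<lambda>q. h (snd q)"] that by simp
        then show "L p (\<lambda>q. h (snd q)) = push N (snd p) snd (L p) h"
          using tv_not_hol_near[OF tL[OF p]] by (auto simp: push_def)
      qed
      then show "tangent_vector N (snd p) (\<lambda>h. L p (\<lambda>q. h (snd q)))"
        using tangent_vector_push[OF hol_map_snd[OF S N_manifold] tL[OF p]] by simp
    next
      fix V h assume V: "open V" and h: "hol_on N h V"
      have "open (W \<inter> snd -` V)" "hol_on SN (\<lambda>q. h (snd q)) (W \<inter> snd -` V)"
        using open_Int[OF W hol_map_open[OF hol_map_snd[OF S N_manifold] V]]
          hol_on_subset[OF hol_map_on[OF hol_map_snd[OF S N_manifold] V h] Int_lower2] by auto
      then show "hol_on SN (\<lambda>p. L p (\<lambda>q. h (snd q))) (W \<inter> snd -` V)"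
        using vL unfolding vector_fields_def by blast
    next
      show "open ?O" "hol_on (prod_manifold N N) (\<lambda>z. \<phi> (inv (fst z) \<otimes> snd z) i) ?O"
        using hol_map_open[OF m chart_open[OF N_manifold ch]] hol_map_on[OF m chart_open[OF N_manifold ch] hol_on_coord[OF N_manifold ch i]] .
    qed
    \<comment> \<open>The diagonal lies in the domain since x^-1 x is the identity, a point of
      \<open>U\<close>.\<close>
    moreover have "{p \<in> W. (snd p, snd p) \<in> ?O} = W" using oneU Lie_mult[OF LG] by auto
    moreover have "c i = (\<lambda>p. L p (\<lambda>q. \<phi> (inv (snd p) \<otimes> snd q) i))" by (rule ext) (simp only: c_def)
    ultimately show ?thesis by simp
  qed
  have l0: "l p = 0" if p: "p \<in> W" for p
  proof -
    \<comment> \<open>As \<open>D\<close> is a nonzero functional, some function has nonzero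
      derivative; it is automatically a holomorphic germ, because tangent vectors vanish on all
      others. Pulled back to the product, it has bracket 0, which forces the multiplier to
      vanish.\<close>
    obtain h where h: "D (fst p) h \<noteq> 0" using Dnz[of "fst p"] by (auto simp: fun_eq_iff)
    have hn: "hol_near S (fst p) h"
      using tv_not_hol_near[OF vector_fields_tangent[OF D UNIV_I]] h by blast
    let ?F = "\<lambda>q. h (fst q)"
    have F: "hol_near SN p ?F" by (rule hol_near_comp_fst[OF S N_manifold hn])
    have ev: "\<forall>\<^sub>F q in nhds p. hol_near S (fst q) h"
    proof -
      obtain V where V: "open V" "fst p \<in> V" "hol_on S h V" using hn by (auto simp: hol_near_def)
      show ?thesis
        using eventually_nhds_in_open[OF hol_map_open[OF hol_map_fst[OF S N_manifold] V(1)], of p] V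
        by (auto elim!: eventually_mono intro: hol_nearI)
    qed
    have 1: "L p (\<lambda>q. A q ?F) = 0"
    proof -
      have e: "\<forall>\<^sub>F q in nhds p. A q ?F = D (fst q) h"
        using ev by (rule eventually_mono) (rule automorphic_comp_fst)
      have hA: "hol_near SN p (\<lambda>q. A q ?F)"
        by (rule vector_fields_hol_near[OF automorphic_vector_field open_UNIV UNIV_I F])
      have "L p (\<lambda>q. A q ?F) = L p (\<lambda>q. D (fst q) h)"
        by (rule tv_cong[OF tL[OF p] hA hol_near_cong[OF SN_manifold e hA] e])
      also have "\<dots> = 0"
        by (rule trL[OF p vector_fields_hol_near[OF D open_UNIV UNIV_I hn]])
      finally show ?thesis .
    qed
    have 2: "A p (\<lambda>q. L q ?F) = 0"
    proof -
      have e: "\<forall>\<^sub>F q in nhds p. 0 = L q ?F"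
        using ev eventually_nhds_in_open[OF W p] by eventually_elim (simp add: trL)
      have "A p (\<lambda>q. 0) = A p (\<lambda>q. L q ?F)"
        by (rule tv_cong[OF tA hol_near_const hol_near_cong[OF SN_manifold e hol_near_const] e])
      then show ?thesis using tv_const[OF tA, of p 0] by simp
    qed
    have "l p * D (fst p) h = 0"
      using l[OF p, of ?F] F 1 2 by (simp add: bracket_def automorphic_comp_fst[OF hn])
    with h show ?thesis by simp
  qed
  have "c j \<in> first_integrals SN A W" if j: "j < ?n" for j
    unfolding first_integrals_def
  proof (intro CollectI conjI allI impI ballI)
    show "hol_on SN (c j) W" by (rule hc[OF j])
    show "c j p = 0" if "p \<notin> W" for p using L0[OF that] by (simp add: c_def)
    fix p assume p: "p \<in> W"
    \<comment> \<open>On the dual coordinate \<open>j\<close> centred at \<open>p\<close> the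
      bracket formula reduces to \<open>- A p (c j)\<close>.\<close>
    let ?F = "\<lambda>q. \<phi> (inv (snd p) \<otimes> snd q) j"
    have F: "hol_near SN p ?F" by (rule hol_near_lifted_coord[OF j])
    have "L p (\<lambda>q. A q ?F) - A p (\<lambda>q. L q ?F) = - (\<Sum>i<?n. lift_snd S N (frame i) p ?F * A p (c i))"
      by (rule bracket_frame_combination[OF hol_nearI[OF W p hc] F]) (use exp in simp_all)
    moreover have "L p (\<lambda>q. A q ?F) - A p (\<lambda>q. L q ?F) = 0"
      using l[OF p, of ?F] F l0[OF p] by (simp add: bracket_def)
    ultimately have "0 = (\<Sum>i<?n. lift_snd S N (frame i) p ?F * A p (c i))" by simp
    also have "\<dots> = (\<Sum>i<?n. if i = j then A p (c j) else 0)"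
      by (rule sum.cong) (auto simp: lift_frame_coord j)
    finally show "A p (c j) = 0" using j by simp
  qed
  then show thesis using ext[of L, OF exp] by (intro that[of c]) blast+
qed

end

end

section \<open>Tensor products\<close>

lemma lookup_free_scale: "Poly_Mapping.lookup (free_scale c u) k = c * Poly_Mapping.lookup u k"
  by (simp add: free_scale_def map.rep_eq when_def)

lemma module_free_scale: "module free_scale"
  by unfold_locales (auto intro!: poly_mapping_eqI simp: lookup_free_scale lookup_add algebra_simps)

lemma module_vfield_scale: "module vfield_scale"
  by unfold_locales (auto simp: vfield_scale_def fun_eq_iff algebra_simps)

lemma module_fun_scale: "module fun_scale"
  by unfold_locales (auto simp: fun_scale_def fun_eq_iff algebra_simps)

context
  fixes s :: "complex \<Rightarrow> 'c \<Rightarrow> 'c::ab_group_add"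
  assumes s: "module s"
begin

interpretation s: module s by (rule s)

text \<open>Supports may shrink under addition and scaling, so linearity is proved over a common
  finite index set.\<close>

lemma formal_eval_superset:
  assumes "finite K" "Poly_Mapping.keys u \<subseteq> K"
  shows "formal_eval s b u = (\<Sum>k\<in>K. s (Poly_Mapping.lookup u k) (b (fst k) (snd k)))"
  unfolding formal_eval_def case_prod_unfold
  by (rule sum.mono_neutral_cong_left[OF assms]) (auto simp: in_keys_iff)

lemma formal_eval_add: "formal_eval s b (u + u') = formal_eval s b u + formal_eval s b u'"
proof -
  let ?K = "Poly_Mapping.keys u \<union> Poly_Mapping.keys u'"
  have "formal_eval s b (u + u') = (\<Sum>k\<in>?K. s (Poly_Mapping.lookup (u + u') k) (b (fst k) (snd k)))"
    by (rule formal_eval_superset) (simp_all add: keys_add)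
  then show ?thesis
    by (simp add: formal_eval_superset[of ?K u] formal_eval_superset[of ?K u'] lookup_add
          s.scale_left_distrib sum.distrib)
qed

lemma formal_eval_scale: "formal_eval s b (free_scale c u) = s c (formal_eval s b u)"
proof -
  have "formal_eval s b (free_scale c u) =
      (\<Sum>k\<in>Poly_Mapping.keys u. s (Poly_Mapping.lookup (free_scale c u) k) (b (fst k) (snd k)))"
    by (rule formal_eval_superset) (auto simp: in_keys_iff lookup_free_scale)
  then show ?thesis
    by (simp add: formal_eval_superset[of "Poly_Mapping.keys u" u] lookup_free_scale s.scale_sum_right)
qed

lemma module_hom_formal_eval: "module_hom free_scale s (formal_eval s b)"
  unfolding module_hom_iff using module_free_scale s formal_eval_add formal_eval_scale by blast

lemma formal_eval_diff: "formal_eval s b (u - u') = formal_eval s b u - formal_eval s b u'"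
  by (rule module_hom.diff[OF module_hom_formal_eval])

lemma formal_eval_sum: "formal_eval s b (\<Sum>i\<in>I. u i) = (\<Sum>i\<in>I. formal_eval s b (u i))"
  by (rule module_hom.sum[OF module_hom_formal_eval])

lemma formal_eval_free_pair: "formal_eval s b (free_pair v w) = b v w"
  by (simp add: formal_eval_def)

text \<open>The preimage of \<open>R\<close> is a subspace containing the generators.
  \<open>R\<close> is general because it serves twice: as {0} for evaluation to vector fields, and
  as the relations over a smaller open set for restriction.\<close>

lemma formal_eval_relations:
  assumes R: "module.subspace s R"
    and "\<And>v v' w. v \<in> V \<Longrightarrow> v' \<in> V \<Longrightarrow> w \<in> W \<Longrightarrow> b (v + v') w - b v w - b v' w \<in> R"
    and "\<And>v w w'. v \<in> V \<Longrightarrow> w \<in> W \<Longrightarrow> w' \<in> W \<Longrightarrow> b v (w + w') - b v w - b v w' \<in> R"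
    and "\<And>c v w. v \<in> V \<Longrightarrow> w \<in> W \<Longrightarrow> b (s1 c v) w - s c (b v w) \<in> R"
    and "\<And>c v w. v \<in> V \<Longrightarrow> w \<in> W \<Longrightarrow> b v (s2 c w) - s c (b v w) \<in> R"
    and u: "u \<in> bilinear_relations s1 s2 V W"
  shows "formal_eval s b u \<in> R"
proof -
  have "bilinear_relations s1 s2 V W \<subseteq> {u. formal_eval s b u \<in> R}"
    unfolding bilinear_relations_def
  proof (rule module.span_minimal[OF module_free_scale])
    show "module.subspace free_scale {u. formal_eval s b u \<in> R}"
      by (rule module_hom.subspace_vimage[OF module_hom_formal_eval R, unfolded vimage_def])
  qed (use assms in \<open>auto simp: formal_eval_diff formal_eval_scale formal_eval_free_pair\<close>)
  with u show ?thesis by blast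
qed

text \<open>Evaluation is constant on a coset once it kills the relations, and the coset contains
  \<open>u\<close>; thus \<open>the_elem\<close> is applied to a singleton.\<close>

lemma tensor_lift_class:
  assumes "\<And>r. r \<in> bilinear_relations s1 s2 V W \<Longrightarrow> formal_eval s b r = 0" and "u \<in> formal_sums V W"
    and "u \<in> tensor_class s1 s2 V W u"
  shows "tensor_lift s b (tensor_class s1 s2 V W u) = formal_eval s b u"
proof -
  have *: "formal_eval s b u' = formal_eval s b u" if "u' \<in> tensor_class s1 s2 V W u" for u'
    using assms(1)[of "u' - u"] that by (simp add: tensor_class_def formal_eval_diff)
  show ?thesis
    unfolding tensor_lift_def using assms(3) by (intro the_elem_image_unique[OF _ *]) auto
qed

end

lemma formal_sum_expansion:
  "u = (\<Sum>k\<in>Poly_Mapping.keys u. free_scale (Poly_Mapping.lookup u k) (free_pair (fst k) (snd k)))"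
proof (rule poly_mapping_eqI)
  fix k
  have "(\<Sum>l\<in>Poly_Mapping.keys u. Poly_Mapping.lookup u l * Poly_Mapping.lookup (free_pair (fst l) (snd l)) k) =
      (\<Sum>l\<in>Poly_Mapping.keys u. if l = k then Poly_Mapping.lookup u k else 0)"
    by (rule sum.cong) (auto simp: lookup_single when_def)
  then show "Poly_Mapping.lookup u k = Poly_Mapping.lookup
      (\<Sum>k\<in>Poly_Mapping.keys u. free_scale (Poly_Mapping.lookup u k) (free_pair (fst k) (snd k))) k"
    by (simp add: lookup_sum lookup_free_scale in_keys_iff)
qed

lemma subspace_formal_sums: "module.subspace free_scale (formal_sums V W)"
  unfolding module.subspace_def[OF module_free_scale] formal_sums_def mem_Collect_eq
proof (intro conjI ballI allI)
  fix u v :: "('a \<times> 'b) \<Rightarrow>\<^sub>0 complex"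
  assume "u \<in> {u. Poly_Mapping.keys u \<subseteq> V \<times> W}" "v \<in> {u. Poly_Mapping.keys u \<subseteq> V \<times> W}"
  then show "Poly_Mapping.keys (u + v) \<subseteq> V \<times> W" using keys_add[of u v] by blast
next
  fix c and u :: "('a \<times> 'b) \<Rightarrow>\<^sub>0 complex"
  assume "u \<in> {u. Poly_Mapping.keys u \<subseteq> V \<times> W}"
  moreover have "Poly_Mapping.keys (free_scale c u) \<subseteq> Poly_Mapping.keys u"
    by (auto simp: in_keys_iff lookup_free_scale)
  ultimately show "Poly_Mapping.keys (free_scale c u) \<subseteq> V \<times> W" by blast
qed simp

lemma free_pair_in_formal_sums: "v \<in> V \<Longrightarrow> w \<in> W \<Longrightarrow> free_pair v w \<in> formal_sums V W"
  by (simp add: formal_sums_def)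

section \<open>Normal forms modulo the bilinear relations\<close>

context
  fixes s1 :: "complex \<Rightarrow> 'a \<Rightarrow> 'a::ab_group_add" and s2 :: "complex \<Rightarrow> 'b \<Rightarrow> 'b::ab_group_add"
    and V :: "'a set" and W :: "'b set"
begin

interpretation free: module free_scale by (rule module_free_scale)

abbreviation (input) "Rel \<equiv> bilinear_relations s1 s2 V W"

lemma subspace_Rel: "free.subspace Rel"
  unfolding bilinear_relations_def by (rule free.subspace_span)

lemma Rel_generators:
  "v \<in> V \<Longrightarrow> v' \<in> V \<Longrightarrow> w \<in> W \<Longrightarrow> free_pair (v + v') w - free_pair v w - free_pair v' w \<in> Rel"
  "v \<in> V \<Longrightarrow> w \<in> W \<Longrightarrow> w' \<in> W \<Longrightarrow> free_pair v (w + w') - free_pair v w - free_pair v w' \<in> Rel"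
  "v \<in> V \<Longrightarrow> w \<in> W \<Longrightarrow> free_pair (s1 c v) w - free_scale c (free_pair v w) \<in> Rel"
  "v \<in> V \<Longrightarrow> w \<in> W \<Longrightarrow> free_pair v (s2 c w) - free_scale c (free_pair v w) \<in> Rel"
  unfolding bilinear_relations_def by (rule free.span_base; blast)+

lemma mem_tensor_class: "u \<in> formal_sums V W \<Longrightarrow> u \<in> tensor_class s1 s2 V W u"
  using free.subspace_0[OF subspace_Rel] by (simp add: tensor_class_def)

lemma tensor_class_eqI:
  assumes "u' - u \<in> Rel"
  shows "tensor_class s1 s2 V W u' = tensor_class s1 s2 V W u"
proof -
  have "x - u' \<in> Rel \<longleftrightarrow> x - u \<in> Rel" for x
  proof
    assume "x - u' \<in> Rel"
    from free.subspace_add[OF subspace_Rel this assms] show "x - u \<in> Rel" by simp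
  next
    assume "x - u \<in> Rel"
    from free.subspace_diff[OF subspace_Rel this assms] show "x - u' \<in> Rel" by simp
  qed
  then show ?thesis by (simp add: tensor_class_def)
qed

context
  assumes s1: "module s1" and s2: "module s2" and V: "module.subspace s1 V" and W: "module.subspace s2 W"
begin

interpretation m1: module s1 by (rule s1)
interpretation m2: module s2 by (rule s2)

text \<open>The additivity relation for 0 + 0 is the negative of this pair.\<close>

lemma free_pair_0_left: "w \<in> W \<Longrightarrow> free_pair 0 w \<in> Rel"
  using Rel_generators(1)[of 0 0 w] m1.subspace_0[OF V] free.subspace_neg[OF subspace_Rel] by fastforce

lemma free_pair_0_right: "v \<in> V \<Longrightarrow> free_pair v 0 \<in> Rel"
  using Rel_generators(2)[of v 0 0] m2.subspace_0[OF W] free.subspace_neg[OF subspace_Rel] by fastforce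

text \<open>Splits the left factor by additivity and moves each scalar to the right factor.\<close>

lemma free_pair_combination:
  fixes n :: nat
  assumes E: "\<And>i. i < n \<Longrightarrow> E i \<in> V" and w: "w \<in> W"
  shows "free_pair (\<Sum>i<n. s1 (a i) (E i)) w - (\<Sum>i<n. free_pair (E i) (s2 (a i) w)) \<in> Rel"
  using E
proof (induction n)
  case 0
  then show ?case using free_pair_0_left[OF w] by simp
next
  case (Suc n)
  let ?v = "\<Sum>i<n. s1 (a i) (E i)"
  have E: "E n \<in> V" using Suc.prems by simp
  have "?v \<in> V" using Suc.prems by (intro m1.subspace_sum[OF V] m1.subspace_scale[OF V]) auto
  from Rel_generators(1)[OF this m1.subspace_scale[OF V E] w, of "a n"]
  have 1: "free_pair (?v + s1 (a n) (E n)) w - free_pair ?v w - free_pair (s1 (a n) (E n)) w \<in> Rel" .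
  \<comment> \<open>Difference of the two homogeneity relations, in which the scaled pair
    cancels.\<close>
  have 2: "free_pair (s1 (a n) (E n)) w - free_pair (E n) (s2 (a n) w) \<in> Rel"
    using free.subspace_diff[OF subspace_Rel Rel_generators(3)[OF E w, of "a n"] Rel_generators(4)[OF E w, of "a n"]]
    by simp
  have "free_pair ?v w - (\<Sum>i<n. free_pair (E i) (s2 (a i) w)) \<in> Rel" using Suc by simp
  from free.subspace_add[OF subspace_Rel free.subspace_add[OF subspace_Rel 1 2] this]
  show ?case by (simp add: algebra_simps)
qed

text \<open>The sums with such a normal form are closed under addition and scaling, and contain
  every pair by \<open>free_pair_combination\<close>. Uniqueness of the \<open>F i\<close> is
  supplied for fields by \<open>frame_combination_unique\<close>.\<close>

lemma formal_sum_normal_form: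
  fixes n :: nat
  assumes E: "\<And>i. i < n \<Longrightarrow> E i \<in> V" and gen: "\<And>v. v \<in> V \<Longrightarrow> \<exists>a. v = (\<Sum>i<n. s1 (a i) (E i))"
    and u: "u \<in> formal_sums V W"
  shows "\<exists>F. (\<forall>i<n. F i \<in> W) \<and> u - (\<Sum>i<n. free_pair (E i) (F i)) \<in> Rel"
proof -
  define Q where "Q u \<longleftrightarrow> (\<exists>F. (\<forall>i<n. F i \<in> W) \<and> u - (\<Sum>i<n. free_pair (E i) (F i)) \<in> Rel)" for u
  have Q0: "Q 0"
    unfolding Q_def
  proof (intro exI[of _ "\<lambda>i. 0"] conjI allI impI)
    have "(\<Sum>i<n. free_pair (E i) (0::'b)) \<in> Rel"
      using E by (intro free.subspace_sum[OF subspace_Rel] free_pair_0_right) auto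
    from free.subspace_neg[OF subspace_Rel this] show "0 - (\<Sum>i<n. free_pair (E i) (0::'b)) \<in> Rel" by simp
  qed (rule m2.subspace_0[OF W])
  have Qadd: "Q (u + u')" if "Q u" "Q u'" for u u'
  proof -
    from that obtain F F' where F: "\<forall>i<n. F i \<in> W" "u - (\<Sum>i<n. free_pair (E i) (F i)) \<in> Rel"
      and F': "\<forall>i<n. F' i \<in> W" "u' - (\<Sum>i<n. free_pair (E i) (F' i)) \<in> Rel" unfolding Q_def by blast
    have "(\<Sum>i<n. free_pair (E i) (F i + F' i) - free_pair (E i) (F i) - free_pair (E i) (F' i)) \<in> Rel"
      using E F(1) F'(1) by (intro free.subspace_sum[OF subspace_Rel] Rel_generators(2)) auto
    from free.subspace_diff[OF subspace_Rel free.subspace_add[OF subspace_Rel F(2) F'(2)] this]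
    have "u + u' - (\<Sum>i<n. free_pair (E i) (F i + F' i)) \<in> Rel"
      by (simp add: sum_subtractf sum.distrib algebra_simps)
    then show ?thesis
      unfolding Q_def using F(1) F'(1) m2.subspace_add[OF W] by (intro exI[of _ "\<lambda>i. F i + F' i"]) auto
  qed
  have Qscale: "Q (free_scale c u)" if "Q u" for c u
  proof -
    from that obtain F where F: "\<forall>i<n. F i \<in> W" "u - (\<Sum>i<n. free_pair (E i) (F i)) \<in> Rel"
      unfolding Q_def by blast
    have "(\<Sum>i<n. free_pair (E i) (s2 c (F i)) - free_scale c (free_pair (E i) (F i))) \<in> Rel"
      using E F(1) by (intro free.subspace_sum[OF subspace_Rel] Rel_generators(4)) auto
    from free.subspace_diff[OF subspace_Rel free.subspace_scale[OF subspace_Rel F(2), of c] this]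
    have "free_scale c u - (\<Sum>i<n. free_pair (E i) (s2 c (F i))) \<in> Rel"
      by (simp add: sum_subtractf free.scale_right_diff_distrib free.scale_sum_right)
    then show ?thesis
      unfolding Q_def using F(1) m2.subspace_scale[OF W] by (intro exI[of _ "\<lambda>i. s2 c (F i)"]) auto
  qed
  have Qpair: "Q (free_pair v w)" if v: "v \<in> V" and w: "w \<in> W" for v w
  proof -
    obtain a where "v = (\<Sum>i<n. s1 (a i) (E i))" using gen[OF v] by blast
    with free_pair_combination[of n E w a] E w
    have "free_pair v w - (\<Sum>i<n. free_pair (E i) (s2 (a i) w)) \<in> Rel" by blast
    then show ?thesis
      unfolding Q_def using w m2.subspace_scale[OF W] by (intro exI[of _ "\<lambda>i. s2 (a i) w"]) auto
  qed
  have "Q (\<Sum>k\<in>K. free_scale (Poly_Mapping.lookup u k) (free_pair (fst k) (snd k)))"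
    if "finite K" "K \<subseteq> V \<times> W" for K
    using that
  proof (induction K rule: finite_induct)
    case (insert k K)
    have "Q (free_pair (fst k) (snd k))" by (rule Qpair) (use insert in auto)
    with insert show ?case by (simp add: Qadd Qscale)
  qed (simp add: Q0)
  from this[of "Poly_Mapping.keys u"] u show ?thesis
    unfolding Q_def[symmetric] formal_sums_def using formal_sum_expansion[of u] by simp
qed

end

end

section \<open>The sheaf isomorphism\<close>

lemma left_invariant_combination:
  assumes LG: "complex_lie_group N G" and ch: "(U, \<phi>) \<in> atlas N" and one: "\<one>\<^bsub>G\<^esub> \<in> U"
  shows "(\<lambda>g f. \<Sum>i<cdim N. a i * left_frame N G U \<phi> i g f) \<in> left_invariant_fields N G"
proof -
  have "tangent_vector N \<one>\<^bsub>G\<^esub> (\<lambda>f. \<Sum>i<cdim N. a i * cvec N U \<phi> i \<one>\<^bsub>G\<^esub> f)"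
    by (rule tangent_vector_sum) (use tangent_vector_cvec[OF Lie_manifold[OF LG] ch one] in simp)
  from translate_vector_left_invariant[OF LG this]
  show ?thesis by (simp add: translate_vector_def left_frame_def[OF LG ch one])
qed

text \<open>Closure is read off from the frame expansions, by adding or scaling the constant
  coefficients.\<close>

lemma subspace_left_invariant_fields:
  assumes LG: "complex_lie_group N G"
  shows "module.subspace vfield_scale (left_invariant_fields N G)"
proof -
  obtain U \<phi> where c: "(U, \<phi>) \<in> atlas N" "\<one>\<^bsub>G\<^esub> \<in> U" using chart_at[OF Lie_manifold[OF LG]] .
  note comb = left_invariant_combination[OF LG c] and expn = left_invariant_expansion[OF LG c]
  show ?thesis
    unfolding module.subspace_def[OF module_vfield_scale]
  proof (intro conjI ballI allI)
    show "0 \<in> left_invariant_fields N G" using comb[of "\<lambda>i. 0"] by (simp add: zero_fun_def)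
  next
    fix X Y assume "X \<in> left_invariant_fields N G" "Y \<in> left_invariant_fields N G"
    note e = expn[OF this(1)] expn[OF this(2)]
    have "X + Y = (\<lambda>g f. \<Sum>i<cdim N. (X \<one>\<^bsub>G\<^esub> (\<lambda>q. \<phi> q i) + Y \<one>\<^bsub>G\<^esub> (\<lambda>q. \<phi> q i)) * left_frame N G U \<phi> i g f)"
      by (subst e(1), subst e(2)) (simp add: fun_eq_iff sum.distrib distrib_right)
    then show "X + Y \<in> left_invariant_fields N G" by (simp only: comb)
  next
    fix k X assume "X \<in> left_invariant_fields N G"
    note e = expn[OF this]
    have "vfield_scale k X = (\<lambda>g f. \<Sum>i<cdim N. (k * X \<one>\<^bsub>G\<^esub> (\<lambda>q. \<phi> q i)) * left_frame N G U \<phi> i g f)"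
      by (subst e) (simp add: fun_eq_iff vfield_scale_def sum_distrib_left mult.assoc)
    then show "vfield_scale k X \<in> left_invariant_fields N G" by (simp only: comb)
  qed
qed

lemma subspace_first_integrals:
  assumes A: "A \<in> vector_fields M UNIV" and W: "open W"
  shows "module.subspace fun_scale (first_integrals M A W)"
  unfolding module.subspace_def[OF module_fun_scale]
proof (intro conjI ballI allI)
  note tA = vector_fields_tangent[OF A UNIV_I]
  show "0 \<in> first_integrals M A W"
    using hol_on_const[of M 0 W] tv_const[OF tA, of _ 0] by (simp add: first_integrals_def zero_fun_def)
  fix F assume F: "F \<in> first_integrals M A W"
  then have F': "hol_on M F W" "\<And>p. p \<notin> W \<Longrightarrow> F p = 0" "\<And>p. p \<in> W \<Longrightarrow> A p F = 0"
    unfolding first_integrals_def by blast+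
  {
    fix H assume "H \<in> first_integrals M A W"
    then have H: "hol_on M H W" "\<And>p. p \<notin> W \<Longrightarrow> H p = 0" "\<And>p. p \<in> W \<Longrightarrow> A p H = 0"
      unfolding first_integrals_def by blast+
    have "A p (\<lambda>x. F x + H x) = 0" if "p \<in> W" for p
      using tv_add[OF tA hol_nearI[OF W that F'(1)] hol_nearI[OF W that H(1)]] F'(3) H(3) that by simp
    then show "F + H \<in> first_integrals M A W"
      using F' H hol_on_add[OF F'(1) H(1)] unfolding first_integrals_def plus_fun_def by simp
  }
  fix c
  have "A p (\<lambda>x. c * F x) = 0" if "p \<in> W" for p
    using tv_cmult[OF tA hol_nearI[OF W that F'(1)]] F'(3) that by simp
  then show "fun_scale c F \<in> first_integrals M A W"
    using F' hol_on_mult[OF hol_on_const F'(1)] unfolding first_integrals_def fun_scale_def by simp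
qed

lemma restr_first_integral:
  assumes M: "complex_manifold M" and A: "A \<in> vector_fields M UNIV"
    and V: "open V" "V \<subseteq> W" and F: "F \<in> first_integrals M A W"
  shows "restr V F \<in> first_integrals M A V"
proof -
  have F': "hol_on M F V" "\<And>p. p \<in> W \<Longrightarrow> A p F = 0"
    using F hol_on_subset[OF _ V(2)] unfolding first_integrals_def by blast+
  have h: "hol_on M (restr V F) V"
    by (rule hol_on_cong[OF M V(1) _ F'(1)]) (simp add: restr_def)
  have "A p (restr V F) = A p F" if "p \<in> V" for p
    by (rule tv_cong_on[OF M vector_fields_tangent[OF A UNIV_I] h V(1) that]) (simp add: restr_def)
  then show ?thesis using h F'(2) V(2) unfolding first_integrals_def by (auto simp: restr_def)
qed

lemma restr_add: "restr V (F + H) = restr V F + restr V (H :: 'a \<Rightarrow> complex)"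
  by (simp add: restr_def fun_eq_iff)

lemma restr_fun_scale: "restr V (fun_scale c F) = fun_scale c (restr V F)"
  by (simp add: restr_def fun_scale_def fun_eq_iff)

lemma restr_field_times: "field_times M N L (restr V F) = restr V (field_times M N L F)"
  by (auto simp: field_times_def restr_def fun_eq_iff)

lemma restr_vfield_combination:
  fixes X :: "'i \<Rightarrow> 'a vfield"
  shows "restr V (\<Sum>i\<in>I. vfield_scale (c i) (X i)) = (\<Sum>i\<in>I. vfield_scale (c i) (restr V (X i)))"
proof -
  have "restr V (X + Y) = restr V X + restr V Y" "restr V (vfield_scale c X) = vfield_scale c (restr V X)"
    "restr V (0 :: 'a vfield) = 0" for X Y :: "'a vfield" and c
    by (auto simp: restr_def vfield_scale_def fun_eq_iff)
  then show ?thesis by (induction I rule: infinite_finite_induct) auto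
qed

lemma field_times_relations:
  assumes "r \<in> bilinear_relations vfield_scale fun_scale V W"
  shows "formal_eval vfield_scale (field_times M N) r = 0"
proof -
  interpret vf: module vfield_scale by (rule module_vfield_scale)
  have "formal_eval vfield_scale (field_times M N) r \<in> {0}"
    by (rule formal_eval_relations[OF module_vfield_scale _ _ _ _ _ assms])
       (auto simp: field_times_def lift_snd_def fun_scale_def vfield_scale_def fun_eq_iff algebra_simps)
  then show ?thesis by simp
qed

lemma sum_fun_apply2: "(\<Sum>i\<in>I. X i) p f = (\<Sum>i\<in>I. X i p f :: complex)"
  by (induction I rule: infinite_finite_induct) auto

section \<open>The identification with transversal symmetries and its compatibility with
  restriction\<close>

context
  fixes S :: "('s::t2_space) cmanifold" and D :: "'s vfield"
    and N :: "('g::t2_space) cmanifold" and G :: "'g monoid"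
    and A :: "('s \<times> 'g) vfield"
  assumes S: "complex_manifold S" and D: "D \<in> vector_fields S UNIV" and Dnz: "\<And>t. D t \<noteq> 0"
    and LG: "complex_lie_group N G" and A: "automorphic_system S D N G A"
begin

abbreviation (input) "LI \<equiv> left_invariant_fields N G"
abbreviation (input) "FI W \<equiv> first_integrals (prod_manifold S N) A W"
abbreviation (input) "ev \<equiv> formal_eval vfield_scale (field_times S N)"
abbreviation (input) "relations W \<equiv> bilinear_relations vfield_scale fun_scale LI (FI W)"

lemma A_field: "A \<in> vector_fields (prod_manifold S N) UNIV"
  by (rule automorphic_vector_field[OF S D LG A])

lemma LO_field_class:
  assumes "u \<in> formal_sums LI (FI W)"
  shows "LO_field S N (LO_class S N G A W u) = ev u"
  unfolding LO_field_def LO_class_def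
  by (rule tensor_lift_class[OF module_vfield_scale field_times_relations assms mem_tensor_class[OF assms]])

text \<open>In normal form a class evaluates to the combination of the lifted frame with the first
  integrals \<open>F i\<close> as coefficients. Surjectivity is then
  \<open>Trans_frame_expansion\<close>, and injectivity is uniqueness of frame coefficients.\<close>

lemma LO_field_bij_betw:
  assumes W: "open W"
  shows "bij_betw (LO_field S N) (LO S N G A W) (Trans S N A W)"
proof -
  obtain U \<phi> where c: "(U, \<phi>) \<in> atlas N" "\<one>\<^bsub>G\<^esub> \<in> U" using chart_at[OF Lie_manifold[OF LG]] .
  let ?E = "left_frame N G U \<phi>" and ?n = "cdim N"
  interpret free: module free_scale by (rule module_free_scale)
  interpret vf: module vfield_scale by (rule module_vfield_scale)
  have E: "?E i \<in> LI" if "i < ?n" for i by (rule left_frame_invariant[OF LG c that])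
  have gen: "\<exists>a. X = (\<Sum>i<?n. vfield_scale (a i) (?E i))" if "X \<in> LI" for X
  proof -
    have "X = (\<Sum>i<?n. vfield_scale (X \<one>\<^bsub>G\<^esub> (\<lambda>q. \<phi> q i)) (?E i))"
      by (subst left_invariant_expansion[OF LG c that])
         (simp add: fun_eq_iff sum_fun_apply2 vfield_scale_def)
    then show ?thesis by (rule exI[of _ "\<lambda>i. X \<one>\<^bsub>G\<^esub> (\<lambda>q. \<phi> q i)"])
  qed
  have nf: "\<exists>F. (\<forall>i<?n. F i \<in> FI W) \<and> u - (\<Sum>i<?n. free_pair (?E i) (F i)) \<in> relations W"
    if "u \<in> formal_sums LI (FI W)" for u
    using formal_sum_normal_form[OF module_vfield_scale module_fun_scale subspace_left_invariant_fields[OF LG]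
        subspace_first_integrals[OF A_field W], where n = ?n and E = ?E, OF E gen that] .
  have evnf: "ev (\<Sum>i<?n. free_pair (?E i) (F i)) = (\<lambda>p f. \<Sum>i<?n. F i p * lift_snd S N (?E i) p f)" for F
    by (simp add: formal_eval_sum[OF module_vfield_scale] formal_eval_free_pair[OF module_vfield_scale]
          fun_eq_iff sum_fun_apply2 field_times_def)
  have sums: "(\<Sum>i<?n. free_pair (?E i) (F i)) \<in> formal_sums LI (FI W)" if "\<forall>i<?n. F i \<in> FI W" for F
    using E that by (intro free.subspace_sum[OF subspace_formal_sums] free_pair_in_formal_sums) auto
  have ev_eq: "ev u = ev u'" if "u - u' \<in> relations W" for u u'
    using field_times_relations[OF that, of S N] by (simp add: formal_eval_diff[OF module_vfield_scale])
  have LO: "T \<in> LO S N G A W \<longleftrightarrow> (\<exists>u\<in>formal_sums LI (FI W). T = LO_class S N G A W u)" for T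
    by (auto simp: LO_def LO_class_def tensor_def)
  show ?thesis
    unfolding bij_betw_def
  proof
    show "inj_on (LO_field S N) (LO S N G A W)"
    proof (rule inj_onI)
      fix T T' assume "T \<in> LO S N G A W" "T' \<in> LO S N G A W" and eq: "LO_field S N T = LO_field S N T'"
      then obtain u u' where u: "u \<in> formal_sums LI (FI W)" "T = LO_class S N G A W u"
        and u': "u' \<in> formal_sums LI (FI W)" "T' = LO_class S N G A W u'" unfolding LO by blast
      have "ev (u - u') = 0"
        using eq u u' by (simp add: LO_field_class formal_eval_diff[OF module_vfield_scale])
      moreover obtain F where F: "\<forall>i<?n. F i \<in> FI W" "u - u' - (\<Sum>i<?n. free_pair (?E i) (F i)) \<in> relations W"
        using nf[OF free.subspace_diff[OF subspace_formal_sums u(1) u'(1)]] by blast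
      ultimately have z: "(\<lambda>p f. \<Sum>i<?n. F i p * lift_snd S N (?E i) p f) = 0"
        using ev_eq[OF F(2)] by (simp add: evnf)
      have "F i p = 0" if "i < ?n" for i p
        by (rule frame_combination_unique[OF S D LG A c, where c = "\<lambda>i. F i p" and p = p])
           (use fun_cong[OF fun_cong[OF z, of p]] that in simp_all)
      then have "F i = 0" if "i < ?n" for i using that by (intro ext) simp
      \<comment> \<open>All second factors are 0, so the normal form of \<open>u - u'\<close>
        consists of relations and the two classes agree.\<close>
      then have "(\<Sum>i<?n. free_pair (?E i) (F i)) \<in> relations W"
        using E by (intro free.subspace_sum[OF subspace_Rel])
          (auto intro!: free_pair_0_right[OF module_vfield_scale module_fun_scale
              subspace_left_invariant_fields[OF LG] subspace_first_integrals[OF A_field W]])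
      from free.subspace_add[OF subspace_Rel F(2) this] have "u - u' \<in> relations W" by simp
      then show "T = T'" unfolding u u' LO_class_def by (rule tensor_class_eqI)
    qed
    show "LO_field S N ` LO S N G A W = Trans S N A W"
    proof
      show "LO_field S N ` LO S N G A W \<subseteq> Trans S N A W"
      proof clarify
        fix T assume "T \<in> LO S N G A W"
        then obtain u where u: "u \<in> formal_sums LI (FI W)" "T = LO_class S N G A W u" unfolding LO by blast
        obtain F where F: "\<forall>i<?n. F i \<in> FI W" "u - (\<Sum>i<?n. free_pair (?E i) (F i)) \<in> relations W"
          using nf[OF u(1)] by blast
        have "LO_field S N T = (\<lambda>p f. \<Sum>i<?n. F i p * lift_snd S N (?E i) p f)"
          using u ev_eq[OF F(2)] by (simp add: LO_field_class evnf)
        also have "\<dots> \<in> Trans S N A W"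
          by (rule frame_combination_in_Trans[OF S D LG A c W]) (use F(1) in simp)
        finally show "LO_field S N T \<in> Trans S N A W" .
      qed
      show "Trans S N A W \<subseteq> LO_field S N ` LO S N G A W"
      proof
        fix L assume L: "L \<in> Trans S N A W"
        obtain F where F: "\<forall>i<?n. F i \<in> FI W" "L = (\<lambda>p f. \<Sum>i<?n. F i p * lift_snd S N (?E i) p f)"
          using Trans_frame_expansion[OF S D LG A c W Dnz L] .
        then have "L = LO_field S N (LO_class S N G A W (\<Sum>i<?n. free_pair (?E i) (F i)))"
          by (simp add: LO_field_class[OF sums] evnf)
        then show "L \<in> LO_field S N ` LO S N G A W" using LO sums[OF F(1)] by blast
      qed
    qed
  qed
qed

text \<open>Restricting the second factors maps relations over \<open>W\<close> to relations over
  \<open>V\<close>, so it is well defined on classes; it commutes with evaluation because the field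
  F L vanishes wherever F does.\<close>

lemma LO_restr_compatible:
  assumes V: "open V" "V \<subseteq> W" and T: "T \<in> LO S N G A W"
  shows "LO_restr S N G A V T \<in> LO S N G A V"
    and "LO_field S N (LO_restr S N G A V T) = restr V (LO_field S N T)"
proof -
  interpret free: module free_scale by (rule module_free_scale)
  let ?b = "\<lambda>L F. free_pair L (restr V F)"
  let ?\<rho> = "formal_eval free_scale ?b"
  note SN = complex_manifold_prod[OF S Lie_manifold[OF LG]]
  have res: "restr V F \<in> FI V" if "F \<in> FI W" for F
    by (rule restr_first_integral[OF SN A_field V that])
  obtain u where u: "u \<in> formal_sums LI (FI W)" "T = LO_class S N G A W u"
    using T by (auto simp: LO_def LO_class_def tensor_def)
  have rel: "?\<rho> r \<in> relations V" if "r \<in> relations W" for r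
    by (rule formal_eval_relations[OF module_free_scale subspace_Rel _ _ _ _ that])
       (use res in \<open>auto simp: restr_add restr_fun_scale intro: Rel_generators\<close>)
  \<comment> \<open>Independence of the representative, which determines the value of
    \<open>the_elem\<close> in \<open>LO_restr\<close>.\<close>
  have *: "LO_class S N G A V (?\<rho> u') = LO_class S N G A V (?\<rho> u)" if "u' \<in> T" for u'
  proof -
    have "u' - u \<in> relations W" using that u(2) by (simp add: LO_class_def tensor_class_def)
    from rel[OF this] show ?thesis
      unfolding LO_class_def by (intro tensor_class_eqI) (simp add: formal_eval_diff[OF module_free_scale])
  qed
  have "u \<in> T" using mem_tensor_class[OF u(1)] by (simp add: u(2) LO_class_def)
  then have restr: "LO_restr S N G A V T = LO_class S N G A V (?\<rho> u)"
    unfolding LO_restr_def by (intro the_elem_image_unique[OF _ *]) auto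
  have \<rho>u: "?\<rho> u = (\<Sum>k\<in>Poly_Mapping.keys u. free_scale (Poly_Mapping.lookup u k) (?b (fst k) (snd k)))"
    by (simp add: formal_eval_def case_prod_unfold)
  have fs: "?\<rho> u \<in> formal_sums LI (FI V)"
    unfolding \<rho>u
  proof (intro free.subspace_sum[OF subspace_formal_sums] free.subspace_scale[OF subspace_formal_sums] free_pair_in_formal_sums)
    fix k assume "k \<in> Poly_Mapping.keys u"
    then have "k \<in> LI \<times> FI W" using u(1) by (auto simp: formal_sums_def)
    then show "fst k \<in> LI" "restr V (snd k) \<in> FI V" using res by auto
  qed
  show "LO_restr S N G A V T \<in> LO S N G A V"
    using fs unfolding restr LO_def LO_class_def tensor_def by blast
  have "LO_field S N (LO_restr S N G A V T) = ev (?\<rho> u)"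
    unfolding restr by (rule LO_field_class[OF fs])
  also have "\<dots> = (\<Sum>k\<in>Poly_Mapping.keys u.
      vfield_scale (Poly_Mapping.lookup u k) (restr V (field_times S N (fst k) (snd k))))"
    unfolding \<rho>u
    by (simp add: formal_eval_sum[OF module_vfield_scale] formal_eval_scale[OF module_vfield_scale]
          formal_eval_free_pair[OF module_vfield_scale] restr_field_times)
  also have "\<dots> = restr V (ev u)"
    unfolding restr_vfield_combination[symmetric] by (simp add: formal_eval_def case_prod_unfold)
  also have "ev u = LO_field S N T" by (simp add: u LO_field_class)
  finally show "LO_field S N (LO_restr S N G A V T) = restr V (LO_field S N T)" .
qed

end

text \<open>The formula on representatives says that the bijection is the linear map induced by
  sending L \<otimes> F to the field F L; with compatibility under restriction this is an
  isomorphism of sheaves.\<close>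

theorem theorem5p2:
  fixes S :: "('s::t2_space) cmanifold" and D :: "'s vfield"
    and N :: "('g::t2_space) cmanifold" and G :: "'g monoid"
    and A :: "('s \<times> 'g) vfield"
  assumes "riemann_surface S" and "connected (UNIV :: 's set)"
    and "D \<in> vector_fields S UNIV" and "\<And>t. D t \<noteq> 0"
    and "complex_lie_group N G" and "connected (UNIV :: 'g set)"
    and "automorphic_system S D N G A"
  shows "(\<forall>W. open W \<longrightarrow>
            bij_betw (LO_field S N) (LO S N G A W) (Trans S N A W) \<and>
            (\<forall>u \<in> formal_sums (left_invariant_fields N G) (first_integrals (prod_manifold S N) A W).
               LO_field S N (LO_class S N G A W u) = formal_eval vfield_scale (field_times S N) u)) \<and>
         (\<forall>V W. open V \<longrightarrow> open W \<longrightarrow> V \<subseteq> W \<longrightarrow> (\<forall>T \<in> LO S N G A W.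
            LO_restr S N G A V T \<in> LO S N G A V \<and>
            LO_field S N (LO_restr S N G A V T) = restr V (LO_field S N T)))"
proof -
  have S: "complex_manifold S" using assms(1) by (simp add: riemann_surface_def)
  note LO_field_class = LO_field_class[OF S assms(3,4,5,7)]
    and bij = LO_field_bij_betw[OF S assms(3,4,5,7)]
    and restr = LO_restr_compatible[OF S assms(3,4,5,7)]
  show ?thesis using LO_field_class bij restr by blast
qed

end
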